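(* Let $\alpha>0$, $\lambda\in\mathbb{C}\setminus\{0\}$ and $\beta\in\mathbb{C}$ with $\beta\notin\{1/2,0,-1/2,-1,\ldots\}$, $\Re(\beta)>(1-\alpha)/2$ and $\rho(\mathcal{L}_{\Re(\beta)+\alpha})<|\lambda|$. Let $\mathrm{FE}^{\lambda,\beta,\alpha}$ be the set of $f\in C^\alpha((-1,\infty))$ satisfying \[\lambda f(z)-\lambda f(z+1)=\Big(\frac{1}{z+1}\Big)^{2\beta}f\Big(\frac{1}{z+1}\Big)\quad\text{for all }z\in(-1,\infty).\] Then $f\mapsto Q:=f-\lambda^{-1}L_\beta(f)$ defines a map $\mathcal{A}^{\lambda,\beta,\alpha}:\mathrm{FE}^{\lambda,\beta,\alpha}\to C^\alpha(\mathbb{R}/\mathbb{Z})$, and this map is bijective if and only if $\lambda\notin\sigma(\mathcal{L}_\beta)$.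
   Context: $C^\alpha((-1,\infty))$ is the space of functions on $(-1,\infty)$ which on every compact subset are $\lfloor\alpha\rfloor$ times differentiable with $\lfloor\alpha\rfloor$-th derivative continuous (if $\alpha\in\mathbb{Z}$) or $(\alpha-\lfloor\alpha\rfloor)$-Hölder (otherwise). $C^\alpha(\mathbb{R}/\mathbb{Z})$ is the analogous space of functions on the circle, identified with $1$-periodic functions on $(-1,\infty)$. With $k=\lfloor\alpha\rfloor$ and $\zeta_H(s,z)=\sum_{n\ge0}(n+z)^{-s}$ the meromorphically continued Hurwitz zeta function, $L_\beta$ acts on $f\in C^\alpha((-1,\infty))$ by \[L_\beta(f)(z)=\sum_{n=0}^{k}\frac{f^{(n)}(0)}{n!}\zeta_H(n+2\beta,z+1)+\sum_{n=1}^\infty\frac{1}{(n+z)^{2\beta}}f^\star\!\Big(\frac1{n+z}\Big),\quad f^\star(w)=f(w)-\sum_{n=0}^k\frac{f^{(n)}(0)}{n!}w^n,\ z\in(-1,\infty).\] Let $D=\{z:|z-1|<3/2\}$ and $A_\infty(D)$ the Banach space of functions holomorphic on $D$ and continuous on $\overline D$; $\mathcal{L}_\beta$ is the operator on $A_\infty(D)$ given by the same formula (the meromorphic continuation in $\beta$ of $f\mapsto\sum_{n\ge1}(n+z)^{-2\beta}f(1/(n+z))$), $\sigma(\mathcal{L}_\beta)$ its spectrum, and for real $t>1/2$, $\rho(\mathcal{L}_t)$ is the spectral radius of $\mathcal{L}_t$. *)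

theory Defs
  imports "HOL-Complex_Analysis.Complex_Analysis"
begin

text \<open>
  Functions on a subset of a type are represented by total functions that vanish outside that
  subset, so that equality of functions is equality on the subset and the vector space operations
  are the pointwise ones.
\<close>

definition vderiv :: "nat \<Rightarrow> (real \<Rightarrow> complex) \<Rightarrow> real \<Rightarrow> complex" where
  "vderiv n f = ((\<lambda>g x. vector_derivative g (at x)) ^^ n) f"

definition C_alpha :: "real \<Rightarrow> (real \<Rightarrow> complex) set" where
  "C_alpha \<alpha> = {f.
     (\<forall>x. x \<notin> {-1<..} \<longrightarrow> f x = 0) \<and>
     (\<forall>n < nat \<lfloor>\<alpha>\<rfloor>. \<forall>x \<in> {-1<..}. vderiv n f differentiable (at x)) \<and>
     (\<forall>K. compact K \<and> K \<subseteq> {-1<..} \<longrightarrow>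
        (if \<alpha> \<in> \<int> then continuous_on K (vderiv (nat \<lfloor>\<alpha>\<rfloor>) f)
         else \<exists>C. \<forall>x\<in>K. \<forall>y\<in>K.
           norm (vderiv (nat \<lfloor>\<alpha>\<rfloor>) f x - vderiv (nat \<lfloor>\<alpha>\<rfloor>) f y)
             \<le> C * \<bar>x - y\<bar> powr (\<alpha> - of_int \<lfloor>\<alpha>\<rfloor>)))}"

text \<open>The space of \<open>C\<^sup>\<alpha>\<close> functions on the circle, as 1-periodic functions on \<open>(-1, \<infinity>)\<close>.\<close>

definition C_alpha_per :: "real \<Rightarrow> (real \<Rightarrow> complex) set" where
  "C_alpha_per \<alpha> = {q \<in> C_alpha \<alpha>. \<forall>z > -1. q (z + 1) = q z}"

text \<open>
  The continuation in \<open>s\<close> exists for \<open>Re a > 0\<close> and is unique on \<open>- {1}\<close> by the identity theorem;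
  the value at the pole \<open>s = 1\<close> is unspecified.
\<close>

definition hurwitz_zeta :: "complex \<Rightarrow> complex \<Rightarrow> complex" where
  "hurwitz_zeta s a =
     (SOME g. g holomorphic_on (- {1}) \<and>
        (\<forall>w. Re w > 1 \<longrightarrow> (\<lambda>n. (of_nat n + a) powr (- w)) sums g w)) s"

definition L_op :: "real \<Rightarrow> complex \<Rightarrow> (real \<Rightarrow> complex) \<Rightarrow> real \<Rightarrow> complex" where
  "L_op \<alpha> \<beta> f z =
     (let k = nat \<lfloor>\<alpha>\<rfloor>;
          fstar = (\<lambda>w. f w - (\<Sum>n\<le>k. vderiv n f 0 / fact n * of_real w ^ n))
      in if z > -1 then
           (\<Sum>n\<le>k. vderiv n f 0 / fact n * hurwitz_zeta (of_nat n + 2 * \<beta>) (of_real (z + 1)))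
           + (\<Sum>m. of_real (real (Suc m) + z) powr (- (2 * \<beta>)) * fstar (1 / (real (Suc m) + z)))
         else 0)"

definition FE :: "complex \<Rightarrow> complex \<Rightarrow> real \<Rightarrow> (real \<Rightarrow> complex) set" where
  "FE lam \<beta> \<alpha> = {f \<in> C_alpha \<alpha>. \<forall>z > -1.
     lam * f z - lam * f (z + 1) = of_real (1 / (z + 1)) powr (2 * \<beta>) * f (1 / (z + 1))}"

definition A_map :: "complex \<Rightarrow> complex \<Rightarrow> real \<Rightarrow> (real \<Rightarrow> complex) \<Rightarrow> real \<Rightarrow> complex" where
  "A_map lam \<beta> \<alpha> f = (\<lambda>z. f z - inverse lam * L_op \<alpha> \<beta> f z)"

definition disc_D :: "complex set" where
  "disc_D = ball 1 (3/2)"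

definition A_inf :: "complex set \<Rightarrow> (complex \<Rightarrow> complex) set" where
  "A_inf D = {f. (\<forall>z. z \<notin> closure D \<longrightarrow> f z = 0) \<and> f holomorphic_on D \<and> continuous_on (closure D) f}"

definition sup_norm :: "complex set \<Rightarrow> (complex \<Rightarrow> complex) \<Rightarrow> real" where
  "sup_norm D f = (SUP z\<in>closure D. norm (f z))"

definition bounded_op :: "complex set \<Rightarrow> ((complex \<Rightarrow> complex) \<Rightarrow> (complex \<Rightarrow> complex)) \<Rightarrow> bool" where
  "bounded_op D T \<longleftrightarrow>
     T \<in> A_inf D \<rightarrow> A_inf D \<and>
     (\<forall>f\<in>A_inf D. \<forall>g\<in>A_inf D. T (\<lambda>z. f z + g z) = (\<lambda>z. T f z + T g z)) \<and>
     (\<forall>c. \<forall>f\<in>A_inf D. T (\<lambda>z. c * f z) = (\<lambda>z. c * T f z)) \<and>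
     (\<exists>C. \<forall>f\<in>A_inf D. sup_norm D (T f) \<le> C * sup_norm D f)"

definition op_spectrum :: "complex set \<Rightarrow> ((complex \<Rightarrow> complex) \<Rightarrow> (complex \<Rightarrow> complex)) \<Rightarrow> complex set" where
  "op_spectrum D T = {\<mu>. \<not> (\<exists>S. bounded_op D S \<and>
     (\<forall>f\<in>A_inf D. S (\<lambda>z. \<mu> * f z - T f z) = f \<and> (\<lambda>z. \<mu> * S f z - T (S f) z) = f))}"

definition op_spectral_radius :: "complex set \<Rightarrow> ((complex \<Rightarrow> complex) \<Rightarrow> (complex \<Rightarrow> complex)) \<Rightarrow> real" where
  "op_spectral_radius D T = (SUP \<mu>\<in>op_spectrum D T. norm \<mu>)"

text \<open>
  The transfer operator on \<open>A_inf disc_D\<close>, by the same formula as \<^const>\<open>L_op\<close>. The \<open>m\<close>-series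
  converges when \<open>Re \<beta> > - k / 2\<close> with \<open>k = \<lfloor>\<alpha>\<rfloor>\<close>, in particular when \<open>Re \<beta> > (1 - \<alpha>) / 2\<close>; for
  \<open>\<beta>\<close> in that half-plane and off the poles the value does not depend on \<open>\<alpha>\<close>, and for
  \<open>Re \<beta> > 1/2\<close> it is the sum of \<open>(m + z) powr (- 2 \<beta>) * f (1 / (m + z))\<close> over \<open>m \<ge> 1\<close>.
\<close>

definition transfer_op :: "real \<Rightarrow> complex \<Rightarrow> (complex \<Rightarrow> complex) \<Rightarrow> complex \<Rightarrow> complex" where
  "transfer_op \<alpha> \<beta> f z =
     (let k = nat \<lfloor>\<alpha>\<rfloor>;
          fstar = (\<lambda>w. f w - (\<Sum>n\<le>k. (deriv ^^ n) f 0 / fact n * w ^ n))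
      in if z \<in> closure disc_D then
           (\<Sum>n\<le>k. (deriv ^^ n) f 0 / fact n * hurwitz_zeta (of_nat n + 2 * \<beta>) (z + 1))
           + (\<Sum>m. (of_nat (Suc m) + z) powr (- (2 * \<beta>)) * fstar (1 / (of_nat (Suc m) + z)))
         else 0)"

end

theory Submission
  imports Defs "HOL-Library.Nat_Bijection"
begin

text \<open>
  Write \<open>M = L\<^sub>\<beta> / \<lambda>\<close>, \<open>k = \<lfloor>\<alpha>\<rfloor>\<close> and \<open>t = Re \<beta> + \<alpha>\<close>. The operator satisfies
  \<open>L f(z) - L f(z + 1) = (z + 1)\<^sup>-\<^sup>2\<^sup>\<beta> f(1 / (z + 1))\<close>, so for \<open>f\<close> in \<open>C\<^sup>\<alpha>\<close> the functional
  equation says exactly that \<open>f - M f\<close> is periodic, and the question is whether \<open>1 - M\<close> is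
  bijective on \<open>C\<^sup>\<alpha>\<close>. By the formula for \<open>M\<close> only the interval \<open>(-1/2, 5/2)\<close> matters.

  For a word \<open>w\<close> of inverse branches \<open>z \<mapsto> 1 / (m + z)\<close> let \<open>\<phi>\<^sub>w(z)\<close> be the composition and
  \<open>c\<^sub>w z + d\<^sub>w\<close> its denominator. The spectral radius hypothesis, through positivity of the
  resolvent of \<open>\<L>\<^sub>t\<close> at \<open>|\<lambda>|\<close>, gives that the sum of \<open>|\<lambda>|\<^sup>-\<^sup>|\<^sup>w\<^sup>| d\<^sub>w\<^sup>-\<^sup>2\<^sup>t\<close> over all words is
  finite. Let \<open>E\<^sub>n q\<close> be the sum over words of length \<open>n\<close> of
  \<open>\<lambda>\<^sup>-\<^sup>n (c\<^sub>w z + d\<^sub>w)\<^sup>-\<^sup>2\<^sup>\<beta> (q - T\<^sub>w q)(\<phi>\<^sub>w(z))\<close>, where \<open>T\<^sub>w q\<close> is the Taylor polynomial of degree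
  \<open>k\<close> of \<open>q\<close> at \<open>\<phi>\<^sub>w(0)\<close>. These sums converge in \<open>C\<^sup>\<alpha>\<close> even when summed over \<open>n\<close>, they vanish
  to order \<open>k\<close> at \<open>0\<close>, so that no regularisation is needed in \<open>M E\<^sub>n q\<close>, and
  \<open>E\<^sub>n\<^sub>+\<^sub>1 q = M E\<^sub>n q - d\<^sub>n\<close> with \<open>d\<^sub>n\<close> in the disc algebra.

  If \<open>\<lambda>\<close> is not in the spectrum, then \<open>e = \<Sum>\<^sub>n E\<^sub>n q\<close> satisfies \<open>e - M e = q - a\<close> with \<open>a\<close> in the
  disc algebra, and adding \<open>(1 - M)\<^sup>-\<^sup>1 a\<close> solves \<open>f - M f = q\<close>. If \<open>f = M f\<close>, then \<open>f - E\<^sub>n f\<close> is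
  the restriction of a function \<open>G\<^sub>n\<close> in the disc algebra with \<open>G\<^sub>n\<^sub>+\<^sub>1 = M G\<^sub>n + d\<^sub>n\<close>; since
  \<open>G\<^sub>n\<^sub>+\<^sub>1 - G\<^sub>n\<close> tends to \<open>0\<close> on the interval, Montel's theorem makes it tend to \<open>0\<close> in norm, so
  \<open>(1 - M) G\<^sub>n\<close> and hence \<open>G\<^sub>n\<close> tend to \<open>0\<close>, and \<open>f = 0\<close>. If \<open>\<lambda>\<close> is in the spectrum, the Fredholm
  alternative provides an eigenfunction, which lies in the kernel of \<open>1 - M\<close>.
\<close>

section \<open>The Hurwitz zeta function\<close>

text \<open>The expansion point moves with the word because |\<open>phi w z\<close> -
  \<open>phi w 0\<close>| is of order d_w^(-2): a remainder taken there gains d_w^(-2 \<alpha>) over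
  the weight d_w^(-2 Re \<beta>), and the product is exactly the summand d_w^(-2t) controlled by the
  spectral hypothesis. A remainder taken at 0 would gain nothing from long words. The price is the
  change from \<open>phi w 0\<close> to \<open>phi (m # w) 0\<close>, which involves only Taylor
  polynomials and is therefore holomorphic; its size is again d_w^(-2t), times (m + 1)^(-2 Re
  \<beta> - \<alpha>), and the assumption on Re \<beta> makes this factor summable. Derivatives and
  Hoelder quotients are only kept bounded, uniformly in w; all decay sits in scalar weights. So
  integral \<alpha>, where the top derivative is merely continuous, fits the same estimates. On the
  disc everything rests on one gain of domain: for Re z > -3/5 all branch values lie in D, so the
  operator sends the disc algebra to bounded functions on a disc of radius 8/5 > 3/2. Both the
  Fredholm alternative and the use of Montel's theorem come from this.\<close>

lemma cmod_powr_le: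
  assumes "z \<noteq> 0"
  shows "cmod (z powr s) \<le> cmod z powr Re s * exp (pi * \<bar>Im s\<bar>)"
proof -
  have "cmod (z powr s) = exp (Re s * ln (cmod z) - Im s * Im (Ln z))"
    using assms by (simp add: powr_def)
  also have "\<dots> = cmod z powr Re s * exp (- (Im s * Im (Ln z)))"
    using assms by (simp add: powr_def exp_diff exp_minus field_simps)
  also have "- (Im s * Im (Ln z)) \<le> pi * \<bar>Im s\<bar>"
  proof -
    have "\<bar>Im (Ln z)\<bar> \<le> pi" using Im_Ln_le_pi[OF assms] mpi_less_Im_Ln[OF assms] by linarith
    then have "\<bar>Im s * Im (Ln z)\<bar> \<le> \<bar>Im s\<bar> * pi"
      by (simp add: abs_mult mult_left_mono)
    then show ?thesis by (simp add: mult.commute)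
  qed
  finally show ?thesis by (simp add: mult_left_mono)
qed

lemma cmod_powr_minus_le:
  assumes "0 < r" "r \<le> cmod z" "0 \<le> Re s"
  shows "cmod (z powr (- s)) \<le> r powr (- Re s) * exp (pi * \<bar>Im s\<bar>)"
proof -
  have "cmod (z powr (- s)) \<le> cmod z powr (- Re s) * exp (pi * \<bar>Im s\<bar>)"
    using cmod_powr_le[of z "-s"] assms by (cases "z = 0") auto
  also have "cmod z powr (- Re s) \<le> r powr (- Re s)"
    using assms by (simp add: powr_mono2')
  finally show ?thesis by (simp add: mult_right_mono)
qed

lemma Re_pos_not_nonpos: "0 < Re z \<Longrightarrow> z \<notin> \<real>\<^sub>\<le>\<^sub>0"
  by (auto simp: complex_nonpos_Reals_iff)

lemma summable_Suc_powr: "1 < s \<Longrightarrow> summable (\<lambda>n. real (Suc n) powr (- s))"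
  using summable_Suc_iff[of "\<lambda>n. real n powr (-s)"] by (simp add: summable_real_powr_iff)

lemma summable_shift_powr:
  assumes "0 < c" "1 < s"
  shows "summable (\<lambda>n. (real n + c) powr (- s))"
proof (rule summable_comparison_test_ev)
  show "\<forall>\<^sub>F n in sequentially. norm ((real n + c) powr (- s)) \<le> real n powr (- s)"
    using eventually_gt_at_top[of 0]
  proof eventually_elim
    case (elim n)
    then show ?case using assms by (auto intro!: powr_mono2')
  qed
  show "summable (\<lambda>n. real n powr - s)" using assms by (simp add: summable_real_powr_iff)
qed

text \<open>The majorant is required only from n = 1 on because those used for the zeta series are
  multiples of \<open>real n powr (- \<sigma>)\<close>, which is 0 at n = 0; one term affects
  neither convergence nor holomorphy.\<close>

lemma holomorphic_on_suminf_local: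
  fixes f :: "nat \<Rightarrow> complex \<Rightarrow> complex"
  assumes S: "open S" and hol: "\<And>n. f n holomorphic_on S"
    and bd: "\<And>x. x \<in> S \<Longrightarrow> \<exists>d>0. \<exists>h. summable h \<and> (\<forall>n\<ge>1. \<forall>y\<in>ball x d \<inter> S. norm (f n y) \<le> h n)"
  shows "(\<lambda>z. \<Sum>n. f n z) holomorphic_on S"
proof -
  have "\<exists>g g'. \<forall>x \<in> S. ((\<lambda>n. f n x) sums g x) \<and> ((\<lambda>n. deriv (f n) x) sums g' x) \<and> (g has_field_derivative g' x) (at x)"
  proof (rule series_and_derivative_comparison_local[OF S])
    show "(f n has_field_derivative deriv (f n) x) (at x)" if "x \<in> S" for n x
      using hol S that by (meson holomorphic_derivI)
    show "\<exists>d h. 0 < d \<and> summable h \<and> (\<forall>\<^sub>F n in sequentially. \<forall>y\<in>ball x d \<inter> S. norm (f n y) \<le> h n)" if "x \<in> S" for x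
    proof -
      obtain d h where "d>0" "summable h" "\<And>n y. n\<ge>1 \<Longrightarrow> y\<in>ball x d \<inter> S \<Longrightarrow> norm (f n y) \<le> h n"
        using bd[OF \<open>x \<in> S\<close>] by blast
      then show ?thesis
        by (intro exI[of _ d] exI[of _ h] conjI eventually_sequentiallyI[of 1]) auto
    qed
  qed
  then obtain g g' where g: "\<And>x. x \<in> S \<Longrightarrow> (\<lambda>n. f n x) sums g x" "\<And>x. x \<in> S \<Longrightarrow> (g has_field_derivative g' x) (at x)"
    by blast
  have "g holomorphic_on S"
    using g(2) S by (auto simp: holomorphic_on_open)
  moreover have "g z = (\<Sum>n. f n z)" if "z \<in> S" for z
    using g(1)[OF that] sums_unique by blast
  ultimately show ?thesis by (simp cong: holomorphic_cong)
qed

text \<open>The Taylor remainder at u = 1 of (x + u)^(1 - s) expanded at u = 0 up to order J, that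
  is, the error of the binomial expansion of (x + 1)^(1 - s) in descending powers of x.\<close>

definition binom_rem :: "nat \<Rightarrow> complex \<Rightarrow> complex \<Rightarrow> complex" where
  "binom_rem J s x = (x + 1) powr (1 - s) - (\<Sum>j\<le>J. ((1 - s) gchoose j) * x powr (1 - s - of_nat j))"

text \<open>Taylor's formula on the half-plane Re u >= 0, where |x + u| >= Re x keeps the derivative
  of order J + 1 below a multiple of (Re x)^(-(Re s + J)). This decay is what moves the convergence
  of the sum over x = n + a to the left in s.\<close>

lemma binom_rem_bound:
  assumes x: "0 < Re x" and s: "0 \<le> Re s + J"
  shows "cmod (binom_rem J s x) \<le>
     (fact (Suc J) / fact J * cmod ((1 - s) gchoose Suc J) * exp (pi * \<bar>Im s\<bar>)) * Re x powr (- (Re s + J))"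
proof -
  define f where "f i u = fact i * ((1 - s) gchoose i) * (x + u) powr (1 - s - of_nat i)" for i u
  define B where "B = fact (Suc J) * cmod ((1 - s) gchoose Suc J) * (Re x powr (- (Re s + J)) * exp (pi * \<bar>Im s\<bar>))"
  have "cmod (f 0 1 - (\<Sum>i\<le>J. f i 0 * (1 - 0) ^ i / fact i)) \<le> B * cmod (1 - 0) ^ Suc J / fact J"
  proof (rule complex_Taylor[where S = "{u. Re u \<ge> 0}"])
    show "convex {u. Re u \<ge> 0}" by (rule convex_halfspace_Re_ge)
  next
    fix i u assume u: "u \<in> {u. Re u \<ge> 0}"
    then have "x + u \<notin> \<real>\<^sub>\<le>\<^sub>0" using x by (intro Re_pos_not_nonpos) auto
    then have "(f i has_field_derivative fact i * ((1 - s) gchoose i) * ((1 - s - of_nat i) * (x + u) powr (1 - s - of_nat i - 1))) (at u)"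
      unfolding f_def by (auto intro!: derivative_eq_intros has_field_derivative_powr)
    moreover have "fact i * ((1 - s) gchoose i) * (1 - s - of_nat i) = fact (Suc i) * ((1 - s) gchoose Suc i)"
    proof -
      have "((1 - s) gchoose i) * (1 - s - of_nat i) = of_nat (Suc i) * ((1 - s) gchoose Suc i)"
        using gbinomial_mult_1[of "1 - s" i] by (simp add: algebra_simps)
      then show ?thesis by (simp add: mult.assoc)
    qed
    then have "fact i * ((1 - s) gchoose i) * ((1 - s - of_nat i) * (x + u) powr (1 - s - of_nat i - 1)) = f (Suc i) u"
      unfolding f_def mult.assoc[symmetric] by (simp add: diff_diff_eq add_ac del: fact_Suc)
    ultimately show "(f i has_field_derivative f (Suc i) u) (at u within {u. Re u \<ge> 0})"
      by (simp add: has_field_derivative_at_within)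
  next
    fix u assume u: "u \<in> {u. Re u \<ge> 0}"
    have "Re x \<le> cmod (x + u)" using u complex_Re_le_cmod[of "x+u"] by auto
    then have "cmod ((x + u) powr (- (s + of_nat J))) \<le> Re x powr (- (Re s + J)) * exp (pi * \<bar>Im s\<bar>)"
      using cmod_powr_minus_le[of "Re x" "x + u" "s + of_nat J"] x s by simp
    moreover have "1 - s - of_nat (Suc J) = - (s + of_nat J)" by simp
    ultimately show "cmod (f (Suc J) u) \<le> B"
      unfolding f_def B_def by (simp only: norm_mult norm_fact) (intro mult_left_mono, auto)
  qed auto
  moreover have "f 0 1 - (\<Sum>i\<le>J. f i 0 * (1 - 0) ^ i / fact i) = binom_rem J s x"
    unfolding f_def binom_rem_def by simp
  ultimately show ?thesis unfolding B_def by (simp add: field_simps del: fact_Suc)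
qed

lemma holomorphic_gchoose [holomorphic_intros]:
  "f holomorphic_on S \<Longrightarrow> (\<lambda>s. (f s) gchoose j) holomorphic_on S"
  unfolding gbinomial_prod_rev by (intro holomorphic_intros) auto

text \<open>
  \<open>hurwitz_aux N\<close> is \<open>(s - 1) \<zeta>(s, a)\<close> on \<open>Re s > 1 - N\<close>. The recursion comes from summing the binomial
  expansion of \<open>x\<^sup>1\<^sup>-\<^sup>s - (x + 1)\<^sup>1\<^sup>-\<^sup>s\<close> over \<open>x = n + a\<close>; the factor \<open>s - 1\<close> keeps it free of poles,
  as \<open>(1 - s gchoose j) / (s + j - 2)\<close> is a polynomial.
\<close>

fun hurwitz_aux :: "nat \<Rightarrow> complex \<Rightarrow> complex \<Rightarrow> complex" where
  "hurwitz_aux 0 s a = (s - 1) * (\<Sum>n. (of_nat n + a) powr (- s))"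
| "hurwitz_aux (Suc N) s a = a powr (1 - s)
     - (\<Sum>i<N. ((1 - s) gchoose Suc i) / of_nat (i + 2) * hurwitz_aux N (s + of_nat (Suc i)) a)
     + (\<Sum>n. binom_rem (Suc N) s (of_nat n + a))"

lemma hurwitz_series_bound:
  assumes a: "0 < Re a" and s: "0 \<le> Re s"
  shows "cmod ((of_nat n + a) powr (- s)) \<le> (real n + Re a) powr (- Re s) * exp (pi * \<bar>Im s\<bar>)"
  using cmod_powr_minus_le[of "real n + Re a" "of_nat n + a" s] complex_Re_le_cmod[of "of_nat n + a"] assms
  by auto

lemma hurwitz_series_summable:
  assumes a: "0 < Re a" and s: "1 < Re s"
  shows "summable (\<lambda>n. (of_nat n + a) powr (- s))"
  by (rule summable_comparison_test'[OF summable_mult2[OF summable_shift_powr[OF a s]], of 0 _ "exp (pi * \<bar>Im s\<bar>)"])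
     (use hurwitz_series_bound[OF a, of s] s in auto)

lemma powr_shift_le:
  assumes "1 \<le> n" "0 < c" "0 \<le> \<sigma>" "\<sigma> \<le> r"
  shows "(real n + c) powr (- r) \<le> real n powr (- \<sigma>)"
proof -
  have "(real n + c) powr (- r) \<le> real n powr (- r)"
    using assms by (intro powr_mono2') auto
  also have "\<dots> \<le> real n powr (-\<sigma>)" using assms by (intro powr_mono) auto
  finally show ?thesis .
qed

lemma summable_powr_mult: "1 < \<sigma> \<Longrightarrow> summable (\<lambda>n. C * real n powr (- \<sigma>))"
  by (intro summable_mult) (simp add: summable_real_powr_iff)

lemma ball_Im_bound: "y \<in> ball x 1 \<Longrightarrow> \<bar>Im y\<bar> \<le> \<bar>Im x\<bar> + 1"
  using abs_Im_le_cmod[of "x - y"] by (simp add: dist_norm)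

lemma holomorphic_binom_rem_s:
  "0 < Re x \<Longrightarrow> (\<lambda>s. binom_rem J s x) holomorphic_on S"
  unfolding binom_rem_def by (intro holomorphic_intros holomorphic_on_sum)

text \<open>Each step gains one unit: the remainders of order \<open>Suc N\<close> are summable as
  soon as Re s + N + 1 > 1, and the arguments s + i + 1 in the recursion already lie in the
  half-plane of the previous step.\<close>

lemma hurwitz_aux_holomorphic_s:
  assumes a: "0 < Re a"
  shows "(\<lambda>s. hurwitz_aux N s a) holomorphic_on {s. Re s > 1 - real N}"
proof (induction N)
  case 0
  have "(\<lambda>s. \<Sum>n. (of_nat n + a) powr (- s)) holomorphic_on {s. Re s > 1}"
  proof (rule holomorphic_on_suminf_local)
    show "open {s. Re s > 1}" by (rule open_halfspace_Re_gt)
    show "(\<lambda>s. (of_nat n + a) powr (- s)) holomorphic_on {s. Re s > 1}" for n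
      by (intro holomorphic_intros) 
    fix x assume x: "x \<in> {s. Re s > 1}"
    define \<sigma> where "\<sigma> = (1 + Re x) / 2"
    have \<sigma>: "1 < \<sigma>" "\<sigma> < Re x" using x by (auto simp: \<sigma>_def field_simps)
    show "\<exists>d>0. \<exists>h. summable h \<and> (\<forall>n\<ge>1. \<forall>y\<in>ball x d \<inter> {s. Re s > 1}. norm ((of_nat n + a) powr (- y)) \<le> h n)"
    proof (intro exI conjI allI impI ballI)
      show "0 < min 1 (Re x - \<sigma>)" using \<sigma> by simp
      show "summable (\<lambda>n. exp (pi * (\<bar>Im x\<bar> + 1)) * real n powr (- \<sigma>))"
        using \<sigma> by (intro summable_powr_mult)
      fix n :: nat and y assume n: "1 \<le> n" and y: "y \<in> ball x (min 1 (Re x - \<sigma>)) \<inter> {s. Re s > 1}"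
      have "\<bar>Im y\<bar> \<le> \<bar>Im x\<bar> + 1" using y by (intro ball_Im_bound) auto
      moreover have "Re x - Re y \<le> dist x y" using complex_Re_le_cmod[of "x - y"] by (simp add: dist_norm)
      then have "\<sigma> \<le> Re y" using y by auto
      moreover have "0 \<le> Re y" using y by auto
      ultimately show "norm ((of_nat n + a) powr (- y)) \<le> exp (pi * (\<bar>Im x\<bar> + 1)) * real n powr (- \<sigma>)"
        using \<sigma> by (intro order_trans[OF hurwitz_series_bound[OF a]])
          (auto simp: mult.commute[of "exp _"] intro!: mult_mono powr_shift_le n a)
    qed
  qed
  then show ?case by (auto intro!: holomorphic_intros)
next
  case (Suc N)
  let ?S = "{s. Re s > 1 - real (Suc N)}"
  have "(\<lambda>s. \<Sum>n. binom_rem (Suc N) s (of_nat n + a)) holomorphic_on ?S"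
  proof (rule holomorphic_on_suminf_local)
    show "open ?S" by (rule open_halfspace_Re_gt)
    show "(\<lambda>s. binom_rem (Suc N) s (of_nat n + a)) holomorphic_on ?S" for n
      using a by (intro holomorphic_binom_rem_s) auto
    fix x assume x: "x \<in> ?S"
    define \<sigma> where "\<sigma> = (1 + (Re x + Suc N)) / 2"
    have \<sigma>: "1 < \<sigma>" "\<sigma> < Re x + Suc N" using x by (auto simp: \<sigma>_def field_simps)
    have "continuous_on (cball x 1) (\<lambda>s. (1 - s) gchoose Suc (Suc N))"
      by (intro holomorphic_on_imp_continuous_on holomorphic_intros)
    then have "bounded ((\<lambda>s. (1 - s) gchoose Suc (Suc N)) ` cball x 1)"
      by (intro compact_imp_bounded compact_continuous_image) auto
    then obtain K where K: "\<And>y. y \<in> cball x 1 \<Longrightarrow> cmod ((1 - y) gchoose Suc (Suc N)) \<le> K"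
      unfolding bounded_iff by blast
    have K0: "0 \<le> K" using K[of x] norm_ge_zero order_trans by (metis centre_in_cball zero_le_one)
    define C where "C = fact (Suc (Suc N)) / fact (Suc N) * K * exp (pi * (\<bar>Im x\<bar> + 1))"
    show "\<exists>d>0. \<exists>h. summable h \<and> (\<forall>n\<ge>1. \<forall>y\<in>ball x d \<inter> ?S. norm (binom_rem (Suc N) y (of_nat n + a)) \<le> h n)"
    proof (intro exI conjI allI impI ballI)
      show "0 < min 1 (Re x + Suc N - \<sigma>)" using \<sigma> by simp
      show "summable (\<lambda>n. C * real n powr (- \<sigma>))"
        using \<sigma> by (intro summable_powr_mult)
      fix n :: nat and y assume n: "1 \<le> n" and y: "y \<in> ball x (min 1 (Re x + Suc N - \<sigma>)) \<inter> ?S"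
      have im: "\<bar>Im y\<bar> \<le> \<bar>Im x\<bar> + 1" using y by (intro ball_Im_bound) auto
      have "Re x - Re y \<le> dist x y" using complex_Re_le_cmod[of "x - y"] by (simp add: dist_norm)
      then have sy: "\<sigma> \<le> Re y + Suc N" using y by auto
      have Ky: "cmod ((1 - y) gchoose Suc (Suc N)) \<le> K" using K[of y] y by auto
      have "norm (binom_rem (Suc N) y (of_nat n + a)) \<le> fact (Suc (Suc N)) / fact (Suc N) * cmod ((1 - y) gchoose Suc (Suc N)) * exp (pi * \<bar>Im y\<bar>) * Re (of_nat n + a) powr (- (Re y + Suc N))"
        using sy \<sigma> a by (intro binom_rem_bound) auto
      also have "\<dots> \<le> C * real n powr (- \<sigma>)"
        unfolding C_def using im Ky K0 sy \<sigma> powr_shift_le[OF n a, of \<sigma> "Re y + Suc N"]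
        by (intro mult_mono) (auto simp del: fact_Suc)
      finally show "norm (binom_rem (Suc N) y (of_nat n + a)) \<le> C * real n powr (- \<sigma>)" .
    qed
  qed
  moreover have "(\<lambda>s. hurwitz_aux N (s + of_nat (Suc i)) a) holomorphic_on ?S" for i
  proof -
    have "(\<lambda>s. s + of_nat (Suc i)) ` ?S \<subseteq> {s. Re s > 1 - real N}" by auto
    moreover have "(\<lambda>s. s + of_nat (Suc i)) holomorphic_on ?S" by (intro holomorphic_intros)
    ultimately show ?thesis
      using holomorphic_on_compose_gen[OF _ Suc.IH, of "\<lambda>s. s + of_nat (Suc i)" ?S] by (simp only: o_def)
  qed
  ultimately show ?case
    unfolding hurwitz_aux.simps by (intro holomorphic_intros) (use a in auto)
qed

lemma hurwitz_aux_holomorphic_a: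
  assumes "Re s > 1 - real N"
  shows "hurwitz_aux N s holomorphic_on {a. 0 < Re a}"
  using assms
proof (induction N arbitrary: s)
  case 0
  then have s: "1 < Re s" by simp
  have "(\<lambda>a. \<Sum>n. (of_nat n + a) powr (- s)) holomorphic_on {a. 0 < Re a}"
  proof (rule holomorphic_on_suminf_local)
    show "open {s. 0 < Re s}" by (rule open_halfspace_Re_gt)
    show "(\<lambda>a. (of_nat n + a) powr (- s)) holomorphic_on {a. 0 < Re a}" for n
      by (intro holomorphic_intros) (auto intro!: Re_pos_not_nonpos)
    show "\<exists>d>0. \<exists>h. summable h \<and> (\<forall>n\<ge>1. \<forall>y\<in>ball x d \<inter> {a. 0 < Re a}. norm ((of_nat n + y) powr (- s)) \<le> h n)" for x
    proof (intro exI conjI allI impI ballI)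
      show "summable (\<lambda>n. exp (pi * \<bar>Im s\<bar>) * real n powr (- Re s))"
        using s by (intro summable_powr_mult)
      show "norm ((of_nat n + y) powr (- s)) \<le> exp (pi * \<bar>Im s\<bar>) * real n powr (- Re s)"
        if "1 \<le> n" "y \<in> ball x 1 \<inter> {a. 0 < Re a}" for n y
        using that s by (intro order_trans[OF hurwitz_series_bound])
          (auto simp: mult.commute[of "exp _"] intro!: mult_mono powr_shift_le)
    qed simp
  qed
  then have "(\<lambda>a. hurwitz_aux 0 s a) holomorphic_on {a. 0 < Re a}" by (auto intro!: holomorphic_intros)
  then show ?case by simp
next
  case (Suc N)
  have s: "1 < Re s + Suc N" using Suc.prems by simp
  have "(\<lambda>a. \<Sum>n. binom_rem (Suc N) s (of_nat n + a)) holomorphic_on {a. 0 < Re a}"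
  proof (rule holomorphic_on_suminf_local)
    show "open {s. 0 < Re s}" by (rule open_halfspace_Re_gt)
    show "(\<lambda>a. binom_rem (Suc N) s (of_nat n + a)) holomorphic_on {a. 0 < Re a}" for n
      unfolding binom_rem_def
      by (intro holomorphic_intros holomorphic_on_sum) (auto intro!: Re_pos_not_nonpos)
    define C where "C = fact (Suc (Suc N)) / fact (Suc N) * cmod ((1 - s) gchoose Suc (Suc N)) * exp (pi * \<bar>Im s\<bar>)"
    show "\<exists>d>0. \<exists>h. summable h \<and> (\<forall>n\<ge>1. \<forall>y\<in>ball x d \<inter> {a. 0 < Re a}. norm (binom_rem (Suc N) s (of_nat n + y)) \<le> h n)" for x
    proof (intro exI conjI allI impI ballI)
      show "summable (\<lambda>n. C * real n powr (- (Re s + Suc N)))"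
        using s by (intro summable_powr_mult)
      show "norm (binom_rem (Suc N) s (of_nat n + y)) \<le> C * real n powr (- (Re s + Suc N))"
        if ny: "1 \<le> n" "y \<in> ball x 1 \<inter> {a. 0 < Re a}" for n y
      proof -
        have "norm (binom_rem (Suc N) s (of_nat n + y)) \<le> C * Re (of_nat n + y) powr (- (Re s + Suc N))"
          unfolding C_def using s ny by (intro binom_rem_bound) auto
        also have "\<dots> \<le> C * real n powr (- (Re s + Suc N))"
          unfolding C_def using ny s by (intro mult_left_mono) (auto intro!: powr_shift_le powr_mono2' simp del: fact_Suc)
        finally show ?thesis .
      qed
    qed simp
  qed
  moreover have "hurwitz_aux N (s + of_nat (Suc i)) holomorphic_on {a. 0 < Re a}" for i
    using Suc.prems by (intro Suc.IH) auto
  moreover have "(\<lambda>a. a powr (1 - s)) holomorphic_on {a. 0 < Re a}"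
    by (intro holomorphic_intros) (auto intro!: Re_pos_not_nonpos)
  ultimately have "(\<lambda>a. hurwitz_aux (Suc N) s a) holomorphic_on {a. 0 < Re a}"
    unfolding hurwitz_aux.simps by (intro holomorphic_intros) (auto dest: Re_pos_not_nonpos)
  then show ?case by simp
qed

lemma powr_of_nat_tendsto_0:
  assumes a: "0 < Re a" and s: "0 < Re s"
  shows "(\<lambda>n. (of_nat n + a) powr (- s)) \<longlonglongrightarrow> 0"
proof (rule Lim_null_comparison)
  show "\<forall>\<^sub>F n in sequentially. norm ((of_nat n + a) powr (- s)) \<le> real n powr (- Re s) * exp (pi * \<bar>Im s\<bar>)"
    using eventually_ge_at_top[of 1]
  proof eventually_elim
    case (elim n)
    then show ?case using s a
      by (intro order_trans[OF hurwitz_series_bound[OF a]]) (auto intro!: mult_right_mono powr_shift_le)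
  qed
  have "(\<lambda>n. real n powr (- Re s)) \<longlonglongrightarrow> 0"
    using s by (intro tendsto_neg_powr filterlim_real_sequentially) auto
  then show "(\<lambda>n. real n powr (- Re s) * exp (pi * \<bar>Im s\<bar>)) \<longlonglongrightarrow> 0"
    using tendsto_mult_left_zero by blast
qed

text \<open>For Re s > 1 the binomial expansion may be summed over x = n + a term by term, and the
  differences of the powers with exponent 1 - s telescope to a^(1 - s). The recursion is this
  identity solved for (s - 1) times the zeta function.\<close>

lemma hurwitz_aux_eq_series:
  assumes a: "0 < Re a" and "1 < Re s"
  shows "hurwitz_aux N s a = hurwitz_aux 0 s a"
  using assms(2)
proof (induction N arbitrary: s)
  case (Suc N)
  note s = Suc.prems
  define z where "z s = (\<Sum>n. (of_nat n + a) powr (- s))" for s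
  have z: "(\<lambda>n. (of_nat n + a) powr (- s)) sums z s" if "1 < Re s" for s
    unfolding z_def using hurwitz_series_summable[OF a that] by (rule summable_sums)
  have zN: "hurwitz_aux N (s + of_nat (Suc i)) a = (s + of_nat i) * z (s + of_nat (Suc i))" for i
    using s by (subst Suc.IH) (auto simp: z_def)
  have tel: "(\<lambda>n. (of_nat n + a) powr (1 - s) - (of_nat (Suc n) + a) powr (1 - s)) sums (a powr (1 - s) - 0)"
    using telescope_sums'[OF powr_of_nat_tendsto_0[OF a, of "s - 1"]] s by simp
  have br: "(of_nat n + a) powr (1 - s) - (of_nat (Suc n) + a) powr (1 - s) =
      (s - 1) * (of_nat n + a) powr (- s) - (\<Sum>i<N. ((1 - s) gchoose Suc (Suc i)) * (of_nat n + a) powr (- (s + of_nat (Suc i))))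
      - binom_rem (Suc N) s (of_nat n + a)" for n
  proof -
    have "{..Suc N} = {..<Suc (Suc N)}" by auto
    then show ?thesis unfolding binom_rem_def
      by (simp only: sum.lessThan_Suc_shift) (simp add: algebra_simps)
  qed
  have "(\<lambda>n. binom_rem (Suc N) s (of_nat n + a)) sums
     ((s - 1) * z s - (\<Sum>i<N. ((1 - s) gchoose Suc (Suc i)) * z (s + of_nat (Suc i))) - (a powr (1 - s) - 0))"
  proof -
    have "(\<lambda>n. (s - 1) * (of_nat n + a) powr (- s) - (\<Sum>i<N. ((1 - s) gchoose Suc (Suc i)) * (of_nat n + a) powr (- (s + of_nat (Suc i))))
      - ((of_nat n + a) powr (1 - s) - (of_nat (Suc n) + a) powr (1 - s))) sums
     ((s - 1) * z s - (\<Sum>i<N. ((1 - s) gchoose Suc (Suc i)) * z (s + of_nat (Suc i))) - (a powr (1 - s) - 0))"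
      using s by (intro sums_diff sums_mult sums_sum z tel) auto
    then show ?thesis unfolding br by simp
  qed
  then have rem: "(\<Sum>n. binom_rem (Suc N) s (of_nat n + a)) = (s - 1) * z s - (\<Sum>i<N. ((1 - s) gchoose Suc (Suc i)) * z (s + of_nat (Suc i))) - a powr (1 - s)"
    by (simp add: sums_iff)
  \<comment> \<open>\<open>hurwitz_aux N\<close> at s + i + 1 carries the factor s + i, which turns
    the divided binomial coefficient of the recursion into the next binomial coefficient, up to
    sign.\<close>
  have co: "((1 - s) gchoose Suc i) / of_nat (i + 2) * (s + of_nat i) = - ((1 - s) gchoose Suc (Suc i))" for i
  proof -
    have "of_nat (i + 2) * ((1 - s) gchoose Suc (Suc i)) = - (s + of_nat i) * ((1 - s) gchoose Suc i)"
      using gbinomial_mult_1[of "1 - s" "Suc i"] by (simp add: algebra_simps eq_neg_iff_add_eq_0)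
    moreover have "of_nat (i + 2) \<noteq> (0::complex)" by (metis add_2_eq_Suc' of_nat_eq_0_iff nat.simps(3))
    moreover have "X / n * c = - Y" if "n * Y = - c * X" "n \<noteq> 0" for X Y n c :: complex
    proof -
      have "X / n * c = (c * X) / n" by simp
      also have "c * X = - Y * n" using that by (simp add: mult.commute)
      finally show ?thesis using that by simp
    qed
    ultimately show ?thesis by blast
  qed
  have "(\<Sum>i<N. ((1 - s) gchoose Suc i) / of_nat (i + 2) * hurwitz_aux N (s + of_nat (Suc i)) a)
      = - (\<Sum>i<N. ((1 - s) gchoose Suc (Suc i)) * z (s + of_nat (Suc i)))"
    unfolding zN mult.assoc[symmetric] co by (simp add: sum_negf)
  then show ?case unfolding hurwitz_aux.simps rem by (simp add: z_def)
qed simp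

lemma connected_halfplane: "connected {s::complex. c < Re s}"
  by (intro convex_connected convex_halfspace_Re_gt)

lemma hurwitz_aux_compat:
  assumes a: "0 < Re a" and "Re s > 1 - real N" "Re s > 1 - real M"
  shows "hurwitz_aux N s a = hurwitz_aux M s a"
proof -
  let ?c = "max (1 - real N) (1 - real M)"
  show ?thesis
  proof (rule analytic_continuation_open[of "{s. 1 < Re s}" "{s. ?c < Re s}" "\<lambda>s. hurwitz_aux N s a" "\<lambda>s. hurwitz_aux M s a"])
    show "(\<lambda>s. hurwitz_aux N s a) holomorphic_on {s. ?c < Re s}"
      by (rule holomorphic_on_subset[OF hurwitz_aux_holomorphic_s[OF a]]) auto
    show "(\<lambda>s. hurwitz_aux M s a) holomorphic_on {s. ?c < Re s}"
      by (rule holomorphic_on_subset[OF hurwitz_aux_holomorphic_s[OF a]]) auto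
    show "{s. 1 < Re s} \<noteq> {}" by (auto intro: exI[of _ 2])
    show "hurwitz_aux N z a = hurwitz_aux M z a" if "z \<in> {s. 1 < Re s}" for z
      using hurwitz_aux_eq_series[OF a, of z N] hurwitz_aux_eq_series[OF a, of z M] that by simp
    show "open {s. ?c < Re s}" "connected {s. ?c < Re s}"
      by (rule open_halfspace_Re_gt connected_halfplane)+
  qed (use assms in \<open>auto simp: open_halfspace_Re_gt\<close>)
qed

text \<open>\<open>hurwitz_zeta\<close> is a choice among continuations, so one has to be exhibited
  first: \<open>g0\<close> glues the functions \<open>hurwitz_aux N\<close>, with N growing as Re s
  decreases. The chosen function then equals \<open>g0\<close> by the identity theorem on the
  connected set \<open>- {1}\<close>.\<close>

lemma hurwitz_zeta_eq_aux:
  assumes a: "0 < Re a" and s: "s \<noteq> 1" "Re s > 1 - real N"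
  shows "hurwitz_zeta s a = hurwitz_aux N s a / (s - 1)"
    and "(\<lambda>s. hurwitz_zeta s a) holomorphic_on - {1}"
    and "1 < Re s \<Longrightarrow> (\<lambda>n. (of_nat n + a) powr (- s)) sums hurwitz_zeta s a"
proof -
  define P where "P g \<longleftrightarrow> g holomorphic_on (- {1}) \<and>
        (\<forall>w. Re w > 1 \<longrightarrow> (\<lambda>n. (of_nat n + a) powr (- w)) sums g w)" for g
  define g0 where "g0 s = hurwitz_aux (nat \<lceil>2 - Re s\<rceil>) s a / (s - 1)" for s
  have g0: "g0 w = hurwitz_aux M w a / (w - 1)" if "1 - real M < Re w" for w M
    unfolding g0_def using that by (subst hurwitz_aux_compat[OF a, of _ _ M]) (auto, linarith)
  have ser: "hurwitz_aux 0 w a / (w - 1) = (\<Sum>n. (of_nat n + a) powr (- w))" if "1 < Re w" for w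
    using that by auto
  have "P g0" unfolding P_def
  proof (intro conjI allI impI)
    show "g0 holomorphic_on - {1}"
      unfolding holomorphic_on_def
    proof
      fix w :: complex assume w: "w \<in> - {1}"
      define M where "M = nat \<lceil>2 - Re w\<rceil>"
      let ?U = "{s. 1 - real M < Re s} - {1}"
      have U: "open ?U" by (intro open_Diff open_halfspace_Re_gt) auto
      have "w \<in> ?U" using w by (auto simp: M_def) linarith
      have "(\<lambda>w. hurwitz_aux M w a / (w - 1)) holomorphic_on ?U"
        by (intro holomorphic_intros holomorphic_on_subset[OF hurwitz_aux_holomorphic_s[OF a]]) auto
      then have "g0 holomorphic_on ?U"
        by (rule holomorphic_transform) (use g0 in auto)
      then have "g0 field_differentiable at w"
        using \<open>w \<in> ?U\<close> U holomorphic_on_imp_differentiable_at by blast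
      then show "g0 field_differentiable at w within - {1}"
        by (rule field_differentiable_at_within)
    qed
  next
    fix w assume "1 < Re w"
    then show "(\<lambda>n. (of_nat n + a) powr (- w)) sums g0 w"
      using g0[of 0 w] ser[of w] hurwitz_series_summable[OF a, of w] by (simp add: summable_sums)
  qed
  then have P: "P (SOME g. P g)" by (rule someI[of P])
  have hz: "hurwitz_zeta w a = (SOME g. P g) w" for w
    unfolding hurwitz_zeta_def P_def by simp
  then show "(\<lambda>s. hurwitz_zeta s a) holomorphic_on - {1}" using P by (simp add: P_def)
  show "1 < Re s \<Longrightarrow> (\<lambda>n. (of_nat n + a) powr (- s)) sums hurwitz_zeta s a"
    using P by (simp add: P_def hz)
  have "(SOME g. P g) s = g0 s"
  proof (rule analytic_continuation_open[of "{s. 1 < Re s}" "- {1}" "SOME g. P g" g0])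
    show "{s. 1 < Re s} \<noteq> {}" by (auto intro: exI[of _ 2])
    show "connected (- {1::complex})" by (intro connected_punctured_universe) auto
    show "(SOME g. P g) z = g0 z" if "z \<in> {s. 1 < Re s}" for z
      using P \<open>P g0\<close> that unfolding P_def using sums_unique2 by blast
  qed (use P \<open>P g0\<close> s in \<open>auto simp: open_halfspace_Re_gt P_def\<close>)
  then show "hurwitz_zeta s a = hurwitz_aux N s a / (s - 1)" using g0[OF s(2)] hz by simp
qed

lemma hurwitz_zeta_holomorphic:
  assumes "s \<noteq> 1"
  shows "hurwitz_zeta s holomorphic_on {a. 0 < Re a}"
proof -
  define N where "N = nat \<lceil>2 - Re s\<rceil>"
  have N: "Re s > 1 - real N" unfolding N_def by linarith
  have "(\<lambda>a. hurwitz_aux N s a / (s - 1)) holomorphic_on {a. 0 < Re a}"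
    using assms by (intro holomorphic_intros hurwitz_aux_holomorphic_a[OF N]) auto
  then show ?thesis
    by (rule holomorphic_transform) (use hurwitz_zeta_eq_aux(1)[OF _ assms N] in auto)
qed

lemma hurwitz_zeta_sums:
  assumes "0 < Re a" "1 < Re s"
  shows "(\<lambda>n. (of_nat n + a) powr (- s)) sums hurwitz_zeta s a"
  using hurwitz_zeta_eq_aux(3)[OF assms(1), of s 0] assms by (cases "s = 1") auto

text \<open>For Re s > 1 this is the removal of the first term of the series; both sides continue to
  the punctured plane. It is the source of the recursion of the operator.\<close>

lemma hurwitz_zeta_rec:
  assumes a: "0 < Re a" and s: "s \<noteq> 1"
  shows "hurwitz_zeta s a - hurwitz_zeta s (a + 1) = a powr (- s)"
proof (rule analytic_continuation_open[of "{s. 1 < Re s}" "- {1}" "\<lambda>s. hurwitz_zeta s a - hurwitz_zeta s (a + 1)" "\<lambda>s. a powr (- s)"])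
  show "{s. 1 < Re s} \<noteq> {}" by (auto intro: exI[of _ 2])
  show "connected (- {1::complex})" by (intro connected_punctured_universe) auto
  show "(\<lambda>s. hurwitz_zeta s a - hurwitz_zeta s (a + 1)) holomorphic_on - {1}"
    using hurwitz_zeta_eq_aux(2)[of a 2 0] hurwitz_zeta_eq_aux(2)[of "a+1" 2 0] a
    by (intro holomorphic_intros) auto
  show "(\<lambda>s. a powr - s) holomorphic_on - {1}"
    by (intro holomorphic_intros)
  show "hurwitz_zeta z a - hurwitz_zeta z (a + 1) = a powr - z" if "z \<in> {s. 1 < Re s}" for z
  proof -
    have z: "1 < Re z" using that by simp
    have "(\<lambda>n. (of_nat (Suc n) + a) powr (- z)) sums (hurwitz_zeta z a - (of_nat 0 + a) powr (- z))"
      using hurwitz_zeta_sums[OF a z] by (subst sums_Suc_iff) simp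
    moreover have "(\<lambda>n. (of_nat (Suc n) + a) powr (- z)) sums hurwitz_zeta z (a + 1)"
      using hurwitz_zeta_sums[of "a + 1" z] a z by (simp add: add_ac)
    ultimately show ?thesis using sums_unique2 by fastforce
  qed
qed (use s in \<open>auto simp: open_halfspace_Re_gt\<close>)

section \<open>Quantitative Hoelder classes\<close>

text \<open>
  The flag \<open>z\<close> asks in addition that the derivatives up to order \<open>k\<close> vanish at \<open>0\<close>, if \<open>0 \<in> I\<close>.
  The case \<open>\<gamma> = 0\<close> covers integral exponents, where the Hoelder condition only says that the
  oscillation of the top derivative is at most \<open>B\<close>.
\<close>

primrec C_bound :: "nat \<Rightarrow> real \<Rightarrow> real \<Rightarrow> real set \<Rightarrow> bool \<Rightarrow> (real \<Rightarrow> complex) \<Rightarrow> bool" where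
  "C_bound 0 \<gamma> B I z f \<longleftrightarrow> (z \<longrightarrow> 0 \<in> I \<longrightarrow> f 0 = 0) \<and> (\<forall>x\<in>I. norm (f x) \<le> B) \<and>
     continuous_on I f \<and> (\<forall>x\<in>I. \<forall>y\<in>I. norm (f x - f y) \<le> B * \<bar>x - y\<bar> powr \<gamma>)"
| "C_bound (Suc k) \<gamma> B I z f \<longleftrightarrow> (z \<longrightarrow> 0 \<in> I \<longrightarrow> f 0 = 0) \<and> (\<forall>x\<in>I. norm (f x) \<le> B) \<and>
     (\<exists>f'. (\<forall>x\<in>I. (f has_vector_derivative f' x) (at x)) \<and> C_bound k \<gamma> B I z f')"

lemma C_bound_norm: "C_bound k \<gamma> B I z f \<Longrightarrow> x \<in> I \<Longrightarrow> norm (f x) \<le> B"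
  by (cases k) auto

lemma C_bound_nonneg: "C_bound k \<gamma> B I z f \<Longrightarrow> x \<in> I \<Longrightarrow> 0 \<le> B"
  using C_bound_norm norm_ge_zero order_trans by blast

lemma C_bound_continuous_on: "C_bound k \<gamma> B I z f \<Longrightarrow> continuous_on I f"
  by (cases k) (auto intro!: continuous_at_imp_continuous_on intro: has_vector_derivative_continuous)

lemma C_bound_flat: "C_bound k \<gamma> B I True f \<Longrightarrow> 0 \<in> I \<Longrightarrow> f 0 = 0"
  by (cases k) auto

lemma C_bound_holder:
  "C_bound 0 \<gamma> B I z f \<Longrightarrow> x \<in> I \<Longrightarrow> y \<in> I \<Longrightarrow> norm (f x - f y) \<le> B * \<bar>x - y\<bar> powr \<gamma>"
  by simp

lemma C_bound_SucE:
  assumes "C_bound (Suc k) \<gamma> B I z f"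
  obtains f' where "\<And>x. x \<in> I \<Longrightarrow> (f has_vector_derivative f' x) (at x)" "C_bound k \<gamma> B I z f'"
  using assms by auto

lemma C_bound_empty: "C_bound k \<gamma> B {} z f"
  by (induction k arbitrary: f) auto

lemma C_bound_cong:
  assumes "open I" "\<And>x. x \<in> I \<Longrightarrow> f x = g x" "C_bound k \<gamma> B I z f"
  shows "C_bound k \<gamma> B I z g"
proof (cases k)
  case 0
  have "continuous_on I g" using C_bound_continuous_on[OF assms(3)] assms(2) by (simp cong: continuous_on_cong)
  then show ?thesis using assms 0 by auto
next
  case (Suc k')
  then obtain f' where f': "\<And>x. x \<in> I \<Longrightarrow> (f has_vector_derivative f' x) (at x)" "C_bound k' \<gamma> B I z f'"
    using assms(3) by auto
  have "(g has_vector_derivative f' x) (at x)" if "x \<in> I" for x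
    using has_vector_derivative_transform_within_open[OF f'(1)[OF that] assms(1) that] assms(2) by blast
  then show ?thesis using assms Suc f' by auto
qed

lemma C_bound_mono:
  assumes "C_bound k \<gamma> B I z f" "B \<le> B'" "I' \<subseteq> I" "z' \<longrightarrow> z"
  shows "C_bound k \<gamma> B' I' z' f"
  using assms(1)
proof (induction k arbitrary: f)
  case 0
  have "norm (f x - f y) \<le> B' * \<bar>x - y\<bar> powr \<gamma>" if "x \<in> I'" "y \<in> I'" for x y
    using C_bound_holder[OF 0, of x y] that assms(3) mult_right_mono[OF assms(2), of "\<bar>x - y\<bar> powr \<gamma>"]
    by (meson order_trans powr_ge_zero subsetD)
  moreover have "norm (f x) \<le> B'" if "x \<in> I'" for x using 0 that assms by (auto intro: order_trans)
  ultimately show ?case using 0 assms continuous_on_subset by auto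
next
  case (Suc k)
  moreover have "norm (f x) \<le> B'" if "x \<in> I'" for x using Suc.prems that assms by (auto intro: order_trans)
  ultimately show ?case using assms(3,4) by fastforce
qed

lemma C_bound_add:
  assumes "C_bound k \<gamma> B I z f" "C_bound k \<gamma> B' I z g"
  shows "C_bound k \<gamma> (B + B') I z (\<lambda>x. f x + g x)"
  using assms
proof (induction k arbitrary: f g)
  case 0
  have "norm (f x + g x - (f y + g y)) \<le> (B + B') * \<bar>x - y\<bar> powr \<gamma>" if "x \<in> I" "y \<in> I" for x y
  proof -
    have "norm (f x - f y) \<le> B * \<bar>x - y\<bar> powr \<gamma>" "norm (g x - g y) \<le> B' * \<bar>x - y\<bar> powr \<gamma>"
      using 0 that by auto
    moreover have "norm (f x + g x - (f y + g y)) \<le> norm (f x - f y) + norm (g x - g y)"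
      using norm_triangle_ineq[of "f x - f y" "g x - g y"] by (simp add: algebra_simps)
    ultimately show ?thesis unfolding distrib_right by linarith
  qed
  moreover have "norm (f x + g x) \<le> B + B'" if "x \<in> I" for x
    using C_bound_norm[OF 0(1) that] C_bound_norm[OF 0(2) that] by (rule norm_triangle_mono)
  ultimately show ?case using 0 by (auto intro!: continuous_intros)
next
  case (Suc k)
  obtain f' where f': "\<And>x. x \<in> I \<Longrightarrow> (f has_vector_derivative f' x) (at x)" "C_bound k \<gamma> B I z f'"
    using C_bound_SucE[OF Suc.prems(1)] by blast
  obtain g' where g': "\<And>x. x \<in> I \<Longrightarrow> (g has_vector_derivative g' x) (at x)" "C_bound k \<gamma> B' I z g'"
    using C_bound_SucE[OF Suc.prems(2)] by blast
  note fg = f' g'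
  have "norm (f x + g x) \<le> B + B'" if "x \<in> I" for x
    using C_bound_norm[OF Suc.prems(1) that] C_bound_norm[OF Suc.prems(2) that] by (rule norm_triangle_mono)
  moreover have "((\<lambda>x. f x + g x) has_vector_derivative f' x + g' x) (at x)" if "x \<in> I" for x
    using fg that by (auto intro!: derivative_eq_intros)
  ultimately show ?case using Suc.IH[OF fg(2,4)] Suc.prems by (auto intro!: exI[of _ "\<lambda>x. f' x + g' x"])
qed

lemma C_bound_cmult:
  assumes "C_bound k \<gamma> B I z f"
  shows "C_bound k \<gamma> (norm c * B) I z (\<lambda>x. c * f x)"
  using assms
proof (induction k arbitrary: f)
  case 0
  have "norm (c * f x - c * f y) \<le> norm c * B * \<bar>x - y\<bar> powr \<gamma>" if "x \<in> I" "y \<in> I" for x y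
  proof -
    have "norm (f x - f y) \<le> B * \<bar>x - y\<bar> powr \<gamma>" using 0 that by auto
    then have "norm c * norm (f x - f y) \<le> norm c * (B * \<bar>x - y\<bar> powr \<gamma>)" by (intro mult_left_mono) auto
    then show ?thesis by (simp add: norm_mult[symmetric] right_diff_distrib mult.assoc)
  qed
  then show ?case using 0 by (auto intro!: continuous_intros mult_left_mono simp: norm_mult)
next
  case (Suc k)
  then obtain f' where f': "\<And>x. x \<in> I \<Longrightarrow> (f has_vector_derivative f' x) (at x)" "C_bound k \<gamma> B I z f'" by auto
  have "((\<lambda>x. c * f x) has_vector_derivative c * f' x) (at x)" if "x \<in> I" for x
    using f' that by (auto intro!: derivative_eq_intros)
  then show ?case using Suc.IH[OF f'(2)] Suc.prems
    by (auto intro!: exI[of _ "\<lambda>x. c * f' x"] mult_left_mono simp: norm_mult)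
qed

lemma C_bound_diff:
  assumes "C_bound k \<gamma> B I z f" "C_bound k \<gamma> B' I z g"
  shows "C_bound k \<gamma> (B + B') I z (\<lambda>x. f x - g x)"
  using C_bound_add[OF assms(1) C_bound_cmult[OF assms(2), of "-1"]] by simp

text \<open>On a set of diameter at most R a Lipschitz bound becomes a Hoelder bound of exponent
  \<gamma> at the cost of the factor R. Hence the number R >= 1 in the lemmas below.\<close>

lemma powr_ge_self:
  assumes "0 \<le> d" "d \<le> R" "1 \<le> (R::real)" "0 \<le> \<gamma>" "\<gamma> \<le> 1"
  shows "d \<le> R * d powr \<gamma>"
proof (cases "d = 0")
  case False
  have "d = d powr (1 - \<gamma>) * d powr \<gamma>" using False assms by (simp flip: powr_add)
  also have "d powr (1 - \<gamma>) \<le> R powr (1 - \<gamma>)" using assms by (intro powr_mono2) auto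
  also have "R powr (1 - \<gamma>) \<le> R powr 1" using assms by (intro powr_mono) auto
  finally show ?thesis using assms by (simp add: mult_right_mono)
qed (use assms in auto)

lemma real_lipschitz_bound:
  fixes f :: "real \<Rightarrow> complex"
  assumes "convex I" "\<And>x. x \<in> I \<Longrightarrow> (f has_vector_derivative f' x) (at x)"
    "\<And>x. x \<in> I \<Longrightarrow> norm (f' x) \<le> B" "x \<in> I" "y \<in> I"
  shows "norm (f x - f y) \<le> B * \<bar>x - y\<bar>"
proof -
  have "norm (f x - f y) \<le> B * norm (x - y)"
  proof (rule differentiable_bound[OF assms(1)])
    show "(f has_derivative (\<lambda>h. h *\<^sub>R f' x)) (at x within I)" if "x \<in> I" for x
      using assms(2)[OF that] unfolding has_vector_derivative_def by (rule has_derivative_at_withinI)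
    show "onorm (\<lambda>h. h *\<^sub>R f' x) \<le> B" if "x \<in> I" for x
      using assms(3)[OF that] by (intro onorm_bound) (auto simp: mult.commute[of B] mult_left_mono intro: order_trans[OF norm_ge_zero])
  qed (use assms in auto)
  then show ?thesis by simp
qed

text \<open>A bounded derivative on a convex set supplies the Hoelder condition one order lower. The
  product and chain rules need this, since they multiply a derivative with an undifferentiated
  factor.\<close>

lemma C_bound_lower:
  assumes I: "convex I" "\<And>x y. x \<in> I \<Longrightarrow> y \<in> I \<Longrightarrow> \<bar>x - y\<bar> \<le> R" and R: "1 \<le> R" and g: "0 \<le> \<gamma>" "\<gamma> \<le> 1"
    and "C_bound (Suc k) \<gamma> B I z f"
  shows "C_bound k \<gamma> (R * B) I z f"
  using assms(6)
proof (induction k arbitrary: f)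
  case 0
  then obtain f' where f': "\<And>x. x \<in> I \<Longrightarrow> (f has_vector_derivative f' x) (at x)" "C_bound 0 \<gamma> B I z f'" by auto
  have "norm (f x - f y) \<le> R * B * \<bar>x - y\<bar> powr \<gamma>" if xy: "x \<in> I" "y \<in> I" for x y
  proof -
    have B: "0 \<le> B" using C_bound_nonneg[OF "0.prems" xy(1)] .
    have "norm (f x - f y) \<le> B * \<bar>x - y\<bar>"
      by (rule real_lipschitz_bound[OF I(1) f'(1)]) (use f'(2) xy in auto)
    also have "\<dots> \<le> B * (R * \<bar>x - y\<bar> powr \<gamma>)"
      using powr_ge_self[OF _ I(2)[OF xy] R g] B by (intro mult_left_mono) auto
    finally show ?thesis by (simp add: mult_ac)
  qed
  moreover have "norm (f x) \<le> R * B" if "x \<in> I" for x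
    using C_bound_norm[OF "0.prems" that] C_bound_nonneg[OF "0.prems" that] R
      mult_right_mono[of 1 R B] by linarith
  ultimately show ?case using "0.prems" C_bound_continuous_on[OF "0.prems"] by auto
next
  case (Suc k)
  then obtain f' where f': "\<And>x. x \<in> I \<Longrightarrow> (f has_vector_derivative f' x) (at x)" "C_bound (Suc k) \<gamma> B I z f'"
    unfolding C_bound.simps(2)[of "Suc k"] by blast
  have "norm (f x) \<le> R * B" if "x \<in> I" for x
    using C_bound_norm[OF Suc.prems that] C_bound_nonneg[OF Suc.prems that] R
      mult_right_mono[of 1 R B] by linarith
  then show ?case using Suc.IH[OF f'(2)] f'(1) Suc.prems
    unfolding C_bound.simps(2)[of k] C_bound.simps(2)[of "Suc k"] by blast
qed

text \<open>Induction by the product rule: two products arise, and in each the undifferentiated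
  factor drops one order and costs R, whence (2R)^k. Vanishing at 0 to order k passes to the product
  from either factor.\<close>

lemma C_bound_mult:
  assumes I: "convex I" "\<And>x y. x \<in> I \<Longrightarrow> y \<in> I \<Longrightarrow> \<bar>x - y\<bar> \<le> R" and R: "1 \<le> R" and g: "0 \<le> \<gamma>" "\<gamma> \<le> 1"
    and "C_bound k \<gamma> B I z f" "C_bound k \<gamma> B' I z' g"
  shows "C_bound k \<gamma> (2 * (2 * R) ^ k * B * B') I (z \<or> z') (\<lambda>x. f x * g x)"
  using assms(6,7)
proof (induction k arbitrary: f g B B' z z')
  case 0
  have le: "norm (f x * g x) \<le> B * B'" if "x \<in> I" for x
    using 0 that C_bound_nonneg[OF 0(1) that] by (auto simp: norm_mult intro!: mult_mono)
  have "norm (f x * g x) \<le> 2 * B * B'" if "x \<in> I" for x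
    using le[OF that] norm_ge_zero[of "f x * g x"] by linarith
  moreover have "norm (f x * g x - f y * g y) \<le> 2 * B * B' * \<bar>x - y\<bar> powr \<gamma>" if xy: "x \<in> I" "y \<in> I" for x y
  proof -
    have B: "0 \<le> B" "0 \<le> B'" using C_bound_nonneg[OF 0(1) xy(1)] C_bound_nonneg[OF 0(2) xy(1)] .
    have "f x * g x - f y * g y = f x * (g x - g y) + (f x - f y) * g y" by (simp add: algebra_simps)
    then have "norm (f x * g x - f y * g y) \<le> norm (f x) * norm (g x - g y) + norm (f x - f y) * norm (g y)"
      by (metis norm_mult norm_triangle_ineq)
    also have "\<dots> \<le> B * (B' * \<bar>x - y\<bar> powr \<gamma>) + (B * \<bar>x - y\<bar> powr \<gamma>) * B'"
      using 0 xy B by (intro add_mono mult_mono) auto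
    finally show ?thesis by (simp add: mult_ac)
  qed
  ultimately show ?case using 0 by (auto intro!: continuous_intros)
next
  case (Suc k)
  obtain f' where f': "\<And>x. x \<in> I \<Longrightarrow> (f has_vector_derivative f' x) (at x)" "C_bound k \<gamma> B I z f'"
    using C_bound_SucE[OF Suc.prems(1)] by blast
  obtain g' where g': "\<And>x. x \<in> I \<Longrightarrow> (g has_vector_derivative g' x) (at x)" "C_bound k \<gamma> B' I z' g'"
    using C_bound_SucE[OF Suc.prems(2)] by blast
  note fg = f' g'
  have f: "C_bound k \<gamma> (R * B) I z f" and g: "C_bound k \<gamma> (R * B') I z' g"
    using C_bound_lower[OF I R g] Suc.prems by blast+
  let ?h = "\<lambda>x. f x * g' x + f' x * g x"
  have "C_bound k \<gamma> (2 * (2 * R) ^ k * (R * B) * B' + 2 * (2 * R) ^ k * B * (R * B')) I (z \<or> z') ?h"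
    by (intro C_bound_add Suc.IH f g fg)
  then have h: "C_bound k \<gamma> (2 * (2 * R) ^ Suc k * B * B') I (z \<or> z') ?h" by (simp add: algebra_simps)
  have 1: "((\<lambda>x. f x * g x) has_vector_derivative ?h x) (at x)" if "x \<in> I" for x
    using has_vector_derivative_mult[OF fg(1)[OF that] fg(3)[OF that]] .
  have 2: "norm (f x * g x) \<le> 2 * (2 * R) ^ Suc k * B * B'" if x: "x \<in> I" for x
  proof -
    have B: "0 \<le> B" "0 \<le> B'" using C_bound_nonneg[OF Suc.prems(1) x] C_bound_nonneg[OF Suc.prems(2) x] .
    have "norm (f x * g x) \<le> 1 * (B * B')"
      using C_bound_norm[OF Suc.prems(1) x] C_bound_norm[OF Suc.prems(2) x] B by (auto simp: norm_mult intro!: mult_mono)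
    also have "\<dots> \<le> (2 * (2 * R) ^ Suc k) * (B * B')"
    proof (rule mult_right_mono)
      have "1 \<le> (2 * R) ^ Suc k" using R by (intro one_le_power) auto
      then show "1 \<le> 2 * (2 * R) ^ Suc k" by linarith
    qed (use B in auto)
    finally show ?thesis by (simp add: mult_ac)
  qed
  have 3: "f 0 * g 0 = 0" if "z \<or> z'" "0 \<in> I"
    using C_bound_flat[of "Suc k" \<gamma> B I f] C_bound_flat[of "Suc k" \<gamma> B' I g] Suc.prems that by fastforce
  show ?case unfolding C_bound.simps(2)[of k]
    by (intro conjI exI[of _ ?h] impI ballI 1 2 3 h)
qed

text \<open>The order of quantifiers is the point: K depends on R, k and the bound A for \<psi>'
  alone, so one K serves all inverse branches, or all words, at once.\<close>

lemma C_bound_compose: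
  assumes R: "1 \<le> R"
  shows "\<exists>K\<ge>1. \<forall>\<gamma> I J p \<psi> \<psi>' B z. 0 \<le> \<gamma> \<longrightarrow> \<gamma> \<le> 1 \<longrightarrow> convex I \<longrightarrow> (\<forall>x\<in>I. \<forall>y\<in>I. \<bar>x - y\<bar> \<le> R) \<longrightarrow>
    C_bound k \<gamma> B J z p \<longrightarrow> \<psi> ` I \<subseteq> J \<longrightarrow> (\<forall>x\<in>I. (\<psi> has_real_derivative \<psi>' x) (at x)) \<longrightarrow>
    C_bound k \<gamma> A I False (\<lambda>x. of_real (\<psi>' x)) \<longrightarrow> (z \<longrightarrow> \<psi> 0 = 0) \<longrightarrow>
    C_bound k \<gamma> (K * B) I z (\<lambda>x. p (\<psi> x))"
proof (induction k arbitrary: A)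
  case 0
  show ?case
  proof (intro exI[of _ "max 1 A"] conjI allI impI)
    fix \<gamma> I J p \<psi> \<psi>' B z
    assume g: "(0::real) \<le> \<gamma>" "\<gamma> \<le> 1" and I: "convex I" "\<forall>x\<in>I. \<forall>y\<in>I. \<bar>x - y\<bar> \<le> R"
      and p: "C_bound 0 \<gamma> B J z p" and psi: "\<psi> ` I \<subseteq> J" "\<forall>x\<in>I. (\<psi> has_real_derivative \<psi>' x) (at x)"
      and psi': "C_bound 0 \<gamma> A I False (\<lambda>x. complex_of_real (\<psi>' x))" and z: "z \<longrightarrow> \<psi> 0 = 0"
    let ?K = "max 1 A"
    have c\<psi>: "continuous_on I \<psi>"
      using psi(2) by (meson DERIV_isCont continuous_at_imp_continuous_on)
    have lip: "\<bar>\<psi> x - \<psi> y\<bar> \<le> ?K * \<bar>x - y\<bar>" if "x \<in> I" "y \<in> I" for x y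
    proof -
      have "norm (\<psi> x - \<psi> y) \<le> ?K * norm (x - y)"
        by (rule field_differentiable_bound[OF I(1)])
           (use psi(2) psi' that in \<open>auto intro: has_field_derivative_at_within order_trans[of _ A]\<close>)
      then show ?thesis by simp
    qed
    have "norm (p (\<psi> x) - p (\<psi> y)) \<le> ?K * B * \<bar>x - y\<bar> powr \<gamma>" if xy: "x \<in> I" "y \<in> I" for x y
    proof -
      have B: "0 \<le> B" using C_bound_nonneg[OF p, of "\<psi> x"] psi xy by auto
      have "norm (p (\<psi> x) - p (\<psi> y)) \<le> B * \<bar>\<psi> x - \<psi> y\<bar> powr \<gamma>"
        using C_bound_holder[OF p, of "\<psi> x" "\<psi> y"] psi(1) xy by blast
      also have "\<dots> \<le> B * (?K * \<bar>x - y\<bar>) powr \<gamma>"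
        using lip[OF xy] g B by (intro mult_left_mono powr_mono2) auto
      also have "\<dots> = B * (?K powr \<gamma> * \<bar>x - y\<bar> powr \<gamma>)" by (simp only: powr_mult)
      also have "\<dots> \<le> B * (?K powr 1 * \<bar>x - y\<bar> powr \<gamma>)"
        using g B by (intro mult_left_mono mult_right_mono powr_mono) auto
      finally show ?thesis by (simp add: mult_ac)
    qed
    moreover have "norm (p (\<psi> x)) \<le> ?K * B" if "x \<in> I" for x
    proof -
      have "norm (p (\<psi> x)) \<le> 1 * B" using C_bound_norm[OF p, of "\<psi> x"] psi that by auto
      also have "\<dots> \<le> ?K * B" using C_bound_nonneg[OF p, of "\<psi> x"] psi that by (intro mult_right_mono) auto
      finally show ?thesis .
    qed
    moreover have "continuous_on I (\<lambda>x. p (\<psi> x))"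
      using continuous_on_compose2[OF C_bound_continuous_on[OF p] c\<psi> psi(1)] .
    moreover have "p (\<psi> 0) = 0" if "z" "0 \<in> I" using C_bound_flat[of 0 \<gamma> B J p] p psi(1) z that by force
    ultimately show "C_bound 0 \<gamma> (?K * B) I z (\<lambda>x. p (\<psi> x))"
      unfolding C_bound.simps(1) by blast
  qed auto
next
  case (Suc k)
  \<comment> \<open>The bound for \<psi>' is used one order lower, where
    \<open>C_bound_lower\<close> makes it R * A.\<close>
  obtain K where K: "K \<ge> 1" and IH: "\<And>\<gamma> I J p \<psi> \<psi>' B z. 0 \<le> \<gamma> \<Longrightarrow> \<gamma> \<le> 1 \<Longrightarrow> convex I \<Longrightarrow> (\<forall>x\<in>I. \<forall>y\<in>I. \<bar>x - y\<bar> \<le> R) \<Longrightarrow>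
    C_bound k \<gamma> B J z p \<Longrightarrow> \<psi> ` I \<subseteq> J \<Longrightarrow> (\<forall>x\<in>I. (\<psi> has_real_derivative \<psi>' x) (at x)) \<Longrightarrow>
    C_bound k \<gamma> (R * A) I False (\<lambda>x. of_real (\<psi>' x)) \<Longrightarrow> (z \<longrightarrow> \<psi> 0 = 0) \<Longrightarrow>
    C_bound k \<gamma> (K * B) I z (\<lambda>x. p (\<psi> x))"
    using Suc.IH[of "R * A"] by blast
  define K' where "K' = max 1 (2 * (2 * R) ^ k * K * (R * A))"
  show ?case
  proof (intro exI[of _ K'] conjI allI impI)
    show "1 \<le> K'" by (simp add: K'_def)
    fix \<gamma> I J p \<psi> \<psi>' B z
    assume g: "(0::real) \<le> \<gamma>" "\<gamma> \<le> 1" and I: "convex I" "\<forall>x\<in>I. \<forall>y\<in>I. \<bar>x - y\<bar> \<le> R"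
      and p: "C_bound (Suc k) \<gamma> B J z p" and psi: "\<psi> ` I \<subseteq> J" "\<forall>x\<in>I. (\<psi> has_real_derivative \<psi>' x) (at x)"
      and psi': "C_bound (Suc k) \<gamma> A I False (\<lambda>x. complex_of_real (\<psi>' x))" and z: "z \<longrightarrow> \<psi> 0 = 0"
    obtain p' where p': "\<And>x. x \<in> J \<Longrightarrow> (p has_vector_derivative p' x) (at x)" "C_bound k \<gamma> B J z p'"
      using C_bound_SucE[OF p] by blast
    have ps: "C_bound k \<gamma> (R * A) I False (\<lambda>x. of_real (\<psi>' x))"
      using C_bound_lower[OF I(1) _ R g psi'] I(2) by blast
    have "C_bound k \<gamma> (K * B) I z (\<lambda>x. p' (\<psi> x))" by (rule IH[OF g I p'(2) psi ps z])
    from C_bound_mult[OF I(1) _ R g this ps] I(2)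
    have h: "C_bound k \<gamma> (2 * (2 * R) ^ k * (K * B) * (R * A)) I z (\<lambda>x. p' (\<psi> x) * of_real (\<psi>' x))" by simp
    show "C_bound (Suc k) \<gamma> (K' * B) I z (\<lambda>x. p (\<psi> x))"
    proof (cases "I = {}")
      case True then show ?thesis by (simp add: C_bound_empty)
    next
      case False
      then obtain x0 where "x0 \<in> I" by auto
      then have B: "0 \<le> B" using C_bound_nonneg[OF p, of "\<psi> x0"] psi(1) by auto
      have "2 * (2 * R) ^ k * (K * B) * (R * A) \<le> K' * B"
        using B mult_right_mono[of "2 * (2 * R) ^ k * K * (R * A)" K' B] by (simp add: K'_def mult_ac)
      then have h': "C_bound k \<gamma> (K' * B) I z (\<lambda>x. p' (\<psi> x) * of_real (\<psi>' x))"
        using C_bound_mono[OF h] by blast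
      have 1: "((\<lambda>x. p (\<psi> x)) has_vector_derivative p' (\<psi> x) * of_real (\<psi>' x)) (at x)" if "x \<in> I" for x
      proof -
        have "(\<psi> has_vector_derivative \<psi>' x) (at x)"
          using psi(2) that has_real_derivative_iff_has_vector_derivative by blast
        from vector_diff_chain_at[OF this, of p "p' (\<psi> x)"] p'(1)[of "\<psi> x"] psi(1) that
        show ?thesis by (auto simp: o_def scaleR_conv_of_real mult.commute)
      qed
      have 2: "norm (p (\<psi> x)) \<le> K' * B" if "x \<in> I" for x
      proof -
        have "norm (p (\<psi> x)) \<le> 1 * B" using C_bound_norm[OF p, of "\<psi> x"] psi that by auto
        also have "\<dots> \<le> K' * B" using B by (intro mult_right_mono) (auto simp: K'_def)
        finally show ?thesis .
      qed
      have 3: "p (\<psi> 0) = 0" if "z" "0 \<in> I" using C_bound_flat[of "Suc k" \<gamma> B J p] p psi(1) z that by force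
      show ?thesis unfolding C_bound.simps(2)[of k]
        by (intro conjI exI[of _ "\<lambda>x. p' (\<psi> x) * of_real (\<psi>' x)"] impI ballI 1 2 3 h')
    qed
  qed
qed

text \<open>One majorant controls all derivatives and the Hoelder quotient together, so the series
  may be differentiated term by term k times with the same constants.\<close>

lemma C_bound_suminf:
  fixes f :: "nat \<Rightarrow> real \<Rightarrow> complex"
  assumes I: "open I" "convex I" and b: "summable b" and "\<And>n. C_bound k \<gamma> (b n) I z (f n)"
  shows "C_bound k \<gamma> (suminf b) I z (\<lambda>x. \<Sum>n. f n x)"
proof (cases "I = {}")
  case True then show ?thesis by (simp add: C_bound_empty)
next
  case False
  then obtain x0 where x0: "x0 \<in> I" by auto
  show ?thesis using assms(4)
  proof (induction k arbitrary: f)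
    case 0
    have nb: "norm (f n x) \<le> b n" if "x \<in> I" for n x using 0 that by auto
    have sf: "summable (\<lambda>n. f n x)" if "x \<in> I" for x
      by (rule summable_comparison_test'[OF b, of 0]) (use nb[OF that] in auto)
    have "uniform_limit I (\<lambda>n x. \<Sum>i<n. f i x) (\<lambda>x. \<Sum>n. f n x) sequentially"
      by (rule Weierstrass_m_test[OF nb b])
    then have "continuous_on I (\<lambda>x. \<Sum>n. f n x)"
      by (rule uniform_limit_theorem[rotated]) (use 0 in \<open>auto intro!: always_eventually continuous_on_sum\<close>)
    moreover have "norm (\<Sum>n. f n x) \<le> suminf b" if "x \<in> I" for x
      by (rule norm_suminf_le[OF nb[OF that] b])
    moreover have "norm ((\<Sum>n. f n x) - (\<Sum>n. f n y)) \<le> suminf b * \<bar>x - y\<bar> powr \<gamma>" if xy: "x \<in> I" "y \<in> I" for x y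
    proof -
      have "(\<Sum>n. f n x) - (\<Sum>n. f n y) = (\<Sum>n. f n x - f n y)" by (rule suminf_diff[OF sf sf]) (use xy in auto)
      also have "norm \<dots> \<le> (\<Sum>n. b n * \<bar>x - y\<bar> powr \<gamma>)"
        by (rule norm_suminf_le) (use 0 xy b in \<open>auto intro: summable_mult2\<close>)
      also have "\<dots> = suminf b * \<bar>x - y\<bar> powr \<gamma>" by (rule suminf_mult2[OF b, symmetric])
      finally show ?thesis .
    qed
    moreover have "(\<Sum>n. f n 0) = 0" if "z" "0 \<in> I" using 0 that by simp
    ultimately show ?case by auto
  next
    case (Suc k)
    have "\<forall>n. \<exists>f'. (\<forall>x\<in>I. (f n has_vector_derivative f' x) (at x)) \<and> C_bound k \<gamma> (b n) I z f'"
      using Suc.prems by simp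
    then obtain f' where f': "\<And>n x. x \<in> I \<Longrightarrow> (f n has_vector_derivative f' n x) (at x)" "\<And>n. C_bound k \<gamma> (b n) I z (f' n)"
      by metis
    have nb: "norm (f n x) \<le> b n" if "x \<in> I" for n x using C_bound_norm[OF Suc.prems that] .
    have nb': "norm (f' n x) \<le> b n" if "x \<in> I" for n x using C_bound_norm[OF f'(2) that] .
    have sf: "summable (\<lambda>n. f n x)" if "x \<in> I" for x
      by (rule summable_comparison_test'[OF b, of 0]) (use nb[OF that] in auto)
    define g' where "g' x = (\<Sum>n. f' n x)" for x
    have ul: "uniform_limit I (\<lambda>n x. \<Sum>i<n. f' i x) g' sequentially"
      unfolding g'_def by (rule Weierstrass_m_test[OF nb' b])
    have "\<exists>g. \<forall>x\<in>I. (\<lambda>n. f n x) sums g x \<and> (g has_derivative (\<lambda>h. h *\<^sub>R g' x)) (at x within I)"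
    proof (rule has_derivative_series[OF I(2)])
      show "(f n has_derivative (\<lambda>h. h *\<^sub>R f' n x)) (at x within I)" if "x \<in> I" for n x
        using f'(1)[OF that] unfolding has_vector_derivative_def by (rule has_derivative_at_withinI)
      show "x0 \<in> I" "(\<lambda>n. f n x0) sums (\<Sum>n. f n x0)" using x0 sf by (auto simp: summable_sums)
      fix e :: real assume "e > 0"
      then have "\<forall>\<^sub>F n in sequentially. \<forall>x\<in>I. dist (\<Sum>i<n. f' i x) (g' x) < e"
        using ul by (simp add: uniform_limit_iff)
      then show "\<forall>\<^sub>F n in sequentially. \<forall>x\<in>I. \<forall>h. norm ((\<Sum>i<n. h *\<^sub>R f' i x) - h *\<^sub>R g' x) \<le> e * norm h"
      proof eventually_elim
        case (elim n)
        show ?case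
        proof (intro ballI allI)
          fix x h assume "x \<in> I"
          then have "norm ((\<Sum>i<n. f' i x) - g' x) \<le> e" using elim by (force simp: dist_norm)
          then have "\<bar>h\<bar> * norm ((\<Sum>i<n. f' i x) - g' x) \<le> \<bar>h\<bar> * e" by (intro mult_left_mono) auto
          moreover have "(\<Sum>i<n. h *\<^sub>R f' i x) - h *\<^sub>R g' x = h *\<^sub>R ((\<Sum>i<n. f' i x) - g' x)"
            by (simp add: scaleR_right_diff_distrib scaleR_sum_right)
          ultimately show "norm ((\<Sum>i<n. h *\<^sub>R f' i x) - h *\<^sub>R g' x) \<le> e * norm h"
            by (simp add: mult.commute)
        qed
      qed
    qed
    then obtain g where g: "\<And>x. x \<in> I \<Longrightarrow> (\<lambda>n. f n x) sums g x" "\<And>x. x \<in> I \<Longrightarrow> (g has_derivative (\<lambda>h. h *\<^sub>R g' x)) (at x within I)"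
      by blast
    have 1: "((\<lambda>x. \<Sum>n. f n x) has_vector_derivative g' x) (at x)" if "x \<in> I" for x
    proof -
      have "(g has_vector_derivative g' x) (at x)"
        using g(2)[OF that] at_within_open[OF that I(1)] by (simp add: has_vector_derivative_def)
      then show ?thesis
        by (rule has_vector_derivative_transform_within_open[OF _ I(1) that]) (use g(1) sums_unique in blast)
    qed
    have 2: "norm (\<Sum>n. f n x) \<le> suminf b" if "x \<in> I" for x
      by (rule norm_suminf_le[OF nb[OF that] b])
    have 4: "C_bound k \<gamma> (suminf b) I z g'"
      using Suc.IH[of f'] f'(2) unfolding g'_def by blast
    have 3: "(\<Sum>n. f n 0) = 0" if "z" "0 \<in> I" using Suc.prems that by simp
    show ?case unfolding C_bound.simps(2)[of k]
      by (intro conjI exI[of _ g'] impI ballI 1 2 3 4)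
  qed
qed

lemma of_real_has_vector_derivative:
  assumes "(h has_field_derivative h') (at (of_real x))"
  shows "((\<lambda>x. h (of_real x)) has_vector_derivative h') (at (x::real))"
  using has_vector_derivative_real_field[of h h' x UNIV] assms by simp

lemma C_bound_holomorphic:
  assumes S: "open S" and h: "h holomorphic_on S" and ab: "of_real ` {a..b} \<subseteq> S" and g: "0 \<le> \<gamma>" "\<gamma> \<le> 1"
  shows "\<exists>B. C_bound k \<gamma> B {a<..<b} False (\<lambda>x. h (of_real x))"
proof -
  have bd: "\<exists>B\<ge>0. \<forall>x\<in>{a<..<b}. norm (g (of_real x)) \<le> B" if "g holomorphic_on S" for g
  proof -
    have "compact (g ` of_real ` {a..b})"
      by (intro compact_continuous_image continuous_intros holomorphic_on_imp_continuous_on holomorphic_on_subset[OF that ab]) auto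
    then obtain B where "\<And>y. y \<in> g ` of_real ` {a..b} \<Longrightarrow> norm y \<le> B"
      using compact_imp_bounded bounded_iff by metis
    then have "norm (g (of_real x)) \<le> max 0 B" if "x \<in> {a<..<b}" for x
      using that by (force simp: le_max_iff_disj)
    then show ?thesis by (meson max.cobounded1)
  qed
  have der: "((\<lambda>x. g (of_real x)) has_vector_derivative deriv g (of_real x)) (at x)" if "g holomorphic_on S" "x \<in> {a<..<b}" for g x
    using that ab S by (intro of_real_has_vector_derivative holomorphic_derivI[OF that(1) S]) auto
  show ?thesis using h
  proof (induction k arbitrary: h)
    case 0
    obtain B where B: "B \<ge> 0" "\<And>x. x\<in>{a<..<b} \<Longrightarrow> norm (h (of_real x)) \<le> B" using bd[OF 0] by blast
    obtain B' where B': "B' \<ge> 0" "\<And>x. x\<in>{a<..<b} \<Longrightarrow> norm (deriv h (of_real x)) \<le> B'"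
      using bd[OF holomorphic_deriv[OF 0 S]] by blast
    define R where "R = max 1 \<bar>b - a\<bar>"
    have "norm (h (of_real x) - h (of_real y)) \<le> (B + R * B') * \<bar>x - y\<bar> powr \<gamma>" if xy: "x \<in> {a<..<b}" "y \<in> {a<..<b}" for x y
    proof -
      have "norm (h (of_real x) - h (of_real y)) \<le> B' * \<bar>x - y\<bar>"
        by (rule real_lipschitz_bound[of "{a<..<b}", OF _ der[OF 0] B'(2)]) (use xy in auto)
      also have "\<dots> \<le> B' * (R * \<bar>x - y\<bar> powr \<gamma>)"
        using xy g B' by (intro mult_left_mono powr_ge_self) (auto simp: R_def)
      also have "\<dots> \<le> (B + R * B') * \<bar>x - y\<bar> powr \<gamma>"
        using B by (simp add: algebra_simps)
      finally show ?thesis .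
    qed
    moreover have "norm (h (of_real x)) \<le> B + R * B'" if "x \<in> {a<..<b}" for x
    proof -
      have "0 \<le> R * B'" using B' by (simp add: R_def)
      then show ?thesis using B(2)[OF that] by linarith
    qed
    moreover have "continuous_on {a<..<b} (\<lambda>x. h (of_real x))"
      by (intro continuous_at_imp_continuous_on ballI) (rule has_vector_derivative_continuous[OF der[OF 0]])
    ultimately show ?case by (intro exI[of _ "B + R * B'"]) simp
  next
    case (Suc k)
    obtain B where B: "B \<ge> 0" "\<And>x. x\<in>{a<..<b} \<Longrightarrow> norm (h (of_real x)) \<le> B" using bd[OF Suc.prems] by blast
    obtain B' where B': "C_bound k \<gamma> B' {a<..<b} False (\<lambda>x. deriv h (of_real x))"
      using Suc.IH[OF holomorphic_deriv[OF Suc.prems S]] by blast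
    have 1: "C_bound k \<gamma> (max B B') {a<..<b} False (\<lambda>x. deriv h (of_real x))"
      by (rule C_bound_mono[OF B']) auto
    have 2: "norm (h (of_real x)) \<le> max B B'" if "x \<in> {a<..<b}" for x
      using B(2)[OF that] by (simp add: le_max_iff_disj)
    show ?case unfolding C_bound.simps(2)[of k]
      by (intro exI[of _ "max B B'"] conjI exI[of _ "\<lambda>x. deriv h (of_real x)"] ballI der[OF Suc.prems] 1 2) auto
  qed
qed

text \<open>A power is monotone in its base, in a direction given by the sign of the exponent.
  Taking both end values covers either sign, which is unknown for Re \<beta>.\<close>

lemma powr_between:
  assumes "0 < m" "m \<le> x" "x \<le> (M::real)"
  shows "x powr s \<le> m powr s + M powr s"
proof (cases "s \<ge> 0")
  case True
  then have "x powr s \<le> M powr s" using assms by (intro powr_mono2) auto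
  then show ?thesis using powr_ge_zero[of m s] by linarith
next
  case False
  then have "x powr s \<le> m powr s" using assms by (intro powr_mono2') auto
  then show ?thesis using powr_ge_zero[of M s] by linarith
qed

lemma cmod_of_real_powr: "0 < x \<Longrightarrow> cmod (of_real x powr s) = x powr Re s"
  by (simp add: norm_powr_real_powr)

text \<open>The denominators that occur are constants times \<kappa> x + 1, with \<kappa> = 1 / (m +
  1) for a branch and \<kappa> = c_w / d_w for a word. Both ratios lie in [0, 1], so a constant
  uniform in \<kappa> settles all weights, and with s = -2 the derivatives of all rescaled
  branches.\<close>

lemma C_bound_affine_powr:
  fixes s :: complex
  assumes a: "-1 < a" and g: "0 \<le> \<gamma>" "\<gamma> \<le> 1"
  shows "\<exists>C\<ge>0. \<forall>\<kappa>. 0 \<le> \<kappa> \<longrightarrow> \<kappa> \<le> 1 \<longrightarrow> C_bound k \<gamma> C {a<..<b} False (\<lambda>x. of_real (\<kappa> * x + 1) powr s)"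
proof -
  define m where "m = min 1 (1 + a)"
  define M where "M = 1 + \<bar>b\<bar>"
  have m: "0 < m" using a by (simp add: m_def)
  have rng: "m \<le> \<kappa> * x + 1" "\<kappa> * x + 1 \<le> M" if "0 \<le> \<kappa>" "\<kappa> \<le> 1" "x \<in> {a<..<b}" for \<kappa> x
  proof -
    show "m \<le> \<kappa> * x + 1"
    proof (cases "x \<ge> 0")
      case True then show ?thesis using that by (auto simp: m_def intro: order_trans[of _ 1])
    next
      case False
      then have "1 * x \<le> \<kappa> * x" using that by (intro mult_right_mono_neg) auto
      then show ?thesis using that by (auto simp: m_def)
    qed
    have "\<kappa> * x \<le> 1 * \<bar>b\<bar>"
    proof (cases "x \<ge> 0")
      case True then show ?thesis using that by (intro mult_mono) auto
    next
      case False then show ?thesis using that mult_nonneg_nonpos[of \<kappa> x] by auto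
    qed
    then show "\<kappa> * x + 1 \<le> M" by (simp add: M_def)
  qed
  define D where "D s = m powr Re s + M powr Re s" for s :: complex
  have D0: "0 \<le> D s" for s by (simp add: D_def)
  have D: "norm (of_real (\<kappa> * x + 1) powr s) \<le> D s" if "0 \<le> \<kappa>" "\<kappa> \<le> 1" "x \<in> {a<..<b}" for \<kappa> x and s :: complex
    using rng[OF that] m powr_between[OF m, of "\<kappa> * x + 1" M "Re s"]
    by (subst cmod_of_real_powr) (auto simp: D_def)
  have der: "((\<lambda>x. of_real (\<kappa> * x + 1) powr s) has_vector_derivative (of_real \<kappa> * s) * of_real (\<kappa> * x + 1) powr (s - 1)) (at x)"
    if "0 \<le> \<kappa>" "\<kappa> \<le> 1" "x \<in> {a<..<b}" for \<kappa> x and s :: complex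
  proof -
    have "0 < \<kappa> * x + 1" using rng[OF that] m by linarith
    then have "complex_of_real \<kappa> * of_real x + 1 \<notin> \<real>\<^sub>\<le>\<^sub>0"
      by (intro Re_pos_not_nonpos) auto
    then have "((\<lambda>z. (of_real \<kappa> * z + 1) powr s) has_field_derivative (of_real \<kappa> * s) * (of_real \<kappa> * of_real x + 1) powr (s - 1)) (at (of_real x))"
      by (auto intro!: derivative_eq_intros has_field_derivative_powr)
    then show ?thesis using of_real_has_vector_derivative by fastforce
  qed
  have nd: "norm ((of_real \<kappa> * s) * of_real (\<kappa> * x + 1) powr (s - 1)) \<le> norm s * D (s - 1)"
    if "0 \<le> \<kappa>" "\<kappa> \<le> 1" "x \<in> {a<..<b}" for \<kappa> x and s :: complex
  proof -
    have "\<kappa> * norm s \<le> 1 * norm s" using that by (intro mult_right_mono) auto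
    then show ?thesis using D[OF that, of "s - 1"] that by (simp only: norm_mult) (intro mult_mono, auto)
  qed
  define R where "R = max 1 \<bar>b - a\<bar>"
  show ?thesis
  proof (induction k arbitrary: s)
    case 0
    show ?case
    proof (intro exI[of _ "D s + R * (norm s * D (s - 1))"] conjI allI impI)
      have nn: "0 \<le> R * (norm s * D (s - 1))" using D0 by (simp add: R_def)
      then show "0 \<le> D s + R * (norm s * D (s - 1))" using D0[of s] by linarith
      fix \<kappa> :: real assume k: "0 \<le> \<kappa>" "\<kappa> \<le> 1"
      let ?f = "\<lambda>x. of_real (\<kappa> * x + 1) powr s"
      have 1: "norm (?f x) \<le> D s + R * (norm s * D (s - 1))" if "x \<in> {a<..<b}" for x
        using D[OF k that, of s] nn by linarith
      have 2: "continuous_on {a<..<b} ?f"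
        by (intro continuous_at_imp_continuous_on ballI) (rule has_vector_derivative_continuous[OF der[OF k]])
      have 3: "norm (?f x - ?f y) \<le> (D s + R * (norm s * D (s - 1))) * \<bar>x - y\<bar> powr \<gamma>" if xy: "x \<in> {a<..<b}" "y \<in> {a<..<b}" for x y
      proof -
        have "norm (?f x - ?f y) \<le> (norm s * D (s - 1)) * \<bar>x - y\<bar>"
          by (rule real_lipschitz_bound[of "{a<..<b}", OF _ der[OF k] nd[OF k]]) (use xy in auto)
        also have "\<dots> \<le> (norm s * D (s - 1)) * (R * \<bar>x - y\<bar> powr \<gamma>)"
          using xy g D0 by (intro mult_left_mono powr_ge_self) (auto simp: R_def)
        also have "\<dots> \<le> (D s + R * (norm s * D (s - 1))) * \<bar>x - y\<bar> powr \<gamma>"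
          using D0[of s] by (simp add: algebra_simps)
        finally show ?thesis .
      qed
      show "C_bound 0 \<gamma> (D s + R * (norm s * D (s - 1))) {a<..<b} False ?f"
        unfolding C_bound.simps(1) by (intro conjI ballI impI 1 2 3) auto
    qed
  next
    case (Suc k)
    obtain C where C: "0 \<le> C" "\<And>\<kappa>. 0 \<le> \<kappa> \<Longrightarrow> \<kappa> \<le> 1 \<Longrightarrow> C_bound k \<gamma> C {a<..<b} False (\<lambda>x. of_real (\<kappa> * x + 1) powr (s - 1))"
      using Suc.IH[of "s - 1"] by blast
    show ?case
    proof (intro exI[of _ "max (D s) (norm s * C)"] conjI allI impI)
      show "0 \<le> max (D s) (norm s * C)" using D0 by (simp add: le_max_iff_disj)
      fix \<kappa> :: real assume k: "0 \<le> \<kappa>" "\<kappa> \<le> 1"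
      have "norm (of_real \<kappa> * s) * C \<le> norm s * C"
        using k C(1) mult_right_mono[of \<kappa> 1 "norm s"] by (intro mult_right_mono) (auto simp: norm_mult)
      then have 1: "C_bound k \<gamma> (max (D s) (norm s * C)) {a<..<b} False (\<lambda>x. (of_real \<kappa> * s) * of_real (\<kappa> * x + 1) powr (s - 1))"
        by (intro C_bound_mono[OF C_bound_cmult[OF C(2)[OF k], of "of_real \<kappa> * s"]]) auto
      have 2: "norm (of_real (\<kappa> * x + 1) powr s) \<le> max (D s) (norm s * C)" if "x \<in> {a<..<b}" for x
        using D[OF k that, of s] by (simp add: le_max_iff_disj)
      show "C_bound (Suc k) \<gamma> (max (D s) (norm s * C)) {a<..<b} False (\<lambda>x. of_real (\<kappa> * x + 1) powr s)"
        unfolding C_bound.simps(2)[of k]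
        by (intro conjI ballI impI exI[of _ "\<lambda>x. (of_real \<kappa> * s) * of_real (\<kappa> * x + 1) powr (s - 1)"] der[OF k] 1 2) auto
    qed
  qed
qed

section \<open>Iterated derivatives, and the C^\<alpha> condition read on bounded intervals\<close>

lemma vderiv_0 [simp]: "vderiv 0 f = f" by (simp add: vderiv_def)

lemma vderiv_Suc: "vderiv (Suc n) f = (\<lambda>x. vector_derivative (vderiv n f) (at x))"
  by (simp add: vderiv_def)

lemma vderiv_Suc_right: "vderiv (Suc n) f = vderiv n (vderiv (Suc 0) f)"
  by (simp add: vderiv_def funpow_Suc_right del: funpow.simps(2))

lemma C_bound_vderiv_1:
  assumes I: "open I" and f: "C_bound (Suc k) \<gamma> B I z f"
  shows "C_bound k \<gamma> B I z (vderiv (Suc 0) f)"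
    and "\<And>x. x \<in> I \<Longrightarrow> (f has_vector_derivative vderiv (Suc 0) f x) (at x)"
proof -
  obtain f' where f': "\<And>x. x \<in> I \<Longrightarrow> (f has_vector_derivative f' x) (at x)" "C_bound k \<gamma> B I z f'"
    using C_bound_SucE[OF f] by blast
  have eq: "vderiv (Suc 0) f x = f' x" if "x \<in> I" for x
    using vector_derivative_at[OF f'(1)[OF that]] by (simp add: vderiv_def)
  show "C_bound k \<gamma> B I z (vderiv (Suc 0) f)" by (rule C_bound_cong[OF I _ f'(2)]) (simp add: eq)
  show "(f has_vector_derivative vderiv (Suc 0) f x) (at x)" if "x \<in> I" for x
    using f'(1)[OF that] eq[OF that] by simp
qed

lemma C_bound_vderiv:
  assumes I: "open I" and "C_bound k \<gamma> B I z f" "n \<le> k"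
  shows "C_bound (k - n) \<gamma> B I z (vderiv n f)"
  using assms(2,3)
proof (induction n arbitrary: f k)
  case (Suc n)
  then obtain k' where k: "k = Suc k'" by (cases k) auto
  show ?case using Suc.IH[of k' "vderiv (Suc 0) f"] C_bound_vderiv_1(1)[OF I Suc.prems(1)[unfolded k]] Suc.prems(2) k
    by (subst vderiv_Suc_right) simp
qed simp

lemma C_bound_vderiv_differentiable:
  assumes I: "open I" and "C_bound k \<gamma> B I z f" "n < k" "x \<in> I"
  shows "vderiv n f differentiable (at x)"
proof -
  have "C_bound (Suc (k - Suc n)) \<gamma> B I z (vderiv n f)"
    using C_bound_vderiv[OF I assms(2), of n] assms(3) by (simp add: Suc_diff_Suc)
  from C_bound_vderiv_1(2)[OF I this assms(4)] show ?thesis by (rule differentiableI_vector)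
qed

lemma C_bound_flat_vderiv:
  assumes "open I" "C_bound k \<gamma> B I True f" "n \<le> k" "0 \<in> I"
  shows "vderiv n f 0 = 0"
  using C_bound_flat[OF C_bound_vderiv[OF assms(1-3)] assms(4)] .

lemma C_boundI_vderiv:
  assumes "\<And>n x. n < k \<Longrightarrow> x \<in> I \<Longrightarrow> vderiv n f differentiable (at x)"
    "\<And>n x. n \<le> k \<Longrightarrow> x \<in> I \<Longrightarrow> norm (vderiv n f x) \<le> B"
    "continuous_on I (vderiv k f)"
    "\<And>x y. x \<in> I \<Longrightarrow> y \<in> I \<Longrightarrow> norm (vderiv k f x - vderiv k f y) \<le> B * \<bar>x - y\<bar> powr \<gamma>"
  shows "C_bound k \<gamma> B I False f"
  using assms
proof (induction k arbitrary: f)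
  case 0
  then show ?case by simp
next
  case (Suc k)
  have 1: "C_bound k \<gamma> B I False (vderiv (Suc 0) f)"
  proof (rule Suc.IH)
    show "vderiv n (vderiv (Suc 0) f) differentiable at x" if "n < k" "x \<in> I" for n x
      using Suc.prems(1)[of "Suc n" x] that vderiv_Suc_right[of n f] by simp
    show "norm (vderiv n (vderiv (Suc 0) f) x) \<le> B" if "n \<le> k" "x \<in> I" for n x
      using Suc.prems(2)[of "Suc n" x] that vderiv_Suc_right[of n f] by simp
  qed (use Suc.prems(3,4) vderiv_Suc_right[of k f] in simp_all)
  have 2: "(f has_vector_derivative vderiv (Suc 0) f x) (at x)" if "x \<in> I" for x
    using Suc.prems(1)[of 0 x] that by (simp add: vderiv_def flip: vector_derivative_works)
  have 3: "norm (f x) \<le> B" if "x \<in> I" for x using Suc.prems(2)[of 0 x] that by simp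
  show ?case unfolding C_bound.simps(2)[of k] by (intro conjI ballI exI[of _ "vderiv (Suc 0) f"] 1 2 3) auto
qed

lemma vderiv_cong:
  assumes "open I" "\<And>x. x \<in> I \<Longrightarrow> f x = g x" "x \<in> I"
  shows "vderiv n f x = vderiv n g x"
  using assms(3)
proof (induction n arbitrary: x)
  case (Suc n)
  have "(vderiv n f has_vector_derivative D) (at x) \<longleftrightarrow> (vderiv n g has_vector_derivative D) (at x)" for D
    using has_vector_derivative_transform_within_open[OF _ assms(1) Suc.prems, of "vderiv n f" D "vderiv n g"]
      has_vector_derivative_transform_within_open[OF _ assms(1) Suc.prems, of "vderiv n g" D "vderiv n f"] Suc.IH
    by auto
  then show ?case by (simp add: vderiv_Suc vector_derivative_def)
qed (use assms in auto)

definition frac_part :: "real \<Rightarrow> real" where "frac_part \<alpha> = \<alpha> - of_int \<lfloor>\<alpha>\<rfloor>"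

lemma frac_part_bounds: "0 \<le> frac_part \<alpha>" "frac_part \<alpha> < 1" "frac_part \<alpha> \<le> 1"
  unfolding frac_part_def by linarith+

text \<open>Compact subsets of the half-line sit in closed intervals, where the lower derivatives
  are bounded by continuity; so the condition on the top derivative alone yields a full
  \<open>C_bound\<close>. For integral \<alpha> the Hoelder exponent is 0 and its condition follows
  from the boundedness of the top derivative.\<close>

lemma C_alpha_iff:
  assumes "\<alpha> > 0"
  shows "f \<in> C_alpha \<alpha> \<longleftrightarrow> (\<forall>x. x \<notin> {-1<..} \<longrightarrow> f x = 0) \<and>
     (\<forall>a b. -1 < a \<longrightarrow> a < b \<longrightarrow> (\<exists>B. C_bound (nat \<lfloor>\<alpha>\<rfloor>) (frac_part \<alpha>) B {a<..<b} False f))"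
    (is "_ \<longleftrightarrow> ?Z \<and> ?R")
proof -
  define k where "k = nat \<lfloor>\<alpha>\<rfloor>"
  define \<gamma> where "\<gamma> = frac_part \<alpha>"
  have hexp: "\<alpha> - of_int \<lfloor>\<alpha>\<rfloor> = \<gamma>" by (simp add: \<gamma>_def frac_part_def)
  have int: "\<alpha> \<in> \<int> \<longleftrightarrow> \<gamma> = 0" 
    unfolding \<gamma>_def frac_part_def by (auto elim!: Ints_cases) (metis Ints_of_int)
  show ?thesis
  proof
    assume f: "f \<in> C_alpha \<alpha>"
    have Z: ?Z using f by (simp add: C_alpha_def)
    have df: "vderiv n f differentiable (at x)" if "n < k" "x > -1" for n x
      using f that by (auto simp: C_alpha_def k_def)
    have top: "if \<alpha> \<in> \<int> then continuous_on K (vderiv k f) else \<exists>C. \<forall>x\<in>K. \<forall>y\<in>K.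
           norm (vderiv k f x - vderiv k f y) \<le> C * \<bar>x - y\<bar> powr \<gamma>" if "compact K" "K \<subseteq> {-1<..}" for K
      using f that unfolding C_alpha_def k_def hexp by blast
    have "?R"
    proof (intro allI impI)
      fix a b :: real assume ab: "-1 < a" "a < b"
      have sub: "{a..b} \<subseteq> {-1<..}" using ab by auto
      have contk: "continuous_on {a..b} (vderiv k f)"
      proof (cases "\<alpha> \<in> \<int>")
        case True then show ?thesis using top[OF _ sub] by simp
      next
        case False
        then have g: "0 < \<gamma>" using int frac_part_bounds[of \<alpha>] by (simp add: \<gamma>_def)
        obtain C where C: "\<And>x y. x \<in> {a..b} \<Longrightarrow> y \<in> {a..b} \<Longrightarrow> norm (vderiv k f x - vderiv k f y) \<le> C * \<bar>x - y\<bar> powr \<gamma>"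
          using top[OF compact_Icc sub] False by (simp only: if_False) blast
        show ?thesis unfolding continuous_on_def
        proof
          fix x assume x: "x \<in> {a..b}"
          have "((\<lambda>y. C * \<bar>y - x\<bar> powr \<gamma>) \<longlongrightarrow> C * \<bar>x - x\<bar> powr \<gamma>) (at x within {a..b})"
            using g by (intro tendsto_intros) auto
          then have "((\<lambda>y. C * \<bar>y - x\<bar> powr \<gamma>) \<longlongrightarrow> 0) (at x within {a..b})" by simp
          then have "((\<lambda>y. vderiv k f y - vderiv k f x) \<longlongrightarrow> 0) (at x within {a..b})"
            by (rule Lim_null_comparison[rotated]) (use C x in \<open>auto simp: eventually_at_filter intro!: always_eventually\<close>)
          then show "(vderiv k f \<longlongrightarrow> vderiv k f x) (at x within {a..b})" by (simp add: Lim_null[symmetric])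
        qed
      qed
      have cont: "continuous_on {a..b} (vderiv n f)" if "n \<le> k" for n
      proof (cases "n = k")
        case False
        then show ?thesis using df[of n] that ab
          by (intro continuous_at_imp_continuous_on ballI differentiable_imp_continuous_within) auto
      qed (use contk in simp)
      have "\<exists>B. \<forall>x\<in>{a..b}. norm (vderiv n f x) \<le> B" if "n \<le> k" for n
        using compact_imp_bounded[OF compact_continuous_image[OF cont[OF that]]] by (auto simp: bounded_iff)
      then obtain Bn where Bn: "\<And>n x. n \<le> k \<Longrightarrow> x \<in> {a..b} \<Longrightarrow> norm (vderiv n f x) \<le> Bn n"
        by metis
      define B0 where "B0 = (\<Sum>n\<le>k. \<bar>Bn n\<bar>)"
      have B0: "norm (vderiv n f x) \<le> B0" if "n \<le> k" "x \<in> {a..b}" for n x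
      proof -
        have "\<bar>Bn n\<bar> \<le> B0" unfolding B0_def using that by (intro member_le_sum) auto
        then show ?thesis using Bn[OF that] by linarith
      qed
      obtain C where C: "\<And>x y. x \<in> {a..b} \<Longrightarrow> y \<in> {a..b} \<Longrightarrow> norm (vderiv k f x - vderiv k f y) \<le> C * \<bar>x - y\<bar> powr \<gamma>"
      proof (cases "\<alpha> \<in> \<int>")
        case True
        then have g: "\<gamma> = 0" using int by simp
        have "norm (vderiv k f x - vderiv k f y) \<le> (2 * B0) * \<bar>x - y\<bar> powr \<gamma>" if "x \<in> {a..b}" "y \<in> {a..b}" for x y
        \<comment> \<open>\<open>0 powr 0\<close> is 0, so with exponent 0 the right-hand side is 2
          * B0 only for x \<noteq> y; at x = y both sides vanish.\<close>
        proof (cases "x = y")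
          case False
          then show ?thesis using B0[of k x] B0[of k y] that norm_triangle_ineq4[of "vderiv k f x" "vderiv k f y"] g by auto
        qed simp
        then show ?thesis using that by blast
      next
        case False
        then show ?thesis using top[OF compact_Icc sub] that by (simp only: if_False) blast
      qed
      have "C_bound k \<gamma> (B0 + \<bar>C\<bar>) {a<..<b} False f"
      proof (rule C_boundI_vderiv)
        show "norm (vderiv k f x - vderiv k f y) \<le> (B0 + \<bar>C\<bar>) * \<bar>x - y\<bar> powr \<gamma>" if xy: "x \<in> {a<..<b}" "y \<in> {a<..<b}" for x y
        proof -
          have "0 \<le> B0" by (simp add: B0_def sum_nonneg)
          then have "C * \<bar>x - y\<bar> powr \<gamma> \<le> (B0 + \<bar>C\<bar>) * \<bar>x - y\<bar> powr \<gamma>" by (intro mult_right_mono) auto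
          then show ?thesis using C[of x y] xy by auto
        qed
        show "norm (vderiv n f x) \<le> B0 + \<bar>C\<bar>" if "n \<le> k" "x \<in> {a<..<b}" for n x
          using B0[of n x] that by auto
        show "continuous_on {a<..<b} (vderiv k f)" by (rule continuous_on_subset[OF contk]) auto
      qed (use df ab in auto)
      then show "\<exists>B. C_bound (nat \<lfloor>\<alpha>\<rfloor>) (frac_part \<alpha>) B {a<..<b} False f" unfolding k_def \<gamma>_def by blast
    qed
    with Z show "?Z \<and> ?R" by blast
  next
    assume ZR: "?Z \<and> ?R"
    then have R: "\<exists>B. C_bound k \<gamma> B {a<..<b} False f" if "-1 < a" "a < b" for a b
      using that by (simp add: k_def \<gamma>_def)
    have 1: "vderiv n f differentiable (at x)" if "n < k" "x \<in> {-1<..}" for n x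
    proof -
      obtain B where "C_bound k \<gamma> B {(x - 1) / 2<..<x + 1} False f" using R[of "(x - 1)/2" "x + 1"] \<open>x \<in> {-1<..}\<close> by auto
      from C_bound_vderiv_differentiable[OF _ this \<open>n < k\<close>, of x] \<open>x \<in> {-1<..}\<close> show ?thesis by auto
    qed
    have 2: "if \<alpha> \<in> \<int> then continuous_on K (vderiv k f) else \<exists>C. \<forall>x\<in>K. \<forall>y\<in>K.
           norm (vderiv k f x - vderiv k f y) \<le> C * \<bar>x - y\<bar> powr \<gamma>" if K: "compact K" "K \<subseteq> {-1<..}" for K
    proof (cases "K = {}")
      case False
      then obtain l u where l: "l \<in> K" "\<And>x. x \<in> K \<Longrightarrow> l \<le> x" and u: "u \<in> K" "\<And>x. x \<in> K \<Longrightarrow> x \<le> u"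
        using compact_attains_inf[OF K(1)] compact_attains_sup[OF K(1)] by metis
      have "l > -1" using l K by auto
      then obtain B where B: "C_bound k \<gamma> B {(l - 1) / 2<..<u + 1} False f"
        using R[of "(l - 1)/2" "u + 1"] l u by fastforce
      have sub: "K \<subseteq> {(l - 1) / 2<..<u + 1}" using l(2) u(2) \<open>l > -1\<close> by force
      have C0: "C_bound 0 \<gamma> B {(l - 1) / 2<..<u + 1} False (vderiv k f)"
        using C_bound_vderiv[OF _ B, of k] by simp
      have "continuous_on K (vderiv k f)" using C_bound_continuous_on[OF C0] sub continuous_on_subset by blast
      moreover have "\<forall>x\<in>K. \<forall>y\<in>K. norm (vderiv k f x - vderiv k f y) \<le> B * \<bar>x - y\<bar> powr \<gamma>"
        using C_bound_holder[OF C0] sub by blast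
      ultimately show ?thesis by auto
    qed auto
    show "f \<in> C_alpha \<alpha>"
      unfolding C_alpha_def mem_Collect_eq hexp k_def[symmetric] using ZR 1 2 by blast
  qed
qed

section \<open>Taylor polynomials and the operator on the half-line\<close>

text \<open>The argument is complex because the polynomial is used both on the interval and as an
  entire function on the disc, while f itself lives on the real line.\<close>

definition taylor :: "nat \<Rightarrow> (real \<Rightarrow> complex) \<Rightarrow> real \<Rightarrow> complex \<Rightarrow> complex" where
  "taylor k f x0 \<zeta> = (\<Sum>n\<le>k. vderiv n f x0 / fact n * (\<zeta> - of_real x0) ^ n)"

lemma taylor_0 [simp]: "taylor 0 f x0 \<zeta> = f x0"
  by (simp add: taylor_def)

lemma taylor_center [simp]: "taylor k f x0 (of_real x0) = f x0"
  unfolding taylor_def by (subst sum.atMost_shift) simp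

lemma taylor_has_field_derivative:
  "(taylor (Suc k) f x0 has_field_derivative taylor k (vderiv (Suc 0) f) x0 \<zeta>) (at \<zeta>)"
proof -
  have eq: "taylor (Suc k) f x0 = (\<lambda>\<zeta>. f x0 + (\<Sum>n\<le>k. vderiv (Suc n) f x0 / fact (Suc n) * (\<zeta> - of_real x0) ^ Suc n))"
    unfolding taylor_def by (subst sum.atMost_Suc_shift) simp
  have "((\<lambda>\<zeta>. vderiv (Suc n) f x0 / fact (Suc n) * (\<zeta> - of_real x0) ^ Suc n) has_field_derivative
       vderiv n (vderiv (Suc 0) f) x0 / fact n * (\<zeta> - of_real x0) ^ n) (at \<zeta>)" for n
  proof -
    have "((\<lambda>\<zeta>. vderiv (Suc n) f x0 / fact (Suc n) * (\<zeta> - of_real x0) ^ Suc n) has_field_derivative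
       vderiv (Suc n) f x0 / fact (Suc n) * (of_nat (Suc n) * (\<zeta> - of_real x0) ^ n)) (at \<zeta>)"
      by (auto intro!: derivative_eq_intros simp del: of_nat_Suc power_Suc fact_Suc)
    moreover have "of_nat (Suc n) \<noteq> (0::complex)" by (simp del: of_nat_Suc)
    ultimately show ?thesis unfolding vderiv_Suc_right[of n f] by (simp add: divide_simps del: of_nat_Suc)
  qed
  then have "((\<lambda>\<zeta>. f x0 + (\<Sum>n\<le>k. vderiv (Suc n) f x0 / fact (Suc n) * (\<zeta> - of_real x0) ^ Suc n)) has_field_derivative
      0 + (\<Sum>n\<le>k. vderiv n (vderiv (Suc 0) f) x0 / fact n * (\<zeta> - of_real x0) ^ n)) (at \<zeta>)"
    by (intro DERIV_add DERIV_const DERIV_sum)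
  then show ?thesis unfolding eq taylor_def by simp
qed

text \<open>The gain of order k + \<gamma> in |\<delta>|: differentiating in y produces \<delta>
  times the remainder of the derivative of q, the last step uses the Hoelder condition, and the
  values are recovered by the mean value estimate from y = 0, where the remainder vanishes. Later
  |\<delta>| is 1 / (m + 1) for a branch and 1 / d_w^2 for a word.\<close>

lemma C_bound_taylor:
  assumes I: "open I" "convex I" and g: "0 \<le> \<gamma>" "\<gamma> \<le> 1" and R: "1 \<le> R" and x0: "x0 \<in> I" and d: "\<delta> \<noteq> 0"
    and "C_bound k \<gamma> B I z q"
  shows "C_bound k \<gamma> (R ^ Suc k * B * \<bar>\<delta>\<bar> powr (real k + \<gamma>)) ({y. x0 + \<delta> * y \<in> I} \<inter> {-R<..<R}) True
     (\<lambda>y. q (x0 + \<delta> * y) - taylor k q x0 (of_real (x0 + \<delta> * y)))"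
  using assms(8)
proof (induction k arbitrary: q)
  case 0
  have B: "0 \<le> B" using C_bound_nonneg[OF 0 x0] .
  let ?J = "{y. x0 + \<delta> * y \<in> I} \<inter> {-R<..<R}"
  have H: "norm (q (x0 + \<delta> * y) - q (x0 + \<delta> * y')) \<le> B * \<bar>\<delta>\<bar> powr \<gamma> * \<bar>y - y'\<bar> powr \<gamma>"
    if "x0 + \<delta> * y \<in> I" "x0 + \<delta> * y' \<in> I" for y y'
  proof -
    have "x0 + \<delta> * y - (x0 + \<delta> * y') = \<delta> * (y - y')" by (simp add: algebra_simps)
    then show ?thesis using C_bound_holder[OF 0 that] by (simp add: abs_mult powr_mult mult.assoc)
  qed
  have 1: "norm (q (x0 + \<delta> * y) - taylor 0 q x0 (of_real (x0 + \<delta> * y))) \<le> R ^ Suc 0 * B * \<bar>\<delta>\<bar> powr (real 0 + \<gamma>)" if "y \<in> ?J" for y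
  proof -
    have "norm (q (x0 + \<delta> * y) - q x0) \<le> B * \<bar>\<delta>\<bar> powr \<gamma> * \<bar>y\<bar> powr \<gamma>" using H[of y 0] that x0 by simp
    also have "\<dots> \<le> B * \<bar>\<delta>\<bar> powr \<gamma> * R powr \<gamma>" using that g B by (intro mult_left_mono powr_mono2) auto
    also have "\<dots> \<le> B * \<bar>\<delta>\<bar> powr \<gamma> * R powr 1" using R g B by (intro mult_left_mono powr_mono) auto
    finally show ?thesis using R by (simp add: mult_ac)
  qed
  have 2: "norm (q (x0 + \<delta> * y) - taylor 0 q x0 (of_real (x0 + \<delta> * y)) - (q (x0 + \<delta> * y') - taylor 0 q x0 (of_real (x0 + \<delta> * y'))))
      \<le> R ^ Suc 0 * B * \<bar>\<delta>\<bar> powr (real 0 + \<gamma>) * \<bar>y - y'\<bar> powr \<gamma>" if "y \<in> ?J" "y' \<in> ?J" for y y'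
  proof -
    have "norm (q (x0 + \<delta> * y) - q (x0 + \<delta> * y')) \<le> 1 * (B * \<bar>\<delta>\<bar> powr \<gamma> * \<bar>y - y'\<bar> powr \<gamma>)" using H[of y y'] that by simp
    also have "\<dots> \<le> R * (B * \<bar>\<delta>\<bar> powr \<gamma> * \<bar>y - y'\<bar> powr \<gamma>)" using B R by (intro mult_right_mono) auto
    finally show ?thesis by (simp add: mult_ac)
  qed
  have 3: "continuous_on ?J (\<lambda>y. q (x0 + \<delta> * y) - taylor 0 q x0 (of_real (x0 + \<delta> * y)))"
  proof -
    have "continuous_on ?J (\<lambda>y. q (x0 + \<delta> * y))"
      by (rule continuous_on_compose2[OF C_bound_continuous_on[OF 0]]) (auto intro!: continuous_intros)
    then show ?thesis by (auto intro!: continuous_intros)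
  qed
  show ?case unfolding C_bound.simps(1) by (intro conjI ballI impI 1 2 3) simp
next
  case (Suc k)
  have B: "0 \<le> B" using C_bound_nonneg[OF Suc.prems x0] .
  let ?J = "{y. x0 + \<delta> * y \<in> I} \<inter> {-R<..<R}"
  note q1 = C_bound_vderiv_1[OF I(1) Suc.prems]
  let ?p = "\<lambda>y. q (x0 + \<delta> * y) - taylor (Suc k) q x0 (of_real (x0 + \<delta> * y))"
  let ?p1 = "\<lambda>y. vderiv (Suc 0) q (x0 + \<delta> * y) - taylor k (vderiv (Suc 0) q) x0 (of_real (x0 + \<delta> * y))"
  define E where "E = R ^ Suc k * B * \<bar>\<delta>\<bar> powr (real (Suc k) + \<gamma>)"
  have E0: "0 \<le> E" using B R by (simp add: E_def)
  have dd: "\<bar>\<delta>\<bar> * \<bar>\<delta>\<bar> powr (real k + \<gamma>) = \<bar>\<delta>\<bar> powr (real (Suc k) + \<gamma>)"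
    using d by (simp add: powr_mult_base add_ac)
  have p1: "C_bound k \<gamma> E ?J True (\<lambda>y. of_real \<delta> * ?p1 y)"
  proof -
    have "cmod (of_real \<delta>) * (R ^ Suc k * B * \<bar>\<delta>\<bar> powr (real k + \<gamma>)) = E"
      unfolding E_def dd[symmetric] by (simp add: mult_ac)
    then show ?thesis using C_bound_cmult[OF Suc.IH[OF q1(1)], of "of_real \<delta>"] by (simp only:)
  qed
  have EE: "E \<le> R ^ Suc (Suc k) * B * \<bar>\<delta>\<bar> powr (real (Suc k) + \<gamma>)"
  proof -
    have "1 * E \<le> R * E" using R E0 by (intro mult_right_mono) auto
    then show ?thesis by (simp add: E_def mult_ac)
  qed
  have der: "(?p has_vector_derivative of_real \<delta> * ?p1 y) (at y)" if "y \<in> ?J" for y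
  proof -
    have "((\<lambda>y. x0 + \<delta> * y) has_vector_derivative \<delta>) (at y)" by (auto intro!: derivative_eq_intros)
    from vector_diff_chain_at[OF this, of q] q1(2)[of "x0 + \<delta> * y"] that
    have 1: "((\<lambda>y. q (x0 + \<delta> * y)) has_vector_derivative of_real \<delta> * vderiv (Suc 0) q (x0 + \<delta> * y)) (at y)"
      by (simp add: o_def scaleR_conv_of_real)
    have "((\<lambda>\<zeta>. taylor (Suc k) q x0 (of_real x0 + of_real \<delta> * \<zeta>)) has_field_derivative
        taylor k (vderiv (Suc 0) q) x0 (of_real x0 + of_real \<delta> * of_real y) * of_real \<delta>) (at (of_real y))"
      by (rule DERIV_chain2[OF taylor_has_field_derivative]) (auto intro!: derivative_eq_intros)
    from of_real_has_vector_derivative[OF this]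
    have 2: "((\<lambda>y. taylor (Suc k) q x0 (of_real (x0 + \<delta> * y))) has_vector_derivative
        of_real \<delta> * taylor k (vderiv (Suc 0) q) x0 (of_real (x0 + \<delta> * y))) (at y)"
      by (simp add: mult.commute)
    show ?thesis using has_vector_derivative_diff[OF 1 2] by (simp add: right_diff_distrib)
  qed
  have cJ: "convex ?J"
  proof (rule convex_Int)
    show "convex {y. x0 + \<delta> * y \<in> I}"
    proof (rule convexI, clarsimp)
      fix y y' u v :: real assume *: "x0 + \<delta> * y \<in> I" "x0 + \<delta> * y' \<in> I" "0 \<le> u" "0 \<le> v" "u + v = 1"
      have "x0 + \<delta> * (u * y + v * y') = u *\<^sub>R (x0 + \<delta> * y) + v *\<^sub>R (x0 + \<delta> * y')"
      proof -
        have "x0 = (u + v) * x0" using * by simp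
        then show ?thesis by (simp add: algebra_simps)
      qed
      then show "x0 + \<delta> * (u * y + v * y') \<in> I" using convexD[OF I(2) *] by metis
    qed
  qed auto
  have 1: "norm (?p y) \<le> R ^ Suc (Suc k) * B * \<bar>\<delta>\<bar> powr (real (Suc k) + \<gamma>)" if y: "y \<in> ?J" for y
  proof -
    have "norm (?p y - ?p 0) \<le> E * \<bar>y - 0\<bar>"
      by (rule real_lipschitz_bound[OF cJ der C_bound_norm[OF p1]]) (use y x0 R in auto)
    then have "norm (?p y) \<le> E * \<bar>y\<bar>" by simp
    also have "\<dots> \<le> E * R" using y E0 by (intro mult_left_mono) auto
    finally show ?thesis by (simp add: E_def mult_ac)
  qed
  have 2: "C_bound k \<gamma> (R ^ Suc (Suc k) * B * \<bar>\<delta>\<bar> powr (real (Suc k) + \<gamma>)) ?J True (\<lambda>y. of_real \<delta> * ?p1 y)"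
    using C_bound_mono[OF p1 EE] by blast
  show ?case unfolding C_bound.simps(2)[of k]
    by (intro conjI ballI impI exI[of _ "\<lambda>y. of_real \<delta> * ?p1 y"] der 1 2) simp
qed

text \<open>The rescaled remainder with step \<open>y - x\<close>, evaluated at 1; the choice R = 2
  puts 1 inside the open interval.\<close>

lemma taylor_remainder_bound:
  assumes I: "open I" "convex I" and g: "0 \<le> \<gamma>" "\<gamma> \<le> 1" and xy: "x \<in> I" "y \<in> I" and q: "C_bound k \<gamma> B I z q"
  shows "norm (q y - taylor k q x (of_real y)) \<le> 2 ^ Suc k * B * \<bar>y - x\<bar> powr (real k + \<gamma>)"
proof (cases "x = y")
  case False
  then show ?thesis
    using C_bound_norm[OF C_bound_taylor[OF I g _ xy(1) _ q, of 2 "y - x"], of 1] xy by simp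
qed simp

text \<open>Off the real line q has no values, so two of its Taylor polynomials are compared with
  each other. At \<zeta> = x the difference is a Taylor remainder of q based at x', and its
  \<zeta>-derivative is the same difference for the derivative of q, one degree lower. This bounds
  the correction terms \<open>dterm\<close> on the complex disc.\<close>

lemma taylor_diff_bound:
  assumes I: "open I" "convex I" and g: "0 \<le> \<gamma>" "\<gamma> \<le> 1" and x: "x \<in> I" "x' \<in> I"
    and d: "\<bar>x - x'\<bar> \<le> \<delta>" "norm (\<zeta> - of_real x) \<le> \<delta>" "0 < \<delta>" and "C_bound k \<gamma> B I z q"
  shows "norm (taylor k q x \<zeta> - taylor k q x' \<zeta>) \<le> 2 ^ (k + 2) * B * \<delta> powr (real k + \<gamma>)"
  using assms(10) d(2)
proof (induction k arbitrary: q \<zeta>)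
  case 0
  have B: "0 \<le> B" using C_bound_nonneg[OF 0(1) x(1)] .
  have "norm (q x - q x') \<le> B * \<bar>x - x'\<bar> powr \<gamma>" using C_bound_holder[OF 0(1) x] .
  also have "\<dots> \<le> B * \<delta> powr \<gamma>" using d g B by (intro mult_left_mono powr_mono2) auto
  also have "\<dots> \<le> 4 * (B * \<delta> powr \<gamma>)" using B by simp
  finally show ?case by simp
next
  case (Suc k)
  have B: "0 \<le> B" using C_bound_nonneg[OF Suc.prems(1) x(1)] .
  let ?F = "\<lambda>\<zeta>. taylor (Suc k) q x \<zeta> - taylor (Suc k) q x' \<zeta>"
  let ?F' = "\<lambda>\<zeta>. taylor k (vderiv (Suc 0) q) x \<zeta> - taylor k (vderiv (Suc 0) q) x' \<zeta>"
  have "norm (?F \<zeta> - ?F (of_real x)) \<le> 2 ^ (k + 2) * B * \<delta> powr (real k + \<gamma>) * norm (\<zeta> - of_real x)"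
  proof (rule field_differentiable_bound[of "cball (of_real x) \<delta>" ?F ?F'])
    show "(?F has_field_derivative ?F' \<xi>) (at \<xi> within cball (of_real x) \<delta>)" for \<xi>
      by (intro has_field_derivative_at_within[OF DERIV_diff] taylor_has_field_derivative)
    show "norm (?F' \<xi>) \<le> 2 ^ (k + 2) * B * \<delta> powr (real k + \<gamma>)" if "\<xi> \<in> cball (of_real x) \<delta>" for \<xi>
      using that by (intro Suc.IH C_bound_vderiv_1(1)[OF I(1) Suc.prems(1)]) (auto simp: dist_norm norm_minus_commute)
  qed (use Suc.prems d in \<open>auto simp: dist_norm norm_minus_commute\<close>)
  also have "\<dots> \<le> 2 ^ (k + 2) * B * \<delta> powr (real k + \<gamma>) * \<delta>"
    using Suc.prems B by (intro mult_left_mono) auto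
  also have "\<dots> = 2 ^ (k + 2) * B * \<delta> powr (real (Suc k) + \<gamma>)"
  proof -
    have "\<delta> * \<delta> powr (real k + \<gamma>) = \<delta> powr (real (Suc k) + \<gamma>)" using d by (simp add: powr_mult_base add_ac)
    then show ?thesis by (simp add: mult_ac)
  qed
  finally have 1: "norm (?F \<zeta> - ?F (of_real x)) \<le> 2 ^ (k + 2) * B * \<delta> powr (real (Suc k) + \<gamma>)" .
  have "norm (?F (of_real x)) \<le> 2 ^ Suc (Suc k) * B * \<bar>x - x'\<bar> powr (real (Suc k) + \<gamma>)"
    using taylor_remainder_bound[OF I g x(2,1) Suc.prems(1)] by simp
  also have "\<dots> \<le> 2 ^ Suc (Suc k) * B * \<delta> powr (real (Suc k) + \<gamma>)"
    using d g B by (intro mult_left_mono powr_mono2) auto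
  finally have 2: "norm (?F (of_real x)) \<le> 2 ^ (k + 2) * B * \<delta> powr (real (Suc k) + \<gamma>)" by simp
  have "norm (?F \<zeta>) \<le> norm (?F \<zeta> - ?F (of_real x)) + norm (?F (of_real x))"
    using norm_triangle_ineq[of "?F \<zeta> - ?F (of_real x)" "?F (of_real x)"] by simp
  then show ?case using 1 2 by simp
qed

lemma vderiv_lincomb:
  assumes I: "open I" and f: "C_bound k \<gamma> B I False f" and g: "C_bound k \<gamma> B' I False g" and "n \<le> k" "x \<in> I"
  shows "vderiv n (\<lambda>x. f x + c * g x) x = vderiv n f x + c * vderiv n g x"
  using assms(4,5)
proof (induction n arbitrary: x)
  case (Suc n)
  have d: "(vderiv n h has_vector_derivative vderiv (Suc n) h x) (at x)" if "C_bound k \<gamma> B I False h" for h B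
    using C_bound_vderiv_differentiable[OF I that, of n x] Suc.prems
    by (simp add: vderiv_Suc vector_derivative_works[symmetric])
  have "((\<lambda>x. vderiv n f x + c * vderiv n g x) has_vector_derivative vderiv (Suc n) f x + c * vderiv (Suc n) g x) (at x)"
    using d[OF f] d[OF g] by (auto intro!: derivative_eq_intros)
  then have "(vderiv n (\<lambda>x. f x + c * g x) has_vector_derivative vderiv (Suc n) f x + c * vderiv (Suc n) g x) (at x)"
    by (rule has_vector_derivative_transform_within_open[OF _ I Suc.prems(2)]) (use Suc in auto)
  then show ?case by (simp add: vderiv_Suc vector_derivative_at)
qed simp

section \<open>The operator on functions of a real variable: convergence, recursion, regularity,
  locality\<close>

locale transfer_params =
  fixes \<alpha> :: real and \<beta> :: complex
  assumes alpha_pos: "\<alpha> > 0" and not_pole: "\<And>j::nat. \<beta> \<noteq> (1 - of_nat j) / 2" and Re_beta: "Re \<beta> > (1 - \<alpha>) / 2"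
begin

definition deg :: nat where "deg = nat \<lfloor>\<alpha>\<rfloor>"
definition hexp :: real where "hexp = frac_part \<alpha>"

lemma deg_hexp: "real deg + hexp = \<alpha>" "0 \<le> hexp" "hexp \<le> 1"
  using alpha_pos frac_part_bounds[of \<alpha>] by (auto simp: deg_def hexp_def frac_part_def)

lemma expo: "1 < 2 * Re \<beta> + \<alpha>" using Re_beta by (simp add: field_simps)

lemma not_pole': "of_nat n + 2 * \<beta> \<noteq> 1"
  using not_pole[of n] by (auto simp: field_simps)

text \<open>The zeta part sees f only through finitely many derivatives at 0 and is holomorphic for
  Re w > -1; only \<open>lreg\<close> involves f away from 0.\<close>

definition lsing :: "(real \<Rightarrow> complex) \<Rightarrow> complex \<Rightarrow> complex" where
  "lsing f w = (\<Sum>n\<le>deg. vderiv n f 0 / fact n * hurwitz_zeta (of_nat n + 2 * \<beta>) (w + 1))"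

definition lreg :: "(real \<Rightarrow> complex) \<Rightarrow> nat \<Rightarrow> real \<Rightarrow> complex" where
  "lreg f m z = of_real (real (Suc m) + z) powr (- (2 * \<beta>)) *
     (f (1 / (real (Suc m) + z)) - taylor deg f 0 (of_real (1 / (real (Suc m) + z))))"

lemma L_op_eq: "z > -1 \<Longrightarrow> L_op \<alpha> \<beta> f z = lsing f (of_real z) + (\<Sum>m. lreg f m z)"
  by (simp add: L_op_def lsing_def lreg_def taylor_def deg_def Let_def)

lemma L_op_out: "\<not> z > -1 \<Longrightarrow> L_op \<alpha> \<beta> f z = 0"
  by (simp add: L_op_def Let_def)

lemma lsing_holomorphic: "lsing f holomorphic_on {w. Re w > -1}"
proof -
  have "(\<lambda>w. hurwitz_zeta (of_nat n + 2 * \<beta>) (w + 1)) holomorphic_on {w. Re w > -1}" for n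
  proof -
    have "(\<lambda>w. w + 1) ` {w. Re w > -1} \<subseteq> {a. 0 < Re a}" by auto
    from holomorphic_on_compose_gen[OF _ hurwitz_zeta_holomorphic[OF not_pole', of n] this]
    show ?thesis by (simp add: o_def holomorphic_intros)
  qed
  then show ?thesis unfolding lsing_def[abs_def] by (intro holomorphic_intros)
qed

context
  fixes f :: "real \<Rightarrow> complex" and \<epsilon> c B :: real and fl :: bool
  assumes eps: "\<epsilon> > 0" "c > 0" and fB: "C_bound deg hexp B {-\<epsilon><..<c} fl f"
begin

lemma fstar_bound:
  assumes "-\<epsilon> < w" "w < c"
  shows "norm (f w - taylor deg f 0 (of_real w)) \<le> 2 ^ Suc deg * B * \<bar>w\<bar> powr \<alpha>"
  using taylor_remainder_bound[OF _ _ deg_hexp(2,3) _ _ fB, of 0 w] assms eps deg_hexp(1) by simp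

text \<open>All points 1 / (m + 1 + z) lie in (0, 1 / (1 + z)], hence where f is controlled. The
  remainder contributes their power \<alpha>, which raises the exponent of the series from 2 Re
  \<beta> to 2 Re \<beta> + \<alpha> > 1.\<close>

lemma lreg_bound:
  assumes "z > -1" "1 / (1 + z) < c"
  shows "norm (lreg f m z) \<le> 2 ^ Suc deg * B * (real m + (1 + z)) powr (- (2 * Re \<beta> + \<alpha>))"
proof -
  define x where "x = real (Suc m) + z"
  have x: "0 < x" "1 + z \<le> x" using assms by (auto simp: x_def)
  have "1 / x \<le> 1 / (1 + z)" using x assms by (intro divide_left_mono) auto
  then have "1 / x < c" using assms by linarith
  moreover have "-\<epsilon> < 1 / x" using eps x by (smt (verit) zero_less_divide_1_iff)
  ultimately have "norm (f (1 / x) - taylor deg f 0 (of_real (1 / x))) \<le> 2 ^ Suc deg * B * (1 / x) powr \<alpha>"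
    using fstar_bound[of "1 / x"] x by simp
  then have "norm (lreg f m z) \<le> x powr (- (2 * Re \<beta>)) * (2 ^ Suc deg * B * (1 / x) powr \<alpha>)"
    unfolding lreg_def x_def[symmetric] norm_mult using cmod_of_real_powr[OF x(1), of "- (2 * \<beta>)"]
    by (intro mult_mono) auto
  also have "(1 / x) powr \<alpha> = x powr (- \<alpha>)" using x by (simp add: powr_minus_divide powr_divide)
  also have "x powr (- (2 * Re \<beta>)) * (2 ^ Suc deg * B * x powr (- \<alpha>)) = 2 ^ Suc deg * B * (x powr (- (2 * Re \<beta>)) * x powr (- \<alpha>))"
    by (simp add: mult_ac)
  also have "x powr (- (2 * Re \<beta>)) * x powr (- \<alpha>) = x powr (- (2 * Re \<beta> + \<alpha>))" by (simp flip: powr_add)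
  finally show ?thesis by (simp add: x_def add_ac)
qed

lemma lreg_summable:
  assumes "z > -1" "1 / (1 + z) < c"
  shows "summable (\<lambda>m. norm (lreg f m z))"
proof (rule summable_comparison_test'[of "\<lambda>m. 2 ^ Suc deg * B * (real m + (1 + z)) powr (- (2 * Re \<beta> + \<alpha>))" 0])
  show "summable (\<lambda>m. 2 ^ Suc deg * B * (real m + (1 + z)) powr (- (2 * Re \<beta> + \<alpha>)))"
    using assms expo by (intro summable_mult summable_shift_powr) auto
qed (use lreg_bound[OF assms] in auto)

text \<open>With w = 1 / (z + 1), the zeta recursion yields w^(2 \<beta>) times the Taylor
  polynomial of f, and the shift of the series by one index yields w^(2 \<beta>) times the
  remainder; in the sum the regularisation cancels.\<close>

lemma L_op_rec:
  assumes z: "z > -1" "1 / (1 + z) < c"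
  shows "L_op \<alpha> \<beta> f z - L_op \<alpha> \<beta> f (z + 1) = of_real (1 / (z + 1)) powr (2 * \<beta>) * f (1 / (z + 1))"
proof -
  define w where "w = 1 / (z + 1)"
  have w: "0 < w" using z by (simp add: w_def)
  have pw: "of_real (z + 1) powr (- (of_nat n + 2 * \<beta>)) = of_real w powr (2 * \<beta>) * of_real w ^ n" for n
  proof -
    have z1: "0 < z + 1" using z by simp
    have "of_real (z + 1) powr (- (of_nat n + 2 * \<beta>)) = exp ((of_nat n + 2 * \<beta>) * - of_real (ln (z + 1)))"
      using z1 by (simp add: powr_def Ln_of_real algebra_simps del: of_real_add)
    also have "- ln (z + 1) = ln w" using z1 by (simp add: w_def ln_div)
    then have "- complex_of_real (ln (z + 1)) = of_real (ln w)" by (metis of_real_minus)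
    also have "exp ((of_nat n + 2 * \<beta>) * of_real (ln w)) = of_real w powr (of_nat n + 2 * \<beta>)"
      using w by (simp add: powr_def Ln_of_real)
    also have "\<dots> = of_real w powr (2 * \<beta>) * of_real w ^ n"
      using w by (simp add: powr_add powr_nat' mult.commute)
    finally show ?thesis .
  qed
  have "lsing f (of_real z) - lsing f (of_real (z + 1)) = (\<Sum>n\<le>deg. vderiv n f 0 / fact n * (of_real w powr (2 * \<beta>) * of_real w ^ n))"
    unfolding lsing_def sum_subtractf[symmetric] right_diff_distrib[symmetric]
    using hurwitz_zeta_rec[OF _ not_pole', of "of_real (z + 1)"] z pw by simp
  also have "\<dots> = of_real w powr (2 * \<beta>) * taylor deg f 0 (of_real w)"
    by (simp add: taylor_def sum_distrib_left mult_ac)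
  finally have 1: "lsing f (of_real z) - lsing f (of_real (z + 1)) = of_real w powr (2 * \<beta>) * taylor deg f 0 (of_real w)" .
  have s: "summable (\<lambda>m. lreg f m z)" using lreg_summable[OF z] by (rule summable_norm_cancel)
  have "lreg f m (z + 1) = lreg f (Suc m) z" for m by (simp add: lreg_def add_ac)
  then have "(\<Sum>m. lreg f m z) - (\<Sum>m. lreg f m (z + 1)) = lreg f 0 z"
    using suminf_split_head[OF s] by simp
  also have "\<dots> = of_real w powr (2 * \<beta>) * (f w - taylor deg f 0 (of_real w))"
    using pw[of 0] by (simp add: lreg_def w_def add.commute)
  finally have 2: "(\<Sum>m. lreg f m z) - (\<Sum>m. lreg f m (z + 1)) = of_real w powr (2 * \<beta>) * (f w - taylor deg f 0 (of_real w))" .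
  have "L_op \<alpha> \<beta> f z - L_op \<alpha> \<beta> f (z + 1) = (lsing f (of_real z) - lsing f (of_real (z + 1))) + ((\<Sum>m. lreg f m z) - (\<Sum>m. lreg f m (z + 1)))"
    using z by (simp add: L_op_eq)
  then show ?thesis unfolding 1 2 w_def[symmetric] by (simp add: algebra_simps)
qed

text \<open>The condition on a ensures 1 / (1 + z) < c for all z > a. Each branch is factored as
  \<kappa> \<psi>(x) with \<kappa> = 1 / (m + 1) and \<psi>(x) = 1 / (\<kappa> x + 1): the functions
  \<psi> form a bounded family, and the decay in m comes from the scalars \<kappa>^\<alpha> and (m +
  1)^(-2 Re \<beta>).\<close>

lemma L_op_C_bound:
  assumes ab: "1 / c - 1 < a"
  shows "\<exists>B'. C_bound deg hexp B' {a<..<b} False (L_op \<alpha> \<beta> f)"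
proof -
  have a: "-1 < a" using ab eps by (smt (verit) zero_less_divide_1_iff)
  have ac: "1 / (1 + a) < c" using ab a eps by (simp add: field_simps)
  note g = deg_hexp(2,3)
  define m0 where "m0 = min 1 (1 + a)"
  have m0: "0 < m0" using a by (simp add: m0_def)
  \<comment> \<open>R bounds the diameter of the interval and also the values of \<psi>, which are
    at most 1 / m0.\<close>
  define R where "R = 1 + 1 / m0 + \<bar>b - a\<bar>"
  have R1: "1 \<le> R" using m0 by (simp add: R_def)
  let ?I = "{a<..<b}"
  have dR: "\<bar>x - y\<bar> \<le> R" if "x \<in> ?I" "y \<in> ?I" for x y
  proof -
    have "0 < 1 / m0" using m0 by simp
    then show ?thesis using that unfolding R_def by (smt (verit) greaterThanLessThan_iff)
  qed
  obtain C1 where C1: "0 \<le> C1" "\<And>\<kappa>. 0 \<le> \<kappa> \<Longrightarrow> \<kappa> \<le> 1 \<Longrightarrow> C_bound deg hexp C1 ?I False (\<lambda>x. of_real (\<kappa> * x + 1) powr (- (2 * \<beta>)))"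
    using C_bound_affine_powr[OF a g] by blast
  obtain C2 where C2: "0 \<le> C2" "\<And>\<kappa>. 0 \<le> \<kappa> \<Longrightarrow> \<kappa> \<le> 1 \<Longrightarrow> C_bound deg hexp C2 ?I False (\<lambda>x. of_real (\<kappa> * x + 1) powr (- 2))"
    using C_bound_affine_powr[OF a g] by blast
  obtain K where K: "K \<ge> 1" "\<And>\<gamma> I J p \<psi> \<psi>' B z. 0 \<le> \<gamma> \<Longrightarrow> \<gamma> \<le> 1 \<Longrightarrow> convex I \<Longrightarrow> (\<forall>x\<in>I. \<forall>y\<in>I. \<bar>x - y\<bar> \<le> R) \<Longrightarrow>
    C_bound deg \<gamma> B J z p \<Longrightarrow> \<psi> ` I \<subseteq> J \<Longrightarrow> (\<forall>x\<in>I. (\<psi> has_real_derivative \<psi>' x) (at x)) \<Longrightarrow>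
    C_bound deg \<gamma> C2 I False (\<lambda>x. of_real (\<psi>' x)) \<Longrightarrow> (z \<longrightarrow> \<psi> 0 = 0) \<Longrightarrow>
    C_bound deg \<gamma> (K * B) I z (\<lambda>x. p (\<psi> x))"
    using C_bound_compose[OF R1, of deg C2] by blast
  define Cst where "Cst = 2 * (2 * R) ^ deg * C1 * (K * (R ^ Suc deg * B))"
  define bd where "bd m = Cst * real (Suc m) powr (- (2 * Re \<beta> + \<alpha>))" for m
  have "C_bound deg hexp (bd m) ?I False (lreg f m)" for m
  proof -
    define \<kappa> where "\<kappa> = 1 / real (Suc m)"
    have k: "0 < \<kappa>" "0 \<le> \<kappa>" "\<kappa> \<le> 1" "\<kappa> \<noteq> 0" by (auto simp: \<kappa>_def)
    have pos: "m0 \<le> \<kappa> * x + 1" if "x \<in> ?I" for x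
    proof (cases "x \<ge> 0")
      case True then show ?thesis using k by (auto simp: m0_def intro: order_trans[of _ 1])
    next
      case False
      then have "1 * x \<le> \<kappa> * x" using k by (intro mult_right_mono_neg) auto
      then show ?thesis using that by (auto simp: m0_def)
    qed
    let ?J = "{y. 0 + \<kappa> * y \<in> {-\<epsilon><..<c}} \<inter> {-R<..<R}"
    let ?p = "\<lambda>y. f (0 + \<kappa> * y) - taylor deg f 0 (of_real (0 + \<kappa> * y))"
    let ?\<psi> = "\<lambda>x. 1 / (\<kappa> * x + 1)"
    let ?\<psi>' = "\<lambda>x. - \<kappa> / (\<kappa> * x + 1)\<^sup>2"
    have p: "C_bound deg hexp (R ^ Suc deg * B * \<kappa> powr \<alpha>) ?J False ?p"
      using C_bound_mono[OF C_bound_taylor[OF _ _ g R1 _ k(4) fB, of 0]] eps k deg_hexp(1) by simp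
    have \<kappa>x: "\<kappa> * ?\<psi> x = 1 / (real (Suc m) + x)" for x
      by (simp add: \<kappa>_def field_simps)
    have img: "?\<psi> ` ?I \<subseteq> ?J"
    proof clarify
      fix x assume x: "x \<in> ?I"
      have "1 / (real (Suc m) + x) \<le> 1 / (1 + a)" "0 < 1 / (real (Suc m) + x)" using x a by (auto intro!: divide_left_mono mult_pos_pos)
      then have "0 + \<kappa> * ?\<psi> x \<in> {-\<epsilon><..<c}"
        unfolding \<kappa>x greaterThanLessThan_iff using ac eps by linarith
      moreover have "0 < ?\<psi> x" "?\<psi> x \<le> 1 / m0" using pos[OF x] m0 by (auto intro!: divide_left_mono mult_pos_pos)
      then have "?\<psi> x \<in> {-R<..<R}" unfolding greaterThanLessThan_iff using R1 R_def by linarith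
      ultimately show "?\<psi> x \<in> ?J" by blast
    qed
    have der: "\<forall>x\<in>?I. (?\<psi> has_real_derivative ?\<psi>' x) (at x)"
    proof
      fix x assume "x \<in> ?I"
      then have "\<kappa> * x + 1 \<noteq> 0" using pos[of x] m0 by linarith
      then show "(?\<psi> has_real_derivative ?\<psi>' x) (at x)"
        by (auto intro!: derivative_eq_intros simp: power2_eq_square)
    qed
    have psi': "C_bound deg hexp C2 ?I False (\<lambda>x. of_real (?\<psi>' x))"
    proof (rule C_bound_cong[OF _ _ C_bound_mono[OF C_bound_cmult[OF C2(2)[OF k(2,3)], of "- of_real \<kappa>"]]])
      show "cmod (- of_real \<kappa>) * C2 \<le> C2" using k C2(1) by (simp add: mult_left_le_one_le)
      fix x assume "x \<in> ?I"
      then have "0 < \<kappa> * x + 1" using pos[of x] m0 by linarith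
      then have "complex_of_real (\<kappa> * x + 1) powr (- 2) = of_real (1 / (\<kappa> * x + 1)\<^sup>2)"
        using powr_of_real[of "\<kappa> * x + 1" "-2"] by (simp add: powr_minus_divide del: of_real_add of_real_mult)
      then show "- complex_of_real \<kappa> * of_real (\<kappa> * x + 1) powr (- 2) = of_real (?\<psi>' x)" by simp
    qed auto
    have 1: "C_bound deg hexp (K * (R ^ Suc deg * B * \<kappa> powr \<alpha>)) ?I False (\<lambda>x. ?p (?\<psi> x))"
      by (rule K(2)[OF g _ _ p img der psi']) (use dR in auto)
    have 2: "C_bound deg hexp (2 * (2 * R) ^ deg * C1 * (K * (R ^ Suc deg * B * \<kappa> powr \<alpha>))) ?I False
        (\<lambda>x. of_real (\<kappa> * x + 1) powr (- (2 * \<beta>)) * ?p (?\<psi> x))"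
      using C_bound_mult[OF _ dR R1 g C1(2)[OF k(2,3)] 1] by simp
    have 3: "C_bound deg hexp (cmod (of_real (Suc m) powr (- (2 * \<beta>))) * (2 * (2 * R) ^ deg * C1 * (K * (R ^ Suc deg * B * \<kappa> powr \<alpha>)))) ?I False
        (\<lambda>x. of_real (Suc m) powr (- (2 * \<beta>)) * (of_real (\<kappa> * x + 1) powr (- (2 * \<beta>)) * ?p (?\<psi> x)))"
      by (rule C_bound_cmult[OF 2])
    have e1: "cmod (of_real (real (Suc m)) powr (- (2 * \<beta>))) = real (Suc m) powr (- (2 * Re \<beta>))"
      by (subst cmod_of_real_powr) auto
    have e2: "\<kappa> powr \<alpha> = real (Suc m) powr (- \<alpha>)"
      by (simp add: \<kappa>_def powr_minus_divide powr_divide)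
    have e3: "real (Suc m) powr (- (2 * Re \<beta>)) * real (Suc m) powr (- \<alpha>) = real (Suc m) powr (- (2 * Re \<beta> + \<alpha>))"
      by (simp flip: powr_add)
    have "cmod (of_real (real (Suc m)) powr (- (2 * \<beta>))) * (2 * (2 * R) ^ deg * C1 * (K * (R ^ Suc deg * B * \<kappa> powr \<alpha>))) = bd m"
      unfolding bd_def Cst_def e1 e2 e3[symmetric] by (simp only: mult_ac)
    with 3 have 4: "C_bound deg hexp (bd m) ?I False
        (\<lambda>x. of_real (Suc m) powr (- (2 * \<beta>)) * (of_real (\<kappa> * x + 1) powr (- (2 * \<beta>)) * ?p (?\<psi> x)))" by simp
    show ?thesis
    proof (rule C_bound_cong[OF _ _ 4])
      fix x assume x: "x \<in> ?I"
      then have "0 < \<kappa> * x + 1" using pos[of x] m0 by linarith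
      moreover have "real (Suc m) + x = real (Suc m) * (\<kappa> * x + 1)" by (simp add: \<kappa>_def field_simps)
      ultimately have "of_real (real (Suc m) + x) powr (- (2 * \<beta>)) = of_real (Suc m) powr (- (2 * \<beta>)) * of_real (\<kappa> * x + 1) powr (- (2 * \<beta>))"
        using powr_times_real[of "of_real (real (Suc m))" "of_real (\<kappa> * x + 1)" "- (2 * \<beta>)"] by (simp del: of_nat_Suc)
      moreover have "0 + \<kappa> * ?\<psi> x = 1 / (real (Suc m) + x)" using \<kappa>x by simp
      ultimately show "of_real (Suc m) powr (- (2 * \<beta>)) * (of_real (\<kappa> * x + 1) powr (- (2 * \<beta>)) * ?p (?\<psi> x)) = lreg f m x"
        unfolding lreg_def by (simp only: mult.assoc)
    qed auto
  qed
  moreover have "summable bd" unfolding bd_def using expo by (intro summable_mult summable_Suc_powr) auto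
  ultimately have reg: "C_bound deg hexp (suminf bd) ?I False (\<lambda>z. \<Sum>m. lreg f m z)"
    by (intro C_bound_suminf) auto
  have "of_real ` {a..b} \<subseteq> {w. Re w > -1}" using a by auto
  then obtain B1 where "C_bound deg hexp B1 ?I False (\<lambda>z. lsing f (of_real z))"
    using C_bound_holomorphic[OF open_halfspace_Re_gt lsing_holomorphic _ g, of a b deg f] by blast
  from C_bound_add[OF this reg]
  have "C_bound deg hexp (B1 + suminf bd) ?I False (L_op \<alpha> \<beta> f)"
    by (rule C_bound_cong[rotated 2]) (use a in \<open>auto simp: L_op_eq\<close>)
  then show ?thesis by blast
qed

end

text \<open>Locality: the value at z involves f only near 0 and on (0, 1 / (1 + z)]. It lets an
  equation solved on a bounded interval be extended to the half-line.\<close>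

lemma L_op_cong:
  assumes "\<epsilon> > 0" "c > 0" "\<And>x. x \<in> {-\<epsilon><..<c} \<Longrightarrow> f x = g x" "z > -1" "1 / (1 + z) < c"
  shows "L_op \<alpha> \<beta> f z = L_op \<alpha> \<beta> g z"
proof -
  have v: "vderiv n f 0 = vderiv n g 0" for n
    by (rule vderiv_cong[of "{-\<epsilon><..<c}"]) (use assms in auto)
  have "f (1 / (real (Suc m) + z)) = g (1 / (real (Suc m) + z))" for m
  proof (rule assms(3))
    have "1 / (real (Suc m) + z) \<le> 1 / (1 + z)" "0 < 1 / (real (Suc m) + z)"
      using assms(4) by (auto intro!: divide_left_mono mult_pos_pos)
    then show "1 / (real (Suc m) + z) \<in> {-\<epsilon><..<c}"
      using assms(1,5) unfolding greaterThanLessThan_iff by linarith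
  qed
  then show ?thesis using assms(4) by (simp add: L_op_eq lsing_def lreg_def taylor_def v)
qed

lemma L_op_lincomb:
  assumes "\<epsilon> > 0" "c > 0" and f: "C_bound deg hexp B {-\<epsilon><..<c} False f" and g: "C_bound deg hexp B' {-\<epsilon><..<c} False g"
    and z: "z > -1" "1 / (1 + z) < c"
  shows "L_op \<alpha> \<beta> (\<lambda>x. f x + a * g x) z = L_op \<alpha> \<beta> f z + a * L_op \<alpha> \<beta> g z"
proof -
  have v: "vderiv n (\<lambda>x. f x + a * g x) 0 = vderiv n f 0 + a * vderiv n g 0" if "n \<le> deg" for n
    by (rule vderiv_lincomb[OF _ f g that]) (use assms in auto)
  have 1: "lsing (\<lambda>x. f x + a * g x) w = lsing f w + a * lsing g w" for w
    unfolding lsing_def by (simp add: v sum.distrib sum_distrib_left add_divide_distrib algebra_simps)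
  have t: "taylor deg (\<lambda>x. f x + a * g x) 0 w = taylor deg f 0 w + a * taylor deg g 0 w" for w
    unfolding taylor_def by (simp add: v sum.distrib sum_distrib_left add_divide_distrib algebra_simps)
  have 2: "lreg (\<lambda>x. f x + a * g x) m z = lreg f m z + a * lreg g m z" for m
    unfolding lreg_def t by (simp only: algebra_simps)
  have s: "summable (\<lambda>m. lreg f m z)" "summable (\<lambda>m. lreg g m z)"
    using lreg_summable[OF assms(1,2) f z] lreg_summable[OF assms(1,2) g z] by (auto intro: summable_norm_cancel)
  show ?thesis using z s by (simp add: L_op_eq 1 2 suminf_add[symmetric] summable_mult suminf_mult algebra_simps)
qed

lemma C_alpha_C_bound:
  assumes "f \<in> C_alpha \<alpha>" "-1 < a"
  obtains B where "C_bound deg hexp B {a<..<b} False f"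
proof (cases "a < b")
  case True
  then show ?thesis using assms that C_alpha_iff[OF alpha_pos, of f] unfolding deg_def hexp_def by blast
next
  case False
  then show ?thesis using that[of 0] by (simp add: C_bound_empty)
qed

lemma C_alphaI:
  assumes "\<And>x. \<not> x > -1 \<Longrightarrow> f x = 0" "\<And>a b. -1 < a \<Longrightarrow> a < b \<Longrightarrow> \<exists>B. C_bound deg hexp B {a<..<b} False f"
  shows "f \<in> C_alpha \<alpha>"
  unfolding C_alpha_iff[OF alpha_pos] using assms unfolding deg_def hexp_def by auto

lemma L_op_C_alpha:
  assumes f: "f \<in> C_alpha \<alpha>" shows "L_op \<alpha> \<beta> f \<in> C_alpha \<alpha>"
proof (rule C_alphaI)
  fix a b :: real assume ab: "-1 < a" "a < b"
  define c where "c = 1 / (1 + a) + 1"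
  have c: "c > 0" "1 / c - 1 < a"
  proof -
    have "0 < 1 / (1 + a)" using ab by simp
    then show "c > 0" unfolding c_def by linarith
    have "1 / c < 1 / (1 / (1 + a))"
      using \<open>0 < 1 / (1 + a)\<close> \<open>c > 0\<close> by (intro divide_strict_left_mono mult_pos_pos) (auto simp: c_def)
    then show "1 / c - 1 < a" by simp
  qed
  obtain B where "C_bound deg hexp B {-(1/2)<..<c} False f" using C_alpha_C_bound[OF f, of "-(1/2)"] by auto
  from L_op_C_bound[OF _ c(1) this c(2)] show "\<exists>B. C_bound deg hexp B {a<..<b} False (L_op \<alpha> \<beta> f)" by auto
qed (use L_op_out in auto)

lemma A_map_C_alpha:
  assumes f: "f \<in> C_alpha \<alpha>" shows "A_map lam \<beta> \<alpha> f \<in> C_alpha \<alpha>"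
proof (rule C_alphaI)
  show "A_map lam \<beta> \<alpha> f x = 0" if "\<not> x > -1" for x
    using f L_op_out[OF that] that by (auto simp: A_map_def C_alpha_def)
  fix a b :: real assume ab: "-1 < a" "a < b"
  obtain B where B: "C_bound deg hexp B {a<..<b} False f" using C_alpha_C_bound[OF f ab(1)] .
  obtain B' where B': "C_bound deg hexp B' {a<..<b} False (L_op \<alpha> \<beta> f)" using C_alpha_C_bound[OF L_op_C_alpha[OF f] ab(1)] .
  show "\<exists>B. C_bound deg hexp B {a<..<b} False (A_map lam \<beta> \<alpha> f)"
    unfolding A_map_def using C_bound_diff[OF B C_bound_cmult[OF B']] by blast
qed

lemma L_op_rec_C_alpha:
  assumes f: "f \<in> C_alpha \<alpha>" and z: "z > -1"
  shows "L_op \<alpha> \<beta> f z - L_op \<alpha> \<beta> f (z + 1) = of_real (1 / (z + 1)) powr (2 * \<beta>) * f (1 / (z + 1))"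
proof -
  define c where "c = 1 / (1 + z) + 1"
  have c: "c > 0" "1 / (1 + z) < c" using z by (auto simp: c_def add_pos_pos)
  obtain B where "C_bound deg hexp B {-(1/2)<..<c} False f" using C_alpha_C_bound[OF f, of "-(1/2)"] by auto
  from L_op_rec[OF _ c(1) this z c(2)] show ?thesis by simp
qed

lemma FE_iff_A_map_periodic:
  assumes f: "f \<in> C_alpha \<alpha>" and lam: "lam \<noteq> 0"
  shows "f \<in> FE lam \<beta> \<alpha> \<longleftrightarrow> A_map lam \<beta> \<alpha> f \<in> C_alpha_per \<alpha>"
proof -
  have "lam * f z - lam * f (z + 1) = of_real (1 / (z + 1)) powr (2 * \<beta>) * f (1 / (z + 1)) \<longleftrightarrow>
     A_map lam \<beta> \<alpha> f (z + 1) = A_map lam \<beta> \<alpha> f z" if z: "z > -1" for z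
    unfolding L_op_rec_C_alpha[OF f z, symmetric] A_map_def using lam
    by (auto simp: field_simps)
  then show ?thesis using f A_map_C_alpha[OF f] by (auto simp: FE_def C_alpha_per_def)
qed

end

section \<open>Operators on the disc algebra\<close>

abbreviation AD :: "(complex \<Rightarrow> complex) set" where "AD \<equiv> A_inf disc_D"
abbreviation snorm :: "(complex \<Rightarrow> complex) \<Rightarrow> real" where "snorm \<equiv> sup_norm disc_D"
abbreviation cD :: "complex set" where "cD \<equiv> closure disc_D"

lemma cD_eq: "cD = cball 1 (3/2)" by (simp add: disc_D_def)

lemma disc_subset_cD: "disc_D \<subseteq> cD" by (rule closure_subset)

text \<open>The real trace of \<open>disc_D\<close>; every inverse branch maps it into (0,
  2).\<close>

abbreviation iv :: "real set" where "iv \<equiv> {-1/2<..<5/2}"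

lemma of_real_in_cD: "x \<in> {-1/2..5/2} \<Longrightarrow> complex_of_real x \<in> cD"
  and iv_in_disc: "x \<in> iv \<Longrightarrow> complex_of_real x \<in> disc_D"
proof -
  have d: "dist 1 (complex_of_real x) = \<bar>1 - x\<bar>" by (metis dist_norm norm_of_real of_real_1 of_real_diff)
  show "x \<in> {-1/2..5/2} \<Longrightarrow> complex_of_real x \<in> cD" using d by (auto simp: cD_eq abs_if)
  show "x \<in> iv \<Longrightarrow> complex_of_real x \<in> disc_D" using d by (auto simp: disc_D_def abs_if)
qed

lemma branch_interval:
  assumes "x \<in> {-1/2..5/2}" shows "1 / (real (Suc m) + x) \<in> {0<..2}"
proof -
  have zz: "0 < real (Suc m) + x" "1/2 \<le> real (Suc m) + x" using assms by auto
  then have "1 / (real (Suc m) + x) \<le> 1 / (1/2)" by (intro divide_left_mono) auto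
  then have "1 / (real (Suc m) + x) \<le> 2" by (simp only: divide_divide_eq_right mult_1)
  then show ?thesis using zz(1) by (simp only: greaterThanAtMost_iff zero_less_divide_1_iff)
qed

lemma AD_le_snorm:
  assumes "f \<in> AD" "z \<in> cD" shows "cmod (f z) \<le> snorm f"
proof -
  have "compact cD" by (simp add: cD_eq)
  then have "compact ((\<lambda>z. cmod (f z)) ` cD)"
    using assms by (intro compact_continuous_image continuous_on_norm) (auto simp: A_inf_def)
  then have "bdd_above ((\<lambda>z. cmod (f z)) ` cD)" by (intro bounded_imp_bdd_above compact_imp_bounded)
  then show ?thesis unfolding sup_norm_def using assms(2) by (rule cSUP_upper[rotated])
qed

lemma snorm_le: "(\<And>z. z \<in> cD \<Longrightarrow> cmod (f z) \<le> B) \<Longrightarrow> snorm f \<le> B"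
  unfolding sup_norm_def by (rule cSUP_least) (auto simp: cD_eq intro!: exI[of _ 1])

lemma snorm_nonneg: "f \<in> AD \<Longrightarrow> 0 \<le> snorm f"
  using order_trans[OF norm_ge_zero AD_le_snorm[of f 1]] by (simp add: cD_eq)

lemma AD_le: "f \<in> AD \<Longrightarrow> snorm f \<le> B \<Longrightarrow> 0 \<le> B \<Longrightarrow> cmod (f z) \<le> B"
  using AD_le_snorm[of f z] by (cases "z \<in> cD") (auto simp: A_inf_def)

lemma AD_lincomb: "f \<in> AD \<Longrightarrow> g \<in> AD \<Longrightarrow> (\<lambda>z. a * f z + b * g z) \<in> AD"
  by (auto simp: A_inf_def intro!: holomorphic_intros continuous_intros)

lemma AD_zero: "(\<lambda>z. 0) \<in> AD"
  by (auto simp: A_inf_def)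

lemma AD_add: "f \<in> AD \<Longrightarrow> g \<in> AD \<Longrightarrow> (\<lambda>z. f z + g z) \<in> AD"
  using AD_lincomb[of f g 1 1] by simp

lemma AD_diff: "f \<in> AD \<Longrightarrow> g \<in> AD \<Longrightarrow> (\<lambda>z. f z - g z) \<in> AD"
  using AD_lincomb[of f g 1 "-1"] by simp

lemma AD_cmult: "f \<in> AD \<Longrightarrow> (\<lambda>z. c * f z) \<in> AD"
  using AD_lincomb[of f f c 0] by simp

lemma AD_sum: "finite J \<Longrightarrow> (\<And>j. j \<in> J \<Longrightarrow> f j \<in> AD) \<Longrightarrow> (\<lambda>z. \<Sum>j\<in>J. c j * f j z) \<in> AD"
proof (induction J rule: finite_induct)
  case (insert x F)
  then show ?case using AD_add[OF AD_cmult[of "f x" "c x"], of "\<lambda>z. \<Sum>j\<in>F. c j * f j z"] by simp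
qed (simp add: AD_zero)

lemma AD_restrict:
  assumes "open U" "cD \<subseteq> U" "h holomorphic_on U"
  shows "(\<lambda>z. if z \<in> cD then h z else 0) \<in> AD"
proof -
  have "h holomorphic_on disc_D" using assms disc_subset_cD by (auto intro: holomorphic_on_subset)
  then have 1: "(\<lambda>z. if z \<in> cD then h z else 0) holomorphic_on disc_D"
    by (rule holomorphic_transform) (use disc_subset_cD in auto)
  have "continuous_on cD h" using assms by (meson holomorphic_on_imp_continuous_on holomorphic_on_subset)
  then have "continuous_on cD (\<lambda>z. if z \<in> cD then h z else 0)" by (simp cong: continuous_on_cong)
  with 1 show ?thesis by (simp add: A_inf_def)
qed

lemma AD_suminf:
  fixes f :: "nat \<Rightarrow> complex \<Rightarrow> complex"
  assumes f: "\<And>n. f n \<in> AD" and b: "\<And>n z. z \<in> cD \<Longrightarrow> cmod (f n z) \<le> b n" "summable b"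
  shows "(\<lambda>z. \<Sum>n. f n z) \<in> AD"
proof -
  have "uniform_limit cD (\<lambda>n x. \<Sum>i<n. f i x) (\<lambda>x. \<Sum>n. f n x) sequentially"
    by (rule Weierstrass_m_test[OF b])
  then have "continuous_on cD (\<lambda>x. \<Sum>n. f n x)"
    by (rule uniform_limit_theorem[rotated]) (use f in \<open>auto simp: A_inf_def intro!: always_eventually continuous_on_sum\<close>)
  moreover have "(\<lambda>z. \<Sum>n. f n z) holomorphic_on disc_D"
  proof (rule holomorphic_on_suminf_local)
    show "f n holomorphic_on disc_D" for n using f by (simp add: A_inf_def)
    show "\<exists>d>0. \<exists>h. summable h \<and> (\<forall>n\<ge>1. \<forall>y\<in>ball x d \<inter> disc_D. cmod (f n y) \<le> h n)" for x
      using b disc_subset_cD by (intro exI[of _ 1] conjI exI[of _ b]) auto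
  qed (simp add: disc_D_def)
  moreover have "(\<Sum>n. f n z) = 0" if "z \<notin> cD" for z using f that by (simp add: A_inf_def)
  ultimately show ?thesis by (simp add: A_inf_def)
qed

lemma AD_eq_zeroI:
  assumes f: "f \<in> AD" and z: "\<And>x. x \<in> iv \<Longrightarrow> f (of_real x) = 0"
  shows "f = (\<lambda>z. 0)"
proof -
  have D: "f w = 0" if "w \<in> disc_D" for w
  proof (rule analytic_continuation[of f disc_D "of_real ` iv" 1])
    show "f holomorphic_on disc_D" using f by (simp add: A_inf_def)
    show "of_real ` iv \<subseteq> disc_D" using iv_in_disc by blast
    have "1 islimpt iv" by (intro islimpt_greaterThanLessThan1 open_imp_islimpt | auto intro!: interior_limit_point)+
    then show "1 islimpt complex_of_real ` iv"
      using islimpt_isCont_image[of "1::real" "iv" complex_of_real]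
      by (auto simp: eventually_at_filter)
  qed (use z that in \<open>auto simp: disc_D_def\<close>)
  have "f w = 0" if "w \<in> cD" for w
    using continuous_constant_on_closure[of disc_D f 0 w] f D that by (auto simp: A_inf_def)
  then show ?thesis using f by (auto simp: A_inf_def fun_eq_iff)
qed

section \<open>Bounded operators with explicit constants, and the Neumann series\<close>

definition op_bound :: "((complex \<Rightarrow> complex) \<Rightarrow> complex \<Rightarrow> complex) \<Rightarrow> real \<Rightarrow> bool" where
  "op_bound T C \<longleftrightarrow> 0 \<le> C \<and> (\<forall>f\<in>AD. T f \<in> AD \<and> snorm (T f) \<le> C * snorm f) \<and>
     (\<forall>f\<in>AD. \<forall>g\<in>AD. \<forall>a b. T (\<lambda>z. a * f z + b * g z) = (\<lambda>z. a * T f z + b * T g z))"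

lemma op_bound_imp_bounded_op: "op_bound T C \<Longrightarrow> bounded_op disc_D T"
proof -
  assume T: "op_bound T C"
  have "T (\<lambda>z. f z + g z) = (\<lambda>z. T f z + T g z)" if "f \<in> AD" "g \<in> AD" for f g
  proof -
    have "T (\<lambda>z. 1 * f z + 1 * g z) = (\<lambda>z. 1 * T f z + 1 * T g z)"
      using T that unfolding op_bound_def by blast
    then show ?thesis by simp
  qed
  moreover have "T (\<lambda>z. c * f z) = (\<lambda>z. c * T f z)" if "f \<in> AD" for f c
  proof -
    have "T (\<lambda>z. c * f z + 0 * f z) = (\<lambda>z. c * T f z + 0 * T f z)"
      using T that unfolding op_bound_def by blast
    then show ?thesis by simp
  qed
  ultimately show ?thesis using T unfolding bounded_op_def op_bound_def by blast
qed

lemma bounded_op_imp_op_bound: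
  assumes "bounded_op disc_D T"
  obtains C where "op_bound T C"
proof -
  obtain C where C: "\<And>f. f \<in> AD \<Longrightarrow> snorm (T f) \<le> C * snorm f" using assms unfolding bounded_op_def by blast
  have "snorm (T f) \<le> max 0 C * snorm f" if "f \<in> AD" for f
    using C[OF that] mult_right_mono[of C "max 0 C" "snorm f"] snorm_nonneg[OF that] by linarith
  moreover have "T (\<lambda>z. a * f z + b * g z) = (\<lambda>z. a * T f z + b * T g z)" if "f \<in> AD" "g \<in> AD" for f g a b
  proof -
    have "T (\<lambda>z. a * f z + b * g z) = (\<lambda>z. T (\<lambda>z. a * f z) z + T (\<lambda>z. b * g z) z)"
      using assms AD_cmult[OF that(1), of a] AD_cmult[OF that(2), of b] unfolding bounded_op_def
      by (elim conjE) (drule bspec, assumption, drule bspec, assumption, assumption)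
    then show ?thesis using assms that unfolding bounded_op_def by auto
  qed
  ultimately have "op_bound T (max 0 C)" using assms unfolding op_bound_def bounded_op_def by auto
  then show ?thesis using that by blast
qed

context
  fixes T C assumes T: "op_bound T C"
begin

lemma op_in: "f \<in> AD \<Longrightarrow> T f \<in> AD" using T by (simp add: op_bound_def)

lemma op_le: "f \<in> AD \<Longrightarrow> snorm (T f) \<le> C * snorm f" using T by (simp add: op_bound_def)

lemma op_const_nonneg: "0 \<le> C" using T by (simp add: op_bound_def)

lemma op_lincomb: "f \<in> AD \<Longrightarrow> g \<in> AD \<Longrightarrow> T (\<lambda>z. a * f z + b * g z) = (\<lambda>z. a * T f z + b * T g z)"
  using T by (simp add: op_bound_def)

lemma op_diff: "f \<in> AD \<Longrightarrow> g \<in> AD \<Longrightarrow> T (\<lambda>z. f z - g z) = (\<lambda>z. T f z - T g z)"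
  using op_lincomb[of f g 1 "-1"] by simp

lemma op_add: "f \<in> AD \<Longrightarrow> g \<in> AD \<Longrightarrow> T (\<lambda>z. f z + g z) = (\<lambda>z. T f z + T g z)"
  using op_lincomb[of f g 1 1] by simp

lemma op_cmult: "f \<in> AD \<Longrightarrow> T (\<lambda>z. c * f z) = (\<lambda>z. c * T f z)"
  using op_lincomb[of f f c 0] by simp

lemma op_zero: "T (\<lambda>z. 0) = (\<lambda>z. 0)"
  using op_cmult[OF AD_zero, of 0] by simp

lemma op_sum:
  assumes "finite J" "\<And>j. j \<in> J \<Longrightarrow> f j \<in> AD"
  shows "T (\<lambda>z. \<Sum>j\<in>J. c j * f j z) = (\<lambda>z. \<Sum>j\<in>J. c j * T (f j) z)"
  using assms
proof (induction J rule: finite_induct)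
  case (insert x F)
  then show ?case using op_add[OF AD_cmult[of "f x" "c x"] AD_sum[of F f c]] op_cmult[of "f x" "c x"] by simp
qed (simp add: op_zero)

lemma op_pow_in: "f \<in> AD \<Longrightarrow> (T ^^ n) f \<in> AD"
  by (induction n) (auto intro: op_in)

lemma op_pow_le: "f \<in> AD \<Longrightarrow> snorm ((T ^^ n) f) \<le> C ^ n * snorm f"
proof (induction n)
  case (Suc n)
  have "snorm (T ((T ^^ n) f)) \<le> C * snorm ((T ^^ n) f)" using op_le op_pow_in Suc by blast
  also have "\<dots> \<le> C * (C ^ n * snorm f)" using Suc op_const_nonneg by (intro mult_left_mono) auto
  finally show ?case by (simp add: mult_ac)
qed simp

lemma op_fixpoint_zero:
  assumes "C < 1" "f \<in> AD" "T f = f" shows "f = (\<lambda>z. 0)"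
proof -
  have "snorm f \<le> C * snorm f" using op_le[OF assms(2)] assms(3) by simp
  then have "(1 - C) * snorm f \<le> 0" by (simp add: algebra_simps)
  then have "snorm f \<le> 0" using assms(1) by (simp add: mult_le_0_iff)
  then have "cmod (f z) \<le> 0" for z using AD_le[OF assms(2), of 0] by simp
  then show ?thesis by auto
qed

text \<open>The series is summed pointwise, its limit is placed in the disc algebra by the
  Weierstrass test, and linearity follows from uniqueness for f - T f = g. The pointwise series is
  kept in the conclusion because positivity of N is read off from it.\<close>

lemma neumann:
  assumes C1: "C < 1"
  obtains N where "op_bound N (1 / (1 - C))"
    "\<And>f. f \<in> AD \<Longrightarrow> (\<lambda>z. N f z - T (N f) z) = f" "\<And>f. f \<in> AD \<Longrightarrow> N (\<lambda>z. f z - T f z) = f"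
    "\<And>f z. f \<in> AD \<Longrightarrow> (\<lambda>n. (T ^^ n) f z) sums N f z"
proof -
  define N where "N f z = (\<Sum>n. (T ^^ n) f z)" for f z
  have C0: "0 \<le> C" by (rule op_const_nonneg)
  have bd: "cmod ((T ^^ n) f z) \<le> C ^ n * snorm f" if "f \<in> AD" for n f z
    using AD_le[OF op_pow_in[OF that] op_pow_le[OF that]] C0 snorm_nonneg[OF that] by simp
  have sg: "summable (\<lambda>n. C ^ n * snorm f)" for f using C0 C1 by (intro summable_mult2 summable_geometric) auto
  have sm: "summable (\<lambda>n. (T ^^ n) f z)" if "f \<in> AD" for f z
    by (rule summable_comparison_test'[OF sg, of 0]) (use bd[OF that] in auto)
  have NA: "N f \<in> AD" if "f \<in> AD" for f
    unfolding N_def[abs_def] by (rule AD_suminf[OF op_pow_in[OF that] bd[OF that] sg])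
  have tot: "(\<Sum>n. C ^ n * snorm f) = 1 / (1 - C) * snorm f" for f
    using suminf_mult2[of "\<lambda>n. C ^ n" "snorm f"] suminf_geometric[of C] summable_geometric[of C] C0 C1 by simp
  have Nle: "snorm (N f) \<le> 1 / (1 - C) * snorm f" if "f \<in> AD" for f
    unfolding N_def tot[symmetric] by (rule snorm_le, rule norm_suminf_le[OF bd[OF that] sg])
  have fix1: "(\<lambda>z. N f z - T (N f) z) = f" if f: "f \<in> AD" for f
  proof
    fix z
    define s where "s m z = (\<Sum>n<m. (T ^^ n) f z)" for m z
    have sA: "s m \<in> AD" for m
      using AD_sum[of "{..<m}" "\<lambda>n. (T ^^ n) f" "\<lambda>_. 1"] op_pow_in[OF f] by (simp add: s_def[abs_def])
    have Ts: "T (s m) = (\<lambda>z. s (Suc m) z - f z)" for m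
    proof -
      have "T (s m) = (\<lambda>z. \<Sum>n<m. T ((T ^^ n) f) z)"
        using op_sum[of "{..<m}" "\<lambda>n. (T ^^ n) f" "\<lambda>_. 1"] op_pow_in[OF f] by (simp add: s_def[abs_def])
      then show ?thesis unfolding s_def by (simp only: sum.lessThan_Suc_shift) (simp add: fun_eq_iff)
    qed
    have close: "snorm (\<lambda>z. N f z - s m z) \<le> C ^ m * (1 / (1 - C) * snorm f)" for m
    proof (rule snorm_le)
      fix z
      have "N f z - s m z = (\<Sum>n. (T ^^ (n + m)) f z)"
        unfolding N_def s_def using suminf_minus_initial_segment[OF sm[OF f, of z], of m] by simp
      also have "cmod \<dots> \<le> (\<Sum>n. C ^ m * (C ^ n * snorm f))"
      proof (rule norm_suminf_le)
        show "cmod ((T ^^ (n + m)) f z) \<le> C ^ m * (C ^ n * snorm f)" for n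
          using bd[OF f, of "n + m" z] by (simp add: power_add mult_ac)
      qed (rule summable_mult[OF sg])
      also have "\<dots> = C ^ m * (1 / (1 - C) * snorm f)" using suminf_mult[OF sg, of "C ^ m" f] tot by simp
      finally show "cmod (N f z - s m z) \<le> C ^ m * (1 / (1 - C) * snorm f)" .
    qed
    \<comment> \<open>T is only known to commute with finite sums, so T (N f) is compared with T of
      a partial sum; the error is T of a tail, which is small in norm.\<close>
    have est: "cmod (T (N f) z - (s (Suc m) z - f z)) \<le> C * (C ^ m * (1 / (1 - C) * snorm f))" for m
    proof -
      have A: "(\<lambda>z. N f z - s m z) \<in> AD" by (rule AD_diff[OF NA[OF f] sA])
      have "snorm (T (\<lambda>z. N f z - s m z)) \<le> C * (C ^ m * (1 / (1 - C) * snorm f))"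
        by (rule order_trans[OF op_le[OF A]]) (rule mult_left_mono[OF close C0])
      moreover have "0 \<le> C * (C ^ m * (1 / (1 - C) * snorm f))"
        using C0 C1 snorm_nonneg[OF f] by (intro mult_nonneg_nonneg) auto
      ultimately have "cmod (T (\<lambda>z. N f z - s m z) z) \<le> C * (C ^ m * (1 / (1 - C) * snorm f))"
        using AD_le[OF op_in[OF A]] by blast
      then show ?thesis using op_diff[OF NA[OF f] sA] Ts by simp
    qed
    have lim0: "(\<lambda>m. C * (C ^ m * (1 / (1 - C) * snorm f))) \<longlonglongrightarrow> C * (0 * (1 / (1 - C) * snorm f))"
      by (rule tendsto_mult[OF tendsto_const tendsto_mult[OF LIMSEQ_power_zero tendsto_const]]) (use C0 C1 in simp)
    have l1: "(\<lambda>m. T (N f) z - (s (Suc m) z - f z)) \<longlonglongrightarrow> 0"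
      by (rule Lim_null_comparison[OF always_eventually[OF allI[OF est]]]) (use lim0 in simp)
    have "(\<lambda>m. s (Suc m) z) \<longlonglongrightarrow> N f z"
      unfolding s_def N_def using summable_LIMSEQ[OF sm[OF f, of z]] by (rule LIMSEQ_Suc)
    then have l2: "(\<lambda>m. T (N f) z - (s (Suc m) z - f z)) \<longlonglongrightarrow> T (N f) z - (N f z - f z)"
      by (intro tendsto_diff tendsto_const)
    have "T (N f) z - (N f z - f z) = 0" using LIMSEQ_unique[OF l2 l1] .
    then show "N f z - T (N f) z = f z" by (simp add: algebra_simps)
  qed
  have uniq: "f = g" if fg: "f \<in> AD" "g \<in> AD" "(\<lambda>z. f z - T f z) = (\<lambda>z. g z - T g z)" for f g
  proof -
    have "f z - T f z = g z - T g z" for z using that(3) by (rule fun_cong)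
    then have "T f z - T g z = f z - g z" for z by (simp add: algebra_simps)
    then have "T (\<lambda>z. f z - g z) = (\<lambda>z. f z - g z)" using op_diff[OF fg(1,2)] by auto
    then have "(\<lambda>z. f z - g z) = (\<lambda>z. 0)" using op_fixpoint_zero[OF C1 AD_diff[OF fg(1,2)]] by blast
    then have "f z - g z = 0" for z by (rule fun_cong)
    then show ?thesis by auto
  qed
  have fix2: "N (\<lambda>z. f z - T f z) = f" if f: "f \<in> AD" for f
    using uniq[OF NA f fix1] AD_diff[OF f op_in[OF f]] by blast
  have lin: "N (\<lambda>z. a * f z + b * g z) = (\<lambda>z. a * N f z + b * N g z)" if fg: "f \<in> AD" "g \<in> AD" for f g a b
  proof (rule uniq[OF NA AD_lincomb])
    have f': "N f z - T (N f) z = f z" and g': "N g z - T (N g) z = g z" for z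
      using fun_cong[OF fix1[OF fg(1)]] fun_cong[OF fix1[OF fg(2)]] by auto
    have "a * N f z + b * N g z - (a * T (N f) z + b * T (N g) z) = a * (N f z - T (N f) z) + b * (N g z - T (N g) z)" for z
      by (simp add: algebra_simps)
    then show "(\<lambda>z. N (\<lambda>z. a * f z + b * g z) z - T (N (\<lambda>z. a * f z + b * g z)) z) =
       (\<lambda>z. a * N f z + b * N g z - T (\<lambda>z. a * N f z + b * N g z) z)"
      unfolding fix1[OF AD_lincomb[OF fg]] op_lincomb[OF NA[OF fg(1)] NA[OF fg(2)]] f' g' by auto
  qed (use fg NA AD_lincomb in auto)
  have "op_bound N (1 / (1 - C))" unfolding op_bound_def using NA Nle lin C1 by auto
  moreover have "(\<lambda>n. (T ^^ n) f z) sums N f z" if "f \<in> AD" for f z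
    unfolding N_def using sm[OF that] by (rule summable_sums)
  ultimately show ?thesis using that fix1 fix2 by blast
qed

end

definition is_resolvent where
  "is_resolvent T \<mu> S \<longleftrightarrow> bounded_op disc_D S \<and>
     (\<forall>f\<in>AD. S (\<lambda>z. \<mu> * f z - T f z) = f \<and> (\<lambda>z. \<mu> * S f z - T (S f) z) = f)"

lemma op_spectrum_iff: "\<mu> \<in> op_spectrum disc_D T \<longleftrightarrow> \<not> (\<exists>S. is_resolvent T \<mu> S)"
  by (simp add: op_spectrum_def is_resolvent_def)

section \<open>Positivity on the real trace of the disc, and positive resolvents\<close>

definition pos_fun :: "(complex \<Rightarrow> complex) \<Rightarrow> bool" where
  "pos_fun f \<longleftrightarrow> (\<forall>x\<in>{-1/2..5/2}. f (of_real x) \<in> \<real>\<^sub>\<ge>\<^sub>0)"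

definition pos_op :: "((complex \<Rightarrow> complex) \<Rightarrow> complex \<Rightarrow> complex) \<Rightarrow> bool" where
  "pos_op T \<longleftrightarrow> (\<forall>f\<in>AD. pos_fun f \<longrightarrow> pos_fun (T f))"

lemma nonneg_Reals_sums:
  assumes "\<And>n. f n \<in> \<real>\<^sub>\<ge>\<^sub>0" "f sums (s::complex)" shows "s \<in> \<real>\<^sub>\<ge>\<^sub>0"
proof -
  have f: "Re (f n) \<ge> 0" "Im (f n) = 0" for n using assms(1)[of n] by (auto simp: complex_nonneg_Reals_iff)
  have "(\<lambda>n. Re (f n)) sums Re s" "(\<lambda>n. Im (f n)) sums Im s" using assms(2) by (auto simp: sums_complex_iff)
  then have "0 \<le> Re s" "Im s = 0" using f sums_le[of "\<lambda>_. 0" "\<lambda>n. Re (f n)" 0 "Re s"] by (auto simp: sums_unique2)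
  then show ?thesis by (simp add: complex_nonneg_Reals_iff)
qed

lemma neumann_pos:
  assumes T: "op_bound T C" and P: "pos_op T" and N: "\<And>f z. f \<in> AD \<Longrightarrow> (\<lambda>n. (T ^^ n) f z) sums N f z"
  shows "pos_op N"
  unfolding pos_op_def
proof (intro ballI impI)
  fix f assume f: "f \<in> AD" "pos_fun f"
  have "pos_fun ((T ^^ n) f)" for n
    by (induction n) (use f P op_pow_in[OF T f(1)] in \<open>auto simp: pos_op_def\<close>)
  then show "pos_fun (N f)" unfolding pos_fun_def using nonneg_Reals_sums[OF _ N[OF f(1)]] by blast
qed

lemma op_bound_scale:
  assumes T: "op_bound T C" shows "op_bound (\<lambda>f z. c * T f z) (cmod c * C)"
proof -
  have "snorm (\<lambda>z. c * T f z) \<le> cmod c * C * snorm f" if f: "f \<in> AD" for f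
  proof (rule snorm_le)
    fix z assume "z \<in> cD"
    then have "cmod (T f z) \<le> C * snorm f" using AD_le_snorm[OF op_in[OF T f]] op_le[OF T f] by force
    then have "cmod c * cmod (T f z) \<le> cmod c * (C * snorm f)" by (intro mult_left_mono) auto
    then show "cmod (c * T f z) \<le> cmod c * C * snorm f" by (simp add: norm_mult mult_ac)
  qed
  then show ?thesis unfolding op_bound_def
    using op_in[OF T] op_lincomb[OF T] op_const_nonneg[OF T] AD_cmult by (auto simp: algebra_simps)
qed

lemma pos_op_scale: "pos_op T \<Longrightarrow> c \<in> \<real>\<^sub>\<ge>\<^sub>0 \<Longrightarrow> pos_op (\<lambda>f z. c * T f z)"
  by (auto simp: pos_op_def pos_fun_def intro: nonneg_Reals_mult_I)

lemma op_bound_compose: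
  assumes "op_bound T C" "op_bound S C'" shows "op_bound (\<lambda>f. T (S f)) (C * C')"
proof -
  have "snorm (T (S f)) \<le> C * C' * snorm f" if "f \<in> AD" for f
    using order_trans[OF op_le[OF assms(1) op_in[OF assms(2) that]] mult_left_mono[OF op_le[OF assms(2) that] op_const_nonneg[OF assms(1)]]]
    by (simp add: mult_ac)
  then show ?thesis unfolding op_bound_def
    using op_in[OF assms(1)] op_in[OF assms(2)] op_lincomb[OF assms(1)] op_lincomb[OF assms(2)] op_const_nonneg[OF assms(1)] op_const_nonneg[OF assms(2)]
    by auto
qed

lemma resolvent_large:
  assumes T: "op_bound T C" and mu: "C < cmod \<mu>"
  obtains S where "is_resolvent T \<mu> S" "op_bound S (1 / (cmod \<mu> - C))" "pos_op T \<Longrightarrow> \<mu> \<in> \<real>\<^sub>\<ge>\<^sub>0 \<Longrightarrow> pos_op S"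
proof -
  have C0: "0 \<le> C" by (rule op_const_nonneg[OF T])
  then have m0: "\<mu> \<noteq> 0" "cmod \<mu> > 0" using mu by auto
  let ?B = "\<lambda>f z. inverse \<mu> * T f z"
  have B: "op_bound ?B (cmod (inverse \<mu>) * C)" by (rule op_bound_scale[OF T])
  have ci: "cmod (inverse \<mu>) = 1 / cmod \<mu>" by (simp add: norm_inverse divide_inverse)
  have B1: "cmod (inverse \<mu>) * C < 1" unfolding ci using mu m0 by (simp add: field_simps)
  obtain N where N: "op_bound N (1 / (1 - cmod (inverse \<mu>) * C))"
    "\<And>f. f \<in> AD \<Longrightarrow> (\<lambda>z. N f z - ?B (N f) z) = f" "\<And>f. f \<in> AD \<Longrightarrow> N (\<lambda>z. f z - ?B f z) = f"
    "\<And>f z. f \<in> AD \<Longrightarrow> (\<lambda>n. (?B ^^ n) f z) sums N f z"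
    using neumann[OF B B1] by blast
  let ?S = "\<lambda>f z. inverse \<mu> * N f z"
  have S: "op_bound ?S (cmod (inverse \<mu>) * (1 / (1 - cmod (inverse \<mu>) * C)))" by (rule op_bound_scale[OF N(1)])
  have "cmod (inverse \<mu>) * (1 / (1 - cmod (inverse \<mu>) * C)) = 1 / (cmod \<mu> - C)"
    unfolding ci using m0 mu by (simp add: field_simps)
  with S have S': "op_bound ?S (1 / (cmod \<mu> - C))" by simp
  have "is_resolvent T \<mu> ?S" unfolding is_resolvent_def
  proof (intro conjI ballI)
    show "bounded_op disc_D ?S" using op_bound_imp_bounded_op[OF S] .
    fix f assume f: "f \<in> AD"
    have A: "(\<lambda>z. f z - ?B f z) \<in> AD" by (rule AD_diff[OF f op_in[OF B f]])
    have "(\<lambda>z. \<mu> * f z - T f z) = (\<lambda>z. \<mu> * (f z - ?B f z))" using m0 by (simp add: fun_eq_iff field_simps)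
    then show "?S (\<lambda>z. \<mu> * f z - T f z) = f" using op_cmult[OF N(1) A, of \<mu>] N(3)[OF f] m0 by (simp add: fun_eq_iff)
    have "T (?S f) = (\<lambda>z. inverse \<mu> * T (N f) z)" by (rule op_cmult[OF T op_in[OF N(1) f]])
    then show "(\<lambda>z. \<mu> * ?S f z - T (?S f) z) = f" using fun_cong[OF N(2)[OF f]] m0 by (simp add: fun_eq_iff mult.assoc[symmetric])
  qed
  moreover have "pos_op ?S" if "pos_op T" "\<mu> \<in> \<real>\<^sub>\<ge>\<^sub>0"
  proof -
    have "inverse \<mu> \<in> \<real>\<^sub>\<ge>\<^sub>0" using that by (simp add: nonneg_Reals_inverse_I)
    then show ?thesis using pos_op_scale neumann_pos[OF B pos_op_scale[OF that(1)] N(4)] by blast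
  qed
  ultimately show ?thesis using that S' by blast
qed

text \<open>The resolvent at \<mu> + \<delta> is (1 + \<delta> S)^(-1) S, a power series in -
  \<delta> S. For \<delta> <= 0 its coefficients are nonnegative, so lowering the spectral parameter
  keeps positivity.\<close>

lemma resolvent_perturb:
  assumes T: "op_bound T CT" and S: "is_resolvent T \<mu> S" "op_bound S C" and d: "cmod \<delta> * C < 1"
  obtains S' where "is_resolvent T (\<mu> + \<delta>) S'" "op_bound S' (C / (1 - cmod \<delta> * C))"
    "pos_op S \<Longrightarrow> - \<delta> \<in> \<real>\<^sub>\<ge>\<^sub>0 \<Longrightarrow> pos_op S'"
proof -
  let ?B = "\<lambda>f z. (- \<delta>) * S f z"
  have B: "op_bound ?B (cmod (- \<delta>) * C)" by (rule op_bound_scale[OF S(2)])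
  have B1: "cmod (- \<delta>) * C < 1" using d by simp
  obtain N where N: "op_bound N (1 / (1 - cmod (- \<delta>) * C))"
    "\<And>f. f \<in> AD \<Longrightarrow> (\<lambda>z. N f z - ?B (N f) z) = f" "\<And>f. f \<in> AD \<Longrightarrow> N (\<lambda>z. f z - ?B f z) = f"
    "\<And>f z. f \<in> AD \<Longrightarrow> (\<lambda>n. (?B ^^ n) f z) sums N f z"
    using neumann[OF B B1] by blast
  let ?S = "\<lambda>f. N (S f)"
  have Sb: "op_bound ?S (C / (1 - cmod \<delta> * C))" using op_bound_compose[OF N(1) S(2)] by simp
  have SI: "S (\<lambda>z. \<mu> * f z - T f z) = f" "(\<lambda>z. \<mu> * S f z - T (S f) z) = f" if "f \<in> AD" for f
    using S(1) that by (auto simp: is_resolvent_def)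
  have "is_resolvent T (\<mu> + \<delta>) ?S" unfolding is_resolvent_def
  proof (intro conjI ballI)
    show "bounded_op disc_D ?S" using op_bound_imp_bounded_op[OF Sb] .
    fix f assume f: "f \<in> AD"
    note Sf = op_in[OF S(2) f] and Tf = op_in[OF T f]
    have A: "(\<lambda>z. \<mu> * f z - T f z) \<in> AD" using AD_diff[OF AD_cmult[OF f] Tf] .
    have "S (\<lambda>z. (\<mu> + \<delta>) * f z - T f z) = S (\<lambda>z. 1 * (\<mu> * f z - T f z) + \<delta> * f z)"
      by (rule arg_cong[of _ _ S]) (simp add: fun_eq_iff algebra_simps)
    also have "\<dots> = (\<lambda>z. f z - ?B f z)" using op_lincomb[OF S(2) A f, of 1 \<delta>] SI(1)[OF f] by simp
    finally show "?S (\<lambda>z. (\<mu> + \<delta>) * f z - T f z) = f" using N(3)[OF f] by simp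
    define h where "h = N (S f)"
    have h: "h \<in> AD" unfolding h_def using op_in[OF N(1) Sf] .
    have hS: "(\<lambda>z. 1 * h z + \<delta> * S h z) = S f" using N(2)[OF Sf] unfolding h_def by simp
    have "T (S f) = (\<lambda>z. T h z + \<delta> * T (S h) z)"
      using op_lincomb[OF T h op_in[OF S(2) h], of 1 \<delta>] unfolding hS by simp
    then have e1: "T (S f) z = T h z + \<delta> * T (S h) z" for z by simp
    have e2: "S f z = h z + \<delta> * S h z" for z using fun_cong[OF hS, of z] by simp
    have e3: "\<mu> * S f z - T (S f) z = f z" "\<mu> * S h z - T (S h) z = h z" for z
      using fun_cong[OF SI(2)[OF f]] fun_cong[OF SI(2)[OF h]] by auto
    have "f z = \<mu> * h z - T h z + \<delta> * (\<mu> * S h z - T (S h) z)" for z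
      unfolding e3(1)[symmetric] e1 e2 by (simp add: algebra_simps)
    then have "f z = \<mu> * h z - T h z + \<delta> * h z" for z unfolding e3(2) .
    then show "(\<lambda>z. (\<mu> + \<delta>) * ?S f z - T (?S f) z) = f" unfolding h_def[symmetric] by (auto simp: algebra_simps)
  qed
  moreover have "pos_op ?S" if "pos_op S" "- \<delta> \<in> \<real>\<^sub>\<ge>\<^sub>0"
  proof -
    have "pos_op N" using neumann_pos[OF B pos_op_scale[OF that] N(4)] .
    then show ?thesis using that(1) op_in[OF S(2)] unfolding pos_op_def by blast
  qed
  ultimately show ?thesis using that Sb by blast
qed

lemma resolvent_unique:
  assumes "is_resolvent T \<mu> S" "is_resolvent T \<mu> S'" "f \<in> AD" shows "S f = S' f"
proof -
  have "S' f \<in> AD" using assms by (auto simp: is_resolvent_def bounded_op_def)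
  then have "S (\<lambda>z. \<mu> * S' f z - T (S' f) z) = S' f" using assms(1) by (auto simp: is_resolvent_def)
  moreover have "(\<lambda>z. \<mu> * S' f z - T (S' f) z) = f" using assms by (auto simp: is_resolvent_def)
  ultimately show ?thesis by simp
qed

lemma op_bound_cong:
  assumes "op_bound S C" "\<And>f. f \<in> AD \<Longrightarrow> S f = S' f" shows "op_bound S' C"
  using assms AD_lincomb unfolding op_bound_def by auto

text \<open>A positive resolvent at \<open>\<mu>\<close> is a power series with nonnegative coefficients in \<open>\<mu> - \<nu>\<close>
  just below \<open>\<mu>\<close>; so positivity propagates down along the real resolvent set.\<close>

lemma positive_resolvent:
  assumes T: "op_bound T CT" "pos_op T" and L: "0 < L" and res: "\<And>\<mu>. L \<le> \<mu> \<Longrightarrow> \<exists>S. is_resolvent T (of_real \<mu>) S"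
  obtains S where "is_resolvent T (of_real L) S" "pos_op S"
proof -
  define P where "P = {\<mu>. L \<le> \<mu> \<and> (\<exists>S. is_resolvent T (of_real \<mu>) S \<and> pos_op S)}"
  have CT: "0 \<le> CT" by (rule op_const_nonneg[OF T(1)])
  have "max L (CT + 1) \<in> P"
  proof -
    have "CT < cmod (of_real (max L (CT + 1)))" using CT by auto
    then obtain S where S: "is_resolvent T (of_real (max L (CT + 1))) S"
        "pos_op T \<Longrightarrow> complex_of_real (max L (CT + 1)) \<in> \<real>\<^sub>\<ge>\<^sub>0 \<Longrightarrow> pos_op S"
      using resolvent_large[OF T(1)] by metis
    have "complex_of_real (max L (CT + 1)) \<in> \<real>\<^sub>\<ge>\<^sub>0" using L by (subst nonneg_Reals_of_real_iff) auto
    then show ?thesis using S T(2) unfolding P_def mem_Collect_eq by (intro conjI exI[of _ S]) auto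
  qed
  then have ne: "P \<noteq> {}" by blast
  have bb: "bdd_below P" by (rule bdd_belowI[of _ L]) (simp add: P_def)
  define m where "m = Inf P"
  have Lm: "L \<le> m" unfolding m_def by (rule cInf_greatest[OF ne]) (simp add: P_def)
  obtain S0 where S0: "is_resolvent T (of_real m) S0" using res[OF Lm] by blast
  then obtain C' where C': "op_bound S0 C'" using bounded_op_imp_op_bound unfolding is_resolvent_def by blast
  define C where "C = C' + 1"
  have C1: "op_bound S0 C"
  proof -
    have "snorm (S0 f) \<le> C * snorm f" if "f \<in> AD" for f
      using op_le[OF C' that] mult_right_mono[of C' C "snorm f"] snorm_nonneg[OF that] by (auto simp: C_def)
    then show ?thesis using C' unfolding op_bound_def C_def by auto
  qed
  have C: "C > 0" using op_const_nonneg[OF C'] by (simp add: C_def)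
  have "m < m + 1 / (4 * C)" using C by simp
  then obtain m1 where m1: "m1 \<in> P" "m1 < m + 1 / (4 * C)" using cInf_lessD[OF ne] unfolding m_def by blast
  have mm1: "m \<le> m1" unfolding m_def by (rule cInf_lower[OF m1(1) bb])
  define e where "e = m1 - m"
  have e: "0 \<le> e" "e * C < 1 / 4" using m1 mm1 C by (auto simp: e_def field_simps)
  have "cmod (of_real e) * C < 1" using e by simp
  \<comment> \<open>The resolvent \<open>S0\<close> at the infimum exists but is not yet known to be
    positive. It serves to bound the norm of the positive resolvent at the nearby point m1, by
    uniqueness of resolvents.\<close>
  from resolvent_perturb[OF T(1) S0 C1 this] obtain S1' where
    S1': "is_resolvent T (of_real m + of_real e) S1'" "op_bound S1' (C / (1 - cmod (of_real e) * C))" by blast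
  have me: "complex_of_real m + of_real e = of_real m1" by (simp add: e_def)
  obtain S1 where S1: "is_resolvent T (of_real m1) S1" "pos_op S1" using m1(1) unfolding P_def by blast
  have S1b: "op_bound S1 (C / (1 - e * C))"
    using op_bound_cong[OF S1'(2)] resolvent_unique[OF S1'(1)[unfolded me] S1(1)] e by simp
  \<comment> \<open>The norm at m1 is at most 4C/3 and m1 - \<tau> < 1 / (2C), so the perturbation
    reaches \<tau>. Once \<tau> belongs to P it cannot lie below the infimum m, which forces \<tau>
    = L.\<close>
  define \<tau> where "\<tau> = max L (m - 1 / (4 * C))"
  have tau: "\<tau> \<le> m1" "m1 - \<tau> < 1 / (2 * C)"
  proof -
    have h: "1 / (2 * C) = 2 * (1 / (4 * C))" "0 < 1 / (4 * C)" using C by auto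
    show "\<tau> \<le> m1" unfolding \<tau>_def using mm1 Lm h(2) by linarith
    have "m - 1 / (4 * C) \<le> \<tau>" by (simp add: \<tau>_def)
    then show "m1 - \<tau> < 1 / (2 * C)" unfolding h(1) using m1(2) by linarith
  qed
  have "C / (1 - e * C) \<le> C / (3/4)" using e C by (intro divide_left_mono) auto
  then have "(m1 - \<tau>) * (C / (1 - e * C)) \<le> (m1 - \<tau>) * (C / (3/4))" using tau by (intro mult_left_mono) auto
  also have "\<dots> \<le> 1 / (2 * C) * (C / (3/4))" using tau C by (intro mult_right_mono) auto
  also have "\<dots> < 1" using C by simp
  finally have "cmod (of_real (\<tau> - m1)) * (C / (1 - e * C)) < 1" using tau unfolding norm_of_real by simp
  from resolvent_perturb[OF T(1) S1(1) S1b this] obtain S2 where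
    S2: "is_resolvent T (of_real m1 + of_real (\<tau> - m1)) S2" "pos_op S1 \<Longrightarrow> - complex_of_real (\<tau> - m1) \<in> \<real>\<^sub>\<ge>\<^sub>0 \<Longrightarrow> pos_op S2" by blast
  have "- complex_of_real (\<tau> - m1) = of_real (m1 - \<tau>)" by simp
  then have "pos_op S2" using S2(2) S1(2) tau by (simp add: nonneg_Reals_of_real_iff del: of_real_diff)
  moreover have "is_resolvent T (of_real \<tau>) S2" using S2(1) by simp
  ultimately have tP: "\<tau> \<in> P" unfolding P_def by (auto simp: \<tau>_def)
  then have "m \<le> \<tau>" unfolding m_def by (intro cInf_lower bb)
  then have "\<tau> = L" using C Lm by (auto simp: \<tau>_def max_def split: if_splits)
  then show ?thesis using tP that unfolding P_def by blast
qed

section \<open>Finite linear systems and the Fredholm alternative\<close>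

lemma square_system_solvable:
  fixes A :: "'i \<Rightarrow> 'j \<Rightarrow> complex"
  assumes "finite J" "finite I" "card I = card J"
    and "\<And>c. (\<forall>i\<in>I. (\<Sum>j\<in>J. A i j * c j) = 0) \<Longrightarrow> (\<forall>j\<in>J. c j = 0)"
  shows "\<exists>c. \<forall>i\<in>I. (\<Sum>j\<in>J. A i j * c j) = b i"
  using assms
proof (induction J arbitrary: I A b rule: finite_induct)
  case empty
  then show ?case by auto
next
  case (insert j J)
  have sum1: "(\<Sum>l\<in>insert j J. A i l * c l) = A i j * c j + (\<Sum>l\<in>J. A i l * c l)" for i c
    using insert.hyps by simp
  have "\<exists>p\<in>I. A p j \<noteq> 0"
  proof (rule ccontr)
    assume "\<not> ?thesis"
    then have "\<forall>i\<in>I. (\<Sum>l\<in>insert j J. A i l * (if l = j then 1 else 0)) = 0"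
      unfolding sum1 using insert.hyps by (auto intro!: sum.neutral)
    from insert.prems(3)[OF this] show False by auto
  qed
  then obtain p where p: "p \<in> I" "A p j \<noteq> 0" by blast
  \<comment> \<open>One step of Gaussian elimination with pivot \<open>A p j\<close>; the reduced
    system is again square and injective.\<close>
  define A' where "A' i l = A i l - A i j * A p l / A p j" for i l
  have A': "(\<Sum>l\<in>J. A' i l * c l) = (\<Sum>l\<in>J. A i l * c l) - A i j / A p j * (\<Sum>l\<in>J. A p l * c l)" for i c
    unfolding A'_def by (simp add: sum_subtractf sum_distrib_left algebra_simps)
  have card: "finite (I - {p})" "card (I - {p}) = card J" using insert p by auto
  have inj: "\<forall>l\<in>J. c l = 0" if c: "\<forall>i\<in>I - {p}. (\<Sum>l\<in>J. A' i l * c l) = 0" for c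
  proof -
    define c' where "c' = c(j := - (\<Sum>l\<in>J. A p l * c l) / A p j)"
    have cJ: "(\<Sum>l\<in>J. A i l * c' l) = (\<Sum>l\<in>J. A i l * c l)" for i
      by (rule sum.cong) (use insert.hyps in \<open>auto simp: c'_def\<close>)
    have "(\<Sum>l\<in>insert j J. A i l * c' l) = 0" if "i \<in> I" for i
    proof (cases "i = p")
      case True then show ?thesis unfolding sum1 cJ using p by (simp add: c'_def)
    next
      case False then show ?thesis unfolding sum1 cJ using c that A'[of i c] by (simp add: c'_def)
    qed
    then have "\<forall>l\<in>insert j J. c' l = 0" using insert.prems(3) by blast
    then show ?thesis using insert.hyps by (auto simp: c'_def split: if_splits)
  qed
  from insert.IH[OF card inj] obtain c where c: "\<And>i. i \<in> I - {p} \<Longrightarrow> (\<Sum>l\<in>J. A' i l * c l) = b i - A i j / A p j * b p"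
    by fast
  define c' where "c' = c(j := (b p - (\<Sum>l\<in>J. A p l * c l)) / A p j)"
  have cJ: "(\<Sum>l\<in>J. A i l * c' l) = (\<Sum>l\<in>J. A i l * c l)" for i
    by (rule sum.cong) (use insert.hyps in \<open>auto simp: c'_def\<close>)
  have "(\<Sum>l\<in>insert j J. A i l * c' l) = b i" if "i \<in> I" for i
  proof (cases "i = p")
    case True then show ?thesis unfolding sum1 cJ using p by (simp add: c'_def)
  next
    case False
    then have "b i - A i j / A p j * b p = (\<Sum>l\<in>J. A i l * c l) - A i j / A p j * (\<Sum>l\<in>J. A p l * c l)"
      using c[of i] A'[of i c] that by simp
    then have "(\<Sum>l\<in>J. A i l * c l) = b i - A i j / A p j * b p + A i j / A p j * (\<Sum>l\<in>J. A p l * c l)"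
      by simp
    then show ?thesis unfolding sum1 cJ by (simp add: c'_def diff_divide_distrib algebra_simps)
  qed
  then show ?case by blast
qed

text \<open>A fixed matrix M, rather than mere solvability for each b, makes the solution depend
  boundedly on b, as the resolvent constructed from it must.\<close>

lemma square_system_inverse:
  fixes A :: "nat \<Rightarrow> nat \<Rightarrow> complex"
  assumes "\<And>c. (\<forall>i<n. (\<Sum>j<n. A i j * c j) = 0) \<Longrightarrow> (\<forall>j<n. c j = 0)"
  obtains M where "\<And>i b. i < n \<Longrightarrow> (\<Sum>j<n. A i j * (\<Sum>l<n. M j l * b l)) = b i"
proof -
  have "\<exists>c. \<forall>i\<in>{..<n}. (\<Sum>j<n. A i j * c j) = (if i = l then 1 else 0)" for l
    by (rule square_system_solvable) (use assms in auto)
  then obtain M where M: "\<And>l i. i < n \<Longrightarrow> (\<Sum>j<n. A i j * M l j) = (if i = l then 1 else 0)" by (metis lessThan_iff)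
  have "(\<Sum>j<n. A i j * (\<Sum>l<n. M l j * b l)) = b i" if "i < n" for i b
  proof -
    have "(\<Sum>j<n. A i j * (\<Sum>l<n. M l j * b l)) = (\<Sum>l<n. (\<Sum>j<n. A i j * M l j) * b l)"
      unfolding sum_distrib_left sum_distrib_right by (subst sum.swap) (simp add: mult_ac)
    also have "\<dots> = (\<Sum>l<n. if i = l then b l else 0)" by (rule sum.cong) (use M[OF that] in auto)
    finally show ?thesis using that by simp
  qed
  then show ?thesis using that[of "\<lambda>j l. M l j"] by blast
qed

text \<open>T is an operator B of norm below |lam| plus one of finite rank. With N the resolvent of
  B at lam and v_j = N p_j, the equation lam f - T f = g means f = N g + sum_j l_j(f) v_j, and
  applying each l_i turns this into a linear system for the numbers l_j(f).\<close>

lemma fredholm_alternative: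
  fixes n :: nat and p :: "nat \<Rightarrow> complex \<Rightarrow> complex" and l :: "nat \<Rightarrow> (complex \<Rightarrow> complex) \<Rightarrow> complex"
  assumes T: "op_bound T CT" and p: "\<And>j. j < n \<Longrightarrow> p j \<in> AD"
    and l: "\<And>j f g a b. j < n \<Longrightarrow> f \<in> AD \<Longrightarrow> g \<in> AD \<Longrightarrow> l j (\<lambda>z. a * f z + b * g z) = a * l j f + b * l j g"
      "\<And>j f. j < n \<Longrightarrow> f \<in> AD \<Longrightarrow> cmod (l j f) \<le> K * snorm f"
    and approx: "\<And>f. f \<in> AD \<Longrightarrow> snorm (\<lambda>z. T f z - (\<Sum>j<n. l j f * p j z)) \<le> C * snorm f" "0 \<le> C" "C < cmod lam"
    and inj: "\<And>f. f \<in> AD \<Longrightarrow> (\<lambda>z. lam * f z - T f z) = (\<lambda>z. 0) \<Longrightarrow> f = (\<lambda>z. 0)"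
  shows "\<exists>S. is_resolvent T lam S"
proof -
  define F where "F f z = (\<Sum>j<n. l j f * p j z)" for f z
  define B where "B f z = T f z - F f z" for f z
  have FA: "F f \<in> AD" for f unfolding F_def[abs_def] using p by (intro AD_sum) auto
  have Flin: "F (\<lambda>z. a * f z + b * g z) = (\<lambda>z. a * F f z + b * F g z)" if "f \<in> AD" "g \<in> AD" for f g a b
    unfolding F_def[abs_def] using l(1) that by (simp add: sum_distrib_left sum.distrib algebra_simps)
  have B: "op_bound B C" unfolding op_bound_def
  proof (intro conjI ballI allI)
    fix f assume f: "f \<in> AD"
    show "B f \<in> AD" unfolding B_def[abs_def] by (rule AD_diff[OF op_in[OF T f] FA])
    show "snorm (B f) \<le> C * snorm f" using approx(1)[OF f] by (simp add: B_def[abs_def] F_def[abs_def])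
    fix g a b assume g: "g \<in> AD"
    show "B (\<lambda>z. a * f z + b * g z) = (\<lambda>z. a * B f z + b * B g z)"
      unfolding B_def[abs_def] op_lincomb[OF T f g] Flin[OF f g] by (simp add: algebra_simps)
  qed (use approx in auto)
  obtain N where N: "is_resolvent B lam N" "op_bound N (1 / (cmod lam - C))" using resolvent_large[OF B approx(3)] by blast
  have NB: "lam * N f z - B (N f) z = f z" if "f \<in> AD" for f z
    using N(1) that unfolding is_resolvent_def by (metis (no_types, lifting))
  define v where "v j = N (p j)" for j
  have v: "v j \<in> AD" if "j < n" for j unfolding v_def using op_in[OF N(2) p[OF that]] .
  have lsum: "l i (\<lambda>z. \<Sum>j\<in>J. c j * v j z) = (\<Sum>j\<in>J. c j * l i (v j))" if "i < n" "finite J" "J \<subseteq> {..<n}" for i c J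
    using that(2,3)
  proof (induction J rule: finite_induct)
    case empty
    show ?case using l(1)[OF that(1) AD_zero AD_zero, of 0 0] by simp
  next
    case (insert x J)
    have "l i (\<lambda>z. c x * v x z + 1 * (\<Sum>j\<in>J. c j * v j z)) = c x * l i (v x) + 1 * l i (\<lambda>z. \<Sum>j\<in>J. c j * v j z)"
      using insert that(1) v by (intro l(1) AD_sum) auto
    then show ?case using insert by simp
  qed
  have Tf: "T f z = B f z + (\<Sum>j<n. l j f * p j z)" for f z by (simp add: B_def F_def)
  have comb: "lam * h z - B h z = g z + (\<Sum>j<n. c j * p j z)"
    if "g \<in> AD" "h = (\<lambda>z. N g z + (\<Sum>j<n. c j * v j z))" for g h c z
  proof -
    have A: "(\<lambda>z. \<Sum>j<n. c j * v j z) \<in> AD" using v by (intro AD_sum) auto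
    have "B h = (\<lambda>z. B (N g) z + (\<Sum>j<n. c j * B (v j) z))"
      unfolding that(2) op_add[OF B op_in[OF N(2) that(1)] A] using op_sum[OF B, of "{..<n}" v c] v by simp
    then have "lam * h z - B h z = (lam * N g z - B (N g) z) + (\<Sum>j<n. c j * (lam * v j z - B (v j) z))"
      by (simp add: that(2) sum_subtractf sum_distrib_left algebra_simps)
    also have "\<dots> = g z + (\<Sum>j<n. c j * p j z)" using NB[OF that(1)] NB[OF p] by (simp add: v_def)
    finally show ?thesis .
  qed
  \<comment> \<open>The matrix of that system: the identity minus the entries l_i(v_j). A null
    vector c makes sum_j c_j v_j a null function of lam - T, so the assumed injectivity gives c =
    0.\<close>
  define A where "A i j = (if i = j then 1 else 0) - l i (v j)" for i j
  have Ac: "(\<Sum>j<n. A i j * c j) = c i - l i (\<lambda>z. \<Sum>j<n. c j * v j z)" if "i < n" for i c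
  proof -
    have "(\<Sum>j<n. A i j * c j) = (\<Sum>j<n. (if i = j then c j else 0)) - (\<Sum>j<n. c j * l i (v j))"
      unfolding A_def sum_subtractf[symmetric] by (rule sum.cong) (auto simp: algebra_simps)
    then show ?thesis using that lsum[OF that, of "{..<n}" c] by simp
  qed
  have Ainj: "\<forall>j<n. c j = 0" if c: "\<forall>i<n. (\<Sum>j<n. A i j * c j) = 0" for c
  proof -
    define f where "f = (\<lambda>z. \<Sum>j<n. c j * v j z)"
    have f: "f \<in> AD" unfolding f_def using v by (intro AD_sum) auto
    have lf: "l i f = c i" if "i < n" for i using c Ac[OF that, of c] that by (simp add: f_def)
    have N0: "N (\<lambda>z. 0) = (\<lambda>z. 0)" by (rule op_zero[OF N(2)])
    have "lam * f z - B f z = 0 + (\<Sum>j<n. c j * p j z)" for z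
      by (rule comb[OF AD_zero]) (simp add: f_def N0)
    then have "(\<lambda>z. lam * f z - T f z) = (\<lambda>z. 0)" by (simp add: Tf lf diff_diff_eq[symmetric])
    then have "f = (\<lambda>z. 0)" by (rule inj[OF f])
    then have "l i f = 0" if "i < n" for i using l(1)[OF that AD_zero AD_zero, of 0 0] by simp
    then show ?thesis using lf by simp
  qed
  obtain M where M: "\<And>i b. i < n \<Longrightarrow> (\<Sum>j<n. A i j * (\<Sum>m<n. M j m * b m)) = b i"
    using square_system_inverse[of n A] Ainj by blast
  define c where "c g j = (\<Sum>m<n. M j m * l m (N g))" for g j
  define S where "S g = (\<lambda>z. N g z + (\<Sum>j<n. c g j * v j z))" for g
  have SA: "S g \<in> AD" if "g \<in> AD" for g
    unfolding S_def using v by (intro AD_add op_in[OF N(2) that] AD_sum) auto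
  have S1: "lam * S g z - T (S g) z = g z" if g: "g \<in> AD" for g z
  proof -
    have "l i (S g) = c g i" if i: "i < n" for i
    proof -
      have vA: "(\<lambda>z. \<Sum>j<n. c g j * v j z) \<in> AD" using v by (intro AD_sum) auto
      have "l i (S g) = l i (N g) + l i (\<lambda>z. \<Sum>j<n. c g j * v j z)"
        using l(1)[OF i op_in[OF N(2) g] vA, of 1 1] by (simp add: S_def)
      also have "l i (N g) = (\<Sum>j<n. A i j * c g j)" unfolding c_def using M[OF i, of "\<lambda>m. l m (N g)"] by simp
      finally show ?thesis using Ac[OF i] by simp
    qed
    then show ?thesis using comb[OF g, of "S g" "c g" z] by (simp add: Tf S_def[symmetric] diff_diff_eq[symmetric] eq_diff_eq algebra_simps)
  qed
  have uniq: "f = g" if fg: "f \<in> AD" "g \<in> AD" "\<And>z. lam * f z - T f z = lam * g z - T g z" for f g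
  proof -
    have "(\<lambda>z. lam * (f z - g z) - T (\<lambda>z. f z - g z) z) = (\<lambda>z. 0)"
      unfolding op_diff[OF T fg(1,2)] using fg(3) by (simp add: fun_eq_iff algebra_simps)
    from inj[OF AD_diff[OF fg(1,2)] this] show ?thesis by (simp add: fun_eq_iff)
  qed
  have Slin: "S (\<lambda>z. a * f z + b * g z) = (\<lambda>z. a * S f z + b * S g z)" if fg: "f \<in> AD" "g \<in> AD" for f g a b
  proof (rule uniq)
    fix z
    have "lam * (a * S f z + b * S g z) - T (\<lambda>z. a * S f z + b * S g z) z
       = a * (lam * S f z - T (S f) z) + b * (lam * S g z - T (S g) z)"
      unfolding op_lincomb[OF T SA[OF fg(1)] SA[OF fg(2)]] by (simp add: algebra_simps)
    then show "lam * S (\<lambda>z. a * f z + b * g z) z - T (S (\<lambda>z. a * f z + b * g z)) z =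
       lam * (a * S f z + b * S g z) - T (\<lambda>z. a * S f z + b * S g z) z"
      using S1[OF AD_lincomb[OF fg]] S1[OF fg(1)] S1[OF fg(2)] by simp
  qed (use SA fg AD_lincomb in auto)
  define K' where "K' = (1 / (cmod lam - C)) + (\<Sum>j<n. (\<Sum>m<n. cmod (M j m) * (\<bar>K\<bar> * (1 / (cmod lam - C)))) * snorm (v j))"
  have "snorm (S g) \<le> K' * snorm g" if g: "g \<in> AD" for g
  proof (rule snorm_le)
    fix z assume z: "z \<in> cD"
    have Ng: "snorm (N g) \<le> 1 / (cmod lam - C) * snorm g" by (rule op_le[OF N(2) g])
    have lm: "cmod (l m (N g)) \<le> \<bar>K\<bar> * (1 / (cmod lam - C)) * snorm g" if "m < n" for m
    proof -
      have "cmod (l m (N g)) \<le> K * snorm (N g)" by (rule l(2)[OF that op_in[OF N(2) g]])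
      also have "\<dots> \<le> \<bar>K\<bar> * snorm (N g)" using snorm_nonneg[OF op_in[OF N(2) g]] by (intro mult_right_mono) auto
      also have "\<dots> \<le> \<bar>K\<bar> * (1 / (cmod lam - C) * snorm g)" using Ng by (intro mult_left_mono) auto
      finally show ?thesis by (simp add: mult_ac)
    qed
    have cj: "cmod (c g j) \<le> (\<Sum>m<n. cmod (M j m) * (\<bar>K\<bar> * (1 / (cmod lam - C)))) * snorm g" for j
    proof -
      have "cmod (c g j) \<le> (\<Sum>m<n. cmod (M j m * l m (N g)))" unfolding c_def by (rule norm_sum)
      also have "\<dots> \<le> (\<Sum>m<n. cmod (M j m) * (\<bar>K\<bar> * (1 / (cmod lam - C)) * snorm g))"
        unfolding norm_mult using lm by (intro sum_mono mult_left_mono) auto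
      finally show ?thesis unfolding sum_distrib_right by (simp only: mult.assoc)
    qed
    have "cmod (S g z) \<le> cmod (N g z) + (\<Sum>j<n. cmod (c g j * v j z))"
      unfolding S_def by (rule order_trans[OF norm_triangle_ineq]) (intro add_left_mono norm_sum)
    also have "\<dots> \<le> 1 / (cmod lam - C) * snorm g + (\<Sum>j<n. (\<Sum>m<n. cmod (M j m) * (\<bar>K\<bar> * (1 / (cmod lam - C)))) * snorm g * snorm (v j))"
    proof (intro add_mono sum_mono)
      show "cmod (N g z) \<le> 1 / (cmod lam - C) * snorm g" using AD_le_snorm[OF op_in[OF N(2) g] z] Ng by linarith
      fix j assume "j \<in> {..<n}"
      then have vj: "cmod (v j z) \<le> snorm (v j)" using AD_le_snorm[OF v z] by simp
      show "cmod (c g j * v j z) \<le> (\<Sum>m<n. cmod (M j m) * (\<bar>K\<bar> * (1 / (cmod lam - C)))) * snorm g * snorm (v j)"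
        unfolding norm_mult using approx(3) snorm_nonneg[OF g]
        by (intro mult_mono[OF cj vj]) (auto intro!: sum_nonneg mult_nonneg_nonneg)
    qed
    also have "\<dots> = K' * snorm g"
    proof -
      have "a * s + (\<Sum>j<n. X j * s * Y j) = (a + (\<Sum>j<n. X j * Y j)) * s" for a s :: real and X Y :: "nat \<Rightarrow> real"
        by (simp add: distrib_left sum_distrib_left mult_ac)
      then show ?thesis unfolding K'_def .
    qed
    finally show "cmod (S g z) \<le> K' * snorm g" .
  qed
  then have "\<exists>C. \<forall>g\<in>AD. snorm (S g) \<le> C * snorm g" by blast
  moreover have "S (\<lambda>z. f z + g z) = (\<lambda>z. S f z + S g z)" if "f \<in> AD" "g \<in> AD" for f g using Slin[OF that, of 1 1] by simp
  moreover have "S (\<lambda>z. a * f z) = (\<lambda>z. a * S f z)" if "f \<in> AD" for f a using Slin[OF that that, of a 0] by simp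
  ultimately have bS: "bounded_op disc_D S" unfolding bounded_op_def using SA by blast
  have "S (\<lambda>z. lam * f z - T f z) = f" if f: "f \<in> AD" for f
    by (rule uniq[OF SA f S1]) (use AD_diff[OF AD_cmult[OF f] op_in[OF T f]] in auto)
  then show ?thesis using bS S1 unfolding is_resolvent_def by (intro exI[of _ S]) auto
qed

section \<open>The transfer operator on the disc algebra\<close>

lemma holomorphic_coeff_bound:
  assumes "f holomorphic_on ball \<xi> R" "0 < r" "r < R" "\<And>z. z \<in> ball \<xi> R \<Longrightarrow> cmod (f z) \<le> B"
  shows "cmod ((deriv ^^ n) f \<xi> / fact n) \<le> B / r ^ n"
proof -
  have "cball \<xi> r \<subseteq> ball \<xi> R" using assms by auto
  then have "cmod ((deriv ^^ n) f \<xi>) \<le> fact n * B / r ^ n"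
    using assms by (intro Cauchy_inequality)
      (auto intro: holomorphic_on_subset holomorphic_on_imp_continuous_on simp: dist_norm)
  then show ?thesis by (simp add: norm_divide field_simps)
qed

lemma holomorphic_tail_bound:
  assumes f: "f holomorphic_on ball \<xi> R" and r: "0 < r" "r < R" and B: "\<And>z. z \<in> ball \<xi> R \<Longrightarrow> cmod (f z) \<le> B"
    and w: "cmod (w - \<xi>) < r"
  shows "cmod (f w - (\<Sum>n<N. (deriv ^^ n) f \<xi> / fact n * (w - \<xi>) ^ n)) \<le> B * (cmod (w - \<xi>) / r) ^ N / (1 - cmod (w - \<xi>) / r)"
proof -
  define q where "q = cmod (w - \<xi>) / r"
  have q: "0 \<le> q" "q < 1" using r w by (auto simp: q_def)
  let ?c = "\<lambda>n. (deriv ^^ n) f \<xi> / fact n * (w - \<xi>) ^ n"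
  have s: "?c sums f w" using holomorphic_power_series[OF f, of w] w r by (auto simp: dist_norm norm_minus_commute)
  have cb: "cmod (?c n) \<le> B * q ^ n" for n
  proof -
    have "cmod (?c n) \<le> B / r ^ n * cmod (w - \<xi>) ^ n"
      unfolding norm_mult norm_power by (intro mult_right_mono holomorphic_coeff_bound[OF f r B]) auto
    then show ?thesis by (simp add: q_def power_divide)
  qed
  have sg: "summable (\<lambda>n. B * q ^ N * q ^ n)" using q by (intro summable_mult summable_geometric) auto
  have "f w - (\<Sum>n<N. ?c n) = (\<Sum>n. ?c (n + N))"
    using suminf_minus_initial_segment[OF sums_summable[OF s], of N] sums_unique[OF s] by simp
  also have "cmod \<dots> \<le> (\<Sum>n. B * q ^ N * q ^ n)"
  proof (rule norm_suminf_le[OF _ sg])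
    show "cmod (?c (n + N)) \<le> B * q ^ N * q ^ n" for n using cb[of "n + N"] by (simp add: power_add mult_ac)
  qed
  also have "\<dots> = B * q ^ N / (1 - q)"
    using suminf_mult[of "\<lambda>n. q ^ n" "B * q ^ N"] suminf_geometric[of q] summable_geometric[of q] q by simp
  finally show ?thesis by (simp add: q_def)
qed

lemma vderiv_holomorphic:
  assumes S: "open S" and h: "h holomorphic_on S" and x: "of_real x \<in> S"
  shows "vderiv n (\<lambda>x. h (of_real x)) x = (deriv ^^ n) h (of_real x)"
  using x
proof (induction n arbitrary: x)
  case (Suc n)
  have o: "open {x::real. complex_of_real x \<in> S}"
    using open_vimage[OF S, of complex_of_real] by (simp add: vimage_def continuous_on_of_real)
  have "((deriv ^^ n) h has_field_derivative deriv ((deriv ^^ n) h) (of_real x)) (at (of_real x))"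
    using holomorphic_derivI[OF holomorphic_higher_deriv[OF h S] S Suc.prems] .
  from of_real_has_vector_derivative[OF this]
  have "(vderiv n (\<lambda>x. h (of_real x)) has_vector_derivative deriv ((deriv ^^ n) h) (of_real x)) (at x)"
    by (rule has_vector_derivative_transform_within_open[OF _ o]) (use Suc in auto)
  then show ?case by (simp add: vderiv_Suc vector_derivative_at)
qed simp

text \<open>The radius is slightly above 3/2, so that the inverse branches still map into
  \<open>disc_D\<close>. Images under the transfer operator extend to this disc, which is what makes
  that operator compact.\<close>

definition disc_U :: "complex set" where "disc_U = ball 1 (8/5)"

lemma disc_U_Re: "z \<in> disc_U \<Longrightarrow> - (3/5) < Re z"
  using abs_Re_le_cmod[of "1 - z"] by (auto simp: disc_U_def dist_norm)

lemma cD_subset_U: "cD \<subseteq> disc_U" by (auto simp: cD_eq disc_U_def)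

text \<open>Inversion maps Re u > 2/5 onto the disc with centre and radius 5/4, which lies in the
  disc of radius 3/2 about 1 because 5/4 + 1/4 = 3/2. The number 2/5 is 1 - 3/5.\<close>

lemma branch_in_disc:
  assumes "- (3/5) < Re z" shows "1 / (of_nat (Suc m) + z) \<in> disc_D"
proof -
  define u where "u = of_nat (Suc m) + z"
  have u: "2/5 < Re u" using assms by (simp add: u_def)
  then have u0: "u \<noteq> 0" by auto
  have "cmod (1 / u - 5/4) < 5/4"
  proof -
    have "cmod (4 - 5 * u) < 5 * cmod u"
    proof (rule power2_less_imp_less)
      have "(cmod (4 - 5 * u))\<^sup>2 = (4 - 5 * Re u)\<^sup>2 + (5 * Im u)\<^sup>2" by (simp add: cmod_power2)
      also have "\<dots> = 16 - 40 * Re u + 25 * (cmod u)\<^sup>2" unfolding cmod_power2 by (simp add: power2_eq_square algebra_simps)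
      also have "\<dots> < 25 * (cmod u)\<^sup>2" using u by simp
      finally show "(cmod (4 - 5 * u))\<^sup>2 < (5 * cmod u)\<^sup>2" by (simp add: power2_eq_square)
    qed simp
    moreover have "1 / u - 5/4 = (4 - 5 * u) / (4 * u)" using u0 by (simp add: field_simps)
    ultimately show ?thesis using u0 by (simp add: norm_divide norm_mult divide_less_eq)
  qed
  moreover have "cmod (1 / u - 1) \<le> cmod (1 / u - 5/4) + cmod (5/4 - 1)"
    using norm_triangle_ineq[of "1/u - 5/4" "5/4 - 1"] by simp
  moreover have "cmod (5/4 - 1) = 1/4"
  proof -
    have "(5/4 - 1 :: complex) = of_real (1/4)" by simp
    then show ?thesis by (metis norm_of_real abs_of_nonneg zero_le_divide_1_iff zero_le_numeral)
  qed
  ultimately show ?thesis by (simp add: disc_D_def dist_norm norm_minus_commute u_def)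
qed

lemma AD_holomorphic: "f \<in> AD \<Longrightarrow> f holomorphic_on disc_D" by (simp add: A_inf_def)

lemma ball_0_subset_disc: "ball 0 (1/2) \<subseteq> disc_D"
proof
  fix z :: complex assume "z \<in> ball 0 (1/2)"
  then show "z \<in> disc_D" using norm_triangle_ineq4[of 1 z] by (simp add: disc_D_def dist_norm)
qed

lemma zero_in_disc: "0 \<in> disc_D" by (simp add: disc_D_def)

lemma open_disc: "open disc_D" by (simp add: disc_D_def)

lemma AD_le_snorm_ball_0: "f \<in> AD \<Longrightarrow> z \<in> ball 0 (1/2) \<Longrightarrow> cmod (f z) \<le> snorm f"
  using ball_0_subset_disc disc_subset_cD by (blast intro: AD_le_snorm)

lemma higher_deriv_lincomb:
  assumes "f holomorphic_on S" "g holomorphic_on S" "open S" "z \<in> S"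
  shows "(deriv ^^ n) (\<lambda>w. a * f w + b * g w) z = a * (deriv ^^ n) f z + b * (deriv ^^ n) g z"
proof -
  have "(deriv ^^ n) (\<lambda>w. a * f w + b * g w) z = (deriv ^^ n) (\<lambda>w. a * f w) z + (deriv ^^ n) (\<lambda>w. b * g w) z"
    by (rule higher_deriv_add[of _ S]) (use assms in \<open>auto intro!: holomorphic_intros\<close>)
  then show ?thesis using higher_deriv_cmult[OF assms(1,4,3)] higher_deriv_cmult[OF assms(2,4,3)] by simp
qed

definition tcoef :: "(complex \<Rightarrow> complex) \<Rightarrow> nat \<Rightarrow> complex" where
  "tcoef f n = (deriv ^^ n) f 0 / fact n"

lemma tcoef_bound:
  assumes "f \<in> AD" shows "cmod (tcoef f n) \<le> snorm f * 4 ^ n"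
proof -
  have "cmod (tcoef f n) \<le> snorm f / (1/4) ^ n" unfolding tcoef_def
    by (rule holomorphic_coeff_bound[of _ _ "1/2"])
       (use AD_le_snorm_ball_0[OF assms] holomorphic_on_subset[OF AD_holomorphic[OF assms] ball_0_subset_disc] in auto)
  then show ?thesis by (simp add: power_divide)
qed

lemma tcoef_lincomb: "f \<in> AD \<Longrightarrow> g \<in> AD \<Longrightarrow> tcoef (\<lambda>z. a * f z + b * g z) n = a * tcoef f n + b * tcoef g n"
  unfolding tcoef_def
  by (subst higher_deriv_lincomb[of _ disc_D]) (auto simp: AD_holomorphic zero_in_disc add_divide_distrib intro: open_disc)

text \<open>Near 0 the Taylor tail is geometric with ratio 4|w| <= 1/2, coefficients being estimated
  on radius 1/4 inside the disc of radius 1/2 about 0. Away from 0 the trivial bound suffices, as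
  (8|w|)^(k + 1) >= 1; the 10 is 4 * 5/2, with 5/2 the largest |w| on \<open>cD\<close>.\<close>

lemma AD_remainder_bound:
  assumes f: "f \<in> AD" and w: "w \<in> cD"
  shows "cmod (f w - (\<Sum>n\<le>k. tcoef f n * w ^ n)) \<le> (2 * 4 ^ Suc k + 8 ^ Suc k * (1 + (\<Sum>n\<le>k. 10 ^ n))) * snorm f * cmod w ^ Suc k"
proof -
  note s0 = snorm_nonneg[OF f]
  have K: "0 \<le> (\<Sum>n\<le>k. 10 ^ n :: real)" by (intro sum_nonneg) auto
  show ?thesis
  proof (cases "cmod w \<le> 1/8")
    case True
    have "cmod (f w - (\<Sum>n<Suc k. (deriv ^^ n) f 0 / fact n * (w - 0) ^ n)) \<le> snorm f * (cmod (w - 0) / (1/4)) ^ Suc k / (1 - cmod (w - 0) / (1/4))"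
      by (rule holomorphic_tail_bound[of _ _ "1/2"])
         (use True AD_le_snorm_ball_0[OF f] holomorphic_on_subset[OF AD_holomorphic[OF f] ball_0_subset_disc] in auto)
    then have "cmod (f w - (\<Sum>n\<le>k. tcoef f n * w ^ n)) \<le> snorm f * (4 * cmod w) ^ Suc k / (1 - 4 * cmod w)"
      by (simp only: lessThan_Suc_atMost tcoef_def) (simp add: mult.commute)
    also have "\<dots> \<le> snorm f * (4 * cmod w) ^ Suc k / (1/2)"
      using True s0 by (intro divide_left_mono mult_nonneg_nonneg) auto
    also have "\<dots> = 2 * 4 ^ Suc k * snorm f * cmod w ^ Suc k" by (simp add: power_mult_distrib mult_ac)
    also have "\<dots> \<le> (2 * 4 ^ Suc k + 8 ^ Suc k * (1 + (\<Sum>n\<le>k. 10 ^ n))) * snorm f * cmod w ^ Suc k"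
      using s0 K by (intro mult_right_mono) (auto intro!: mult_nonneg_nonneg)
    finally show ?thesis .
  next
    case False
    have "cmod w \<le> 5/2" using w norm_triangle_ineq2[of w 1] by (simp add: cD_eq dist_norm norm_minus_commute)
    have "cmod (\<Sum>n\<le>k. tcoef f n * w ^ n) \<le> (\<Sum>n\<le>k. snorm f * 10 ^ n)"
    proof (rule order_trans[OF norm_sum sum_mono])
      fix n
      have "cmod (tcoef f n * w ^ n) \<le> (snorm f * 4 ^ n) * (5/2) ^ n"
        unfolding norm_mult norm_power using tcoef_bound[OF f] \<open>cmod w \<le> 5/2\<close> s0 by (intro mult_mono power_mono) auto
      also have "\<dots> = snorm f * (4 * (5/2)) ^ n" by (simp only: power_mult_distrib mult.assoc)
      finally show "cmod (tcoef f n * w ^ n) \<le> snorm f * 10 ^ n" by simp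
    qed
    then have "cmod (f w - (\<Sum>n\<le>k. tcoef f n * w ^ n)) \<le> (1 + (\<Sum>n\<le>k. 10 ^ n)) * snorm f"
      using AD_le_snorm[OF f w] norm_triangle_ineq4[of "f w" "\<Sum>n\<le>k. tcoef f n * w ^ n"]
      by (simp add: distrib_right flip: sum_distrib_left) (simp add: mult.commute)
    also have "\<dots> \<le> (1 + (\<Sum>n\<le>k. 10 ^ n)) * snorm f * (8 * cmod w) ^ Suc k"
    proof -
      have "1 \<le> (8 * cmod w) ^ Suc k" using False by (intro one_le_power) auto
      then show ?thesis using s0 K mult_left_mono[of 1 "(8 * cmod w) ^ Suc k" "(1 + (\<Sum>n\<le>k. 10 ^ n)) * snorm f"] by simp
    qed
    also have "\<dots> = 8 ^ Suc k * (1 + (\<Sum>n\<le>k. 10 ^ n)) * snorm f * cmod w ^ Suc k"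
      by (simp only: power_mult_distrib mult_ac)
    also have "\<dots> \<le> (2 * 4 ^ Suc k + 8 ^ Suc k * (1 + (\<Sum>n\<le>k. 10 ^ n))) * snorm f * cmod w ^ Suc k"
      using s0 by (intro mult_right_mono) auto
    finally show ?thesis .
  qed
qed

text \<open>A qualitative two-constants theorem, by contradiction: a Montel limit of counterexamples
  vanishes on the interval, hence on \<open>cD\<close>, while the convergence is uniform on the
  compact set \<open>cD\<close> inside \<open>disc_U\<close>.\<close>

lemma holomorphic_small_on_interval:
  assumes "\<epsilon> > 0"
  shows "\<exists>\<delta>>0. \<forall>H. H holomorphic_on disc_U \<longrightarrow> (\<forall>z\<in>disc_U. cmod (H z) \<le> 1) \<longrightarrow>
     (\<forall>x\<in>iv. cmod (H (of_real x)) \<le> \<delta>) \<longrightarrow> (\<forall>z\<in>cD. cmod (H z) \<le> \<epsilon>)"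
proof (rule ccontr)
  assume "\<not> ?thesis"
  then have "\<forall>n::nat. \<exists>H. H holomorphic_on disc_U \<and> (\<forall>z\<in>disc_U. cmod (H z) \<le> 1) \<and>
     (\<forall>x\<in>iv. cmod (H (of_real x)) \<le> 1 / real (Suc n)) \<and> (\<exists>z\<in>cD. cmod (H z) > \<epsilon>)"
    by (metis (no_types, lifting) not_le of_nat_0_less_iff zero_less_Suc zero_less_divide_1_iff)
  then obtain H where H: "\<And>n. H n holomorphic_on disc_U" "\<And>n z. z\<in>disc_U \<Longrightarrow> cmod (H n z) \<le> 1"
    "\<And>n x. x\<in>iv \<Longrightarrow> cmod (H n (of_real x)) \<le> 1 / real (Suc n)" "\<And>n. \<exists>z\<in>cD. cmod (H n z) > \<epsilon>"
    by metis
  have oU: "open disc_U" by (simp add: disc_U_def)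
  obtain g r where g: "g holomorphic_on disc_U" "strict_mono (r :: nat \<Rightarrow> nat)"
    "\<And>x. x \<in> disc_U \<Longrightarrow> ((\<lambda>n. H (r n) x) \<longlongrightarrow> g x) sequentially"
    "\<And>K. compact K \<Longrightarrow> K \<subseteq> disc_U \<Longrightarrow> uniform_limit K (H \<circ> r) g sequentially"
  proof (rule Montel[OF oU, of "range H" H])
    show "h holomorphic_on disc_U" if "h \<in> range H" for h using that H(1) by auto
    show "\<exists>B. \<forall>h\<in>range H. \<forall>z\<in>K. cmod (h z) \<le> B" if "compact K" "K \<subseteq> disc_U" for K
      using that H(2) by (intro exI[of _ 1]) auto
  qed auto
  have inU: "complex_of_real x \<in> disc_U" if "x \<in> iv" for x
    using iv_in_disc[OF that] disc_subset_cD cD_subset_U by blast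
  have gI: "g (of_real x) = 0" if x: "x \<in> iv" for x
  proof (rule LIMSEQ_unique[OF g(3)[OF inU[OF x]]])
    have "(\<lambda>n. 1 / real (Suc (r n))) \<longlonglongrightarrow> 0"
      using LIMSEQ_subseq_LIMSEQ[OF LIMSEQ_Suc[OF lim_1_over_n] g(2)] by (simp add: o_def)
    then show "(\<lambda>n. H (r n) (complex_of_real x)) \<longlonglongrightarrow> 0"
      by (rule Lim_null_comparison[rotated]) (use H(3)[OF x] in auto)
  qed
  define f where "f z = (if z \<in> cD then g z else 0)" for z
  have "f \<in> AD" unfolding f_def[abs_def] by (rule AD_restrict[OF oU cD_subset_U g(1)])
  moreover have "f (of_real x) = 0" if "x \<in> iv" for x using gI[OF that] by (simp add: f_def)
  ultimately have "f = (\<lambda>z. 0)" by (rule AD_eq_zeroI)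
  then have g0: "g z = 0" if "z \<in> cD" for z using that by (metis f_def)
  have "uniform_limit cD (H \<circ> r) g sequentially" using g(4)[OF _ cD_subset_U] by (simp add: cD_eq)
  then obtain n where "\<forall>z\<in>cD. dist ((H \<circ> r) n z) (g z) < \<epsilon>"
    using assms unfolding uniform_limit_iff eventually_sequentially by blast
  then show False using H(4)[of "r n"] g0 by force
qed

section \<open>Extension of images to the larger disc, eigenfunctions, and agreement with the real
  operator\<close>

context transfer_params
begin

text \<open>The formula of the transfer operator without the cutoff outside \<open>cD\<close>, so
  that it can be used on \<open>disc_U\<close>.\<close>

definition Text :: "(complex \<Rightarrow> complex) \<Rightarrow> complex \<Rightarrow> complex" where
  "Text f z = (\<Sum>n\<le>deg. tcoef f n * hurwitz_zeta (of_nat n + 2 * \<beta>) (z + 1))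
     + (\<Sum>m. (of_nat (Suc m) + z) powr (- (2 * \<beta>)) *
          (f (1 / (of_nat (Suc m) + z)) - (\<Sum>n\<le>deg. tcoef f n * (1 / (of_nat (Suc m) + z)) ^ n)))"

definition T :: "(complex \<Rightarrow> complex) \<Rightarrow> complex \<Rightarrow> complex" where "T = transfer_op \<alpha> \<beta>"

lemma T_eq: "T f z = (if z \<in> cD then Text f z else 0)"
  by (simp add: T_def transfer_op_def Text_def tcoef_def deg_def Let_def)

definition Tterm :: "(complex \<Rightarrow> complex) \<Rightarrow> nat \<Rightarrow> complex \<Rightarrow> complex" where
  "Tterm f m z = (of_nat (Suc m) + z) powr (- (2 * \<beta>)) *
          (f (1 / (of_nat (Suc m) + z)) - (\<Sum>n\<le>deg. tcoef f n * (1 / (of_nat (Suc m) + z)) ^ n))"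

lemma Text_eq: "Text f z = (\<Sum>n\<le>deg. tcoef f n * hurwitz_zeta (of_nat n + 2 * \<beta>) (z + 1)) + (\<Sum>m. Tterm f m z)"
  by (simp add: Text_def Tterm_def)

text \<open>For f holomorphic near 0 the remainder has order deg + 1 > \<alpha>, which only improves
  the exponent 2 Re \<beta> + \<alpha> > 1.\<close>

definition \<sigma>exp :: real where "\<sigma>exp = 2 * Re \<beta> + real (Suc deg)"

lemma sigma_gt_1: "1 < \<sigma>exp"
  using expo deg_hexp frac_part_bounds(2)[of \<alpha>] by (simp add: \<sigma>exp_def hexp_def)

definition Cterm :: real where
  "Cterm = exp (pi * \<bar>Im (- (2 * \<beta>))\<bar>) * (2 * 4 ^ Suc deg + 8 ^ Suc deg * (1 + (\<Sum>n\<le>deg. 10 ^ n)))"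

lemma Cterm_nonneg: "0 \<le> Cterm"
  unfolding Cterm_def by (intro mult_nonneg_nonneg add_nonneg_nonneg sum_nonneg) auto

lemma Tterm_bound:
  assumes f: "f \<in> AD" and z: "- (3/5) < Re z"
  shows "cmod (Tterm f m z) \<le> Cterm * snorm f * (real m + 2/5) powr (- \<sigma>exp)"
proof -
  define u where "u = of_nat (Suc m) + z"
  have u: "real m + 2/5 < Re u" using z by (simp add: u_def)
  then have u0: "u \<noteq> 0" and cu: "real m + 2/5 \<le> cmod u" "0 < cmod u" using complex_Re_le_cmod[of u] by auto
  have w: "1 / u \<in> cD" using branch_in_disc[OF z] disc_subset_cD unfolding u_def by blast
  let ?K = "2 * 4 ^ Suc deg + 8 ^ Suc deg * (1 + (\<Sum>n\<le>deg. 10 ^ n)) :: real"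
  have K: "0 \<le> ?K" by (intro add_nonneg_nonneg mult_nonneg_nonneg sum_nonneg) auto
  have "cmod (Tterm f m z) \<le> (cmod u powr Re (- (2 * \<beta>)) * exp (pi * \<bar>Im (- (2 * \<beta>))\<bar>)) * (?K * snorm f * cmod (1 / u) ^ Suc deg)"
    unfolding Tterm_def u_def[symmetric] norm_mult
    by (intro mult_mono cmod_powr_le[OF u0] AD_remainder_bound[OF f w]) auto
  also have "\<dots> = Cterm * snorm f * (cmod u powr Re (- (2 * \<beta>)) * cmod (1 / u) ^ Suc deg)"
    unfolding Cterm_def by (simp only: mult_ac)
  also have "cmod (1 / u) ^ Suc deg = cmod u powr (- real (Suc deg))"
    using cu by (simp add: norm_divide power_divide powr_minus_divide powr_realpow del: power_Suc of_nat_Suc)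
  also have "cmod u powr Re (- (2 * \<beta>)) * cmod u powr (- real (Suc deg)) = cmod u powr (- \<sigma>exp)"
    unfolding \<sigma>exp_def by (simp flip: powr_add)
  also have "Cterm * snorm f * cmod u powr (- \<sigma>exp) \<le> Cterm * snorm f * (real m + 2/5) powr (- \<sigma>exp)"
    using cu sigma_gt_1 Cterm_nonneg snorm_nonneg[OF f] by (intro mult_left_mono powr_mono2') auto
  finally show ?thesis .
qed

lemma summable_bound: "summable (\<lambda>m. C * (real m + 2/5) powr (- \<sigma>exp))"
  using sigma_gt_1 by (intro summable_mult summable_shift_powr) auto

lemma Tterm_summable:
  assumes f: "f \<in> AD" and z: "- (3/5) < Re z" shows "summable (\<lambda>m. Tterm f m z)"
  by (rule summable_comparison_test'[OF summable_bound, of 0]) (use Tterm_bound[OF assms] in auto)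

lemma Text_holomorphic:
  assumes f: "f \<in> AD" shows "Text f holomorphic_on disc_U"
proof -
  have oU: "open disc_U" by (simp add: disc_U_def)
  have hz: "(\<lambda>w. hurwitz_zeta (of_nat n + 2 * \<beta>) (w + 1)) holomorphic_on disc_U" for n
  proof -
    have "(\<lambda>w. w + 1) ` disc_U \<subseteq> {a. 0 < Re a}" using disc_U_Re by force
    from holomorphic_on_compose_gen[OF _ hurwitz_zeta_holomorphic[OF not_pole', of n] this]
    show ?thesis by (simp add: o_def holomorphic_intros)
  qed
  have "(\<lambda>z. \<Sum>m. Tterm f m z) holomorphic_on disc_U"
  proof (rule holomorphic_on_suminf_local[OF oU])
    fix m
    have nz: "of_nat (Suc m) + z \<notin> \<real>\<^sub>\<le>\<^sub>0" "of_nat (Suc m) + z \<noteq> 0" if "z \<in> disc_U" for z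
      using disc_U_Re[OF that] Re_pos_not_nonpos[of "of_nat (Suc m) + z"] by (auto simp: complex_eq_iff)
    have "(\<lambda>z. 1 / (of_nat (Suc m) + z)) holomorphic_on disc_U"
      using nz by (intro holomorphic_intros) auto
    moreover have "(\<lambda>z. 1 / (of_nat (Suc m) + z)) ` disc_U \<subseteq> disc_D" using branch_in_disc disc_U_Re by blast
    ultimately have "(\<lambda>z. f (1 / (of_nat (Suc m) + z))) holomorphic_on disc_U"
      using holomorphic_on_compose_gen[OF _ AD_holomorphic[OF f]] by (auto simp: o_def)
    then show "Tterm f m holomorphic_on disc_U"
      unfolding Tterm_def[abs_def] using nz by (intro holomorphic_intros) auto
  next
    show "\<exists>d>0. \<exists>h. summable h \<and> (\<forall>n\<ge>1. \<forall>y\<in>ball x d \<inter> disc_U. cmod (Tterm f n y) \<le> h n)" for x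
      using Tterm_bound[OF f] disc_U_Re summable_bound by (intro exI[of _ 1] conjI exI[of _ "\<lambda>m. Cterm * snorm f * (real m + 2/5) powr (- \<sigma>exp)"]) auto
  qed
  then show ?thesis unfolding Text_def[abs_def] Tterm_def[symmetric] by (intro holomorphic_intros hz)
qed

text \<open>For z in \<open>disc_U\<close> the point z + 1 stays in a compact disc within Re > 0,
  where the zeta functions are bounded. Values on the larger disc are thus controlled by the norm on
  the smaller one, the form in which compactness enters below.\<close>

lemma Text_bound: "\<exists>C>0. \<forall>f\<in>AD. \<forall>z\<in>disc_U. cmod (Text f z) \<le> C * snorm f"
proof -
  have "\<exists>Z. \<forall>z\<in>disc_U. cmod (hurwitz_zeta (of_nat n + 2 * \<beta>) (z + 1)) \<le> Z" for n
  proof -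
    have sub: "cball 2 (8/5) \<subseteq> {a. 0 < Re a}"
    proof
      fix a :: complex assume "a \<in> cball 2 (8/5)"
      then show "a \<in> {a. 0 < Re a}" using abs_Re_le_cmod[of "2 - a"] by (auto simp: dist_norm)
    qed
    have "compact (hurwitz_zeta (of_nat n + 2 * \<beta>) ` cball 2 (8/5))"
      by (intro compact_continuous_image holomorphic_on_imp_continuous_on holomorphic_on_subset[OF hurwitz_zeta_holomorphic[OF not_pole'] sub]) auto
    then obtain Z where Z: "\<And>a. a \<in> cball 2 (8/5) \<Longrightarrow> cmod (hurwitz_zeta (of_nat n + 2 * \<beta>) a) \<le> Z"
      using compact_imp_bounded bounded_iff by (metis imageI)
    have "z + 1 \<in> cball 2 (8/5)" if "z \<in> disc_U" for z using that by (simp add: disc_U_def dist_norm)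
    then show ?thesis using Z by blast
  qed
  then obtain Z where Z: "\<And>n z. z \<in> disc_U \<Longrightarrow> cmod (hurwitz_zeta (of_nat n + 2 * \<beta>) (z + 1)) \<le> Z n" by metis
  define C where "C = (\<Sum>n\<le>deg. 4 ^ n * \<bar>Z n\<bar>) + (\<Sum>m. Cterm * (real m + 2/5) powr (- \<sigma>exp)) + 1"
  have s0: "0 \<le> (\<Sum>m. Cterm * (real m + 2/5) powr (- \<sigma>exp))"
    using Cterm_nonneg by (intro suminf_nonneg summable_bound) auto
  have "C > 0" unfolding C_def using s0 sum_nonneg[of "{..deg}" "\<lambda>n. 4 ^ n * \<bar>Z n\<bar>"] by auto
  moreover have "cmod (Text f z) \<le> C * snorm f" if f: "f \<in> AD" and z: "z \<in> disc_U" for f z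
  proof -
    note sn = snorm_nonneg[OF f]
    have "cmod (\<Sum>n\<le>deg. tcoef f n * hurwitz_zeta (of_nat n + 2 * \<beta>) (z + 1)) \<le> (\<Sum>n\<le>deg. (snorm f * 4 ^ n) * \<bar>Z n\<bar>)"
      using sn tcoef_bound[OF f] Z[OF z] by (intro order_trans[OF norm_sum sum_mono]) (auto simp: norm_mult intro!: mult_mono order_trans[OF _ abs_ge_self])
    moreover have "cmod (\<Sum>m. Tterm f m z) \<le> (\<Sum>m. Cterm * snorm f * (real m + 2/5) powr (- \<sigma>exp))"
      by (rule norm_suminf_le[OF Tterm_bound[OF f disc_U_Re[OF z]] summable_bound])
    moreover have "(\<Sum>m. Cterm * snorm f * (real m + 2/5) powr (- \<sigma>exp)) = snorm f * (\<Sum>m. Cterm * (real m + 2/5) powr (- \<sigma>exp))"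
      using suminf_mult[OF summable_bound[of Cterm], of "snorm f"] by (simp add: mult_ac)
    ultimately have "cmod (Text f z) \<le> (\<Sum>n\<le>deg. (snorm f * 4 ^ n) * \<bar>Z n\<bar>) + snorm f * (\<Sum>m. Cterm * (real m + 2/5) powr (- \<sigma>exp))"
      unfolding Text_def Tterm_def[symmetric] by (intro order_trans[OF norm_triangle_ineq]) linarith
    also have "(\<Sum>n\<le>deg. (snorm f * 4 ^ n) * \<bar>Z n\<bar>) = snorm f * (\<Sum>n\<le>deg. 4 ^ n * \<bar>Z n\<bar>)"
      by (simp add: sum_distrib_left mult_ac)
    also have "\<dots> + snorm f * (\<Sum>m. Cterm * (real m + 2/5) powr (- \<sigma>exp)) \<le> C * snorm f"
      unfolding C_def using sn by (simp add: algebra_simps)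
    finally show ?thesis .
  qed
  ultimately show ?thesis by blast
qed

lemma Text_lincomb:
  assumes f: "f \<in> AD" and g: "g \<in> AD" and z: "z \<in> disc_U"
  shows "Text (\<lambda>z. a * f z + b * g z) z = a * Text f z + b * Text g z"
proof -
  have t: "Tterm (\<lambda>z. a * f z + b * g z) m z = a * Tterm f m z + b * Tterm g m z" for m
    unfolding Tterm_def by (simp add: tcoef_lincomb[OF f g] sum.distrib sum_distrib_left algebra_simps)
  have s: "summable (\<lambda>m. Tterm f m z)" "summable (\<lambda>m. Tterm g m z)"
    using Tterm_summable[OF f disc_U_Re[OF z]] Tterm_summable[OF g disc_U_Re[OF z]] .
  have "(\<Sum>m. Tterm (\<lambda>z. a * f z + b * g z) m z) = a * (\<Sum>m. Tterm f m z) + b * (\<Sum>m. Tterm g m z)"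
    unfolding t using s by (simp add: suminf_add[symmetric] summable_mult suminf_mult)
  moreover have "(\<Sum>n\<le>deg. tcoef (\<lambda>z. a * f z + b * g z) n * hurwitz_zeta (of_nat n + 2 * \<beta>) (z + 1)) =
      a * (\<Sum>n\<le>deg. tcoef f n * hurwitz_zeta (of_nat n + 2 * \<beta>) (z + 1)) + b * (\<Sum>n\<le>deg. tcoef g n * hurwitz_zeta (of_nat n + 2 * \<beta>) (z + 1))"
    by (simp add: tcoef_lincomb[OF f g] sum.distrib sum_distrib_left algebra_simps)
  ultimately show ?thesis by (simp add: Text_eq distrib_left)
qed

lemma T_op_bound: "\<exists>C. op_bound T C"
proof -
  obtain C where C: "C > 0" "\<And>f z. f \<in> AD \<Longrightarrow> z \<in> disc_U \<Longrightarrow> cmod (Text f z) \<le> C * snorm f"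
    using Text_bound by blast
  have "op_bound T C" unfolding op_bound_def
  proof (intro conjI ballI allI)
    fix f assume f: "f \<in> AD"
    have "(\<lambda>z. if z \<in> cD then Text f z else 0) \<in> AD"
      by (rule AD_restrict[OF _ cD_subset_U Text_holomorphic[OF f]]) (simp add: disc_U_def)
    then show "T f \<in> AD" by (simp add: T_eq[abs_def])
    show "snorm (T f) \<le> C * snorm f"
      by (rule snorm_le) (use C(2)[OF f] cD_subset_U in \<open>auto simp: T_eq\<close>)
    fix g a b assume g: "g \<in> AD"
    show "T (\<lambda>z. a * f z + b * g z) = (\<lambda>z. a * T f z + b * T g z)"
      using Text_lincomb[OF f g] cD_subset_U by (auto simp: T_eq fun_eq_iff)
  qed (use C in auto)
  then show ?thesis by blast
qed

text \<open>The Taylor polynomials of \<open>Text f\<close> at 1 converge to it on \<open>cD\<close>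
  at a geometric rate uniform over the unit ball. So T is a norm limit of finite rank operators and
  the Fredholm alternative applies at lam \<noteq> 0.\<close>

lemma spectrum_eigenfunction:
  assumes lam: "lam \<noteq> 0" and sp: "lam \<in> op_spectrum disc_D T"
  obtains h where "h \<in> AD" "h \<noteq> (\<lambda>z. 0)" "\<And>z. T h z = lam * h z"
proof (rule ccontr)
  assume H: "\<not> thesis"
  have inj: "f = (\<lambda>z. 0)" if "f \<in> AD" "(\<lambda>z. lam * f z - T f z) = (\<lambda>z. 0)" for f
  proof (rule ccontr)
    assume "f \<noteq> (\<lambda>z. 0)"
    moreover have "T f z = lam * f z" for z using fun_cong[OF that(2), of z] by simp
    ultimately show False using that(1) H \<open>\<And>h. h \<in> AD \<Longrightarrow> h \<noteq> (\<lambda>z. 0) \<Longrightarrow> (\<And>z. T h z = lam * h z) \<Longrightarrow> thesis\<close> by blast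
  qed
  obtain CT where T: "op_bound T CT" using T_op_bound by blast
  obtain C where C: "C > 0" "\<And>f z. f \<in> AD \<Longrightarrow> z \<in> disc_U \<Longrightarrow> cmod (Text f z) \<le> C * snorm f"
    using Text_bound by blast
  \<comment> \<open>The ratio of the radius 3/2 of \<open>cD\<close> to 31/20, a radius chosen
    between 3/2 and 8/5; the factor 31 below is 1 / (1 - q).\<close>
  define q where "q = (30/31 :: real)"
  have "(\<lambda>N. C * q ^ N * 31) \<longlonglongrightarrow> C * 0 * 31"
    by (intro tendsto_mult tendsto_const LIMSEQ_power_zero) (simp add: q_def)
  then have "eventually (\<lambda>N. C * q ^ N * 31 < cmod lam) sequentially" 
    using lam by (intro order_tendstoD(2)[of _ "C * 0 * 31"]) auto
  then obtain N where N: "C * q ^ N * 31 < cmod lam" using eventually_happens'[OF sequentially_bot] by blast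
  define l where "l j f = (deriv ^^ j) (Text f) 1 / fact j" for j f
  define p where "p j z = (if z \<in> cD then (z - 1) ^ j else 0)" for j :: nat and z :: complex
  have U: "disc_U = ball 1 (8/5)" by (simp add: disc_U_def)
  have "\<exists>S. is_resolvent T lam S"
  proof (rule fredholm_alternative[OF T, of N p l "C * (\<Sum>j<N. 1 / (31/20) ^ j)" "C * q ^ N * 31"])
    show "p j \<in> AD" for j unfolding p_def[abs_def]
      by (rule AD_restrict[of UNIV]) (auto intro!: holomorphic_intros)
    show "l j (\<lambda>z. a * f z + b * g z) = a * l j f + b * l j g" if f: "f \<in> AD" and g: "g \<in> AD" for j f g a b
    proof -
      have "(deriv ^^ j) (Text (\<lambda>z. a * f z + b * g z)) 1 = (deriv ^^ j) (\<lambda>z. a * Text f z + b * Text g z) 1"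
        by (rule higher_deriv_transform_within_open[of _ disc_U])
           (use Text_lincomb[OF f g] Text_holomorphic[OF AD_lincomb[OF f g]] Text_holomorphic[OF f] Text_holomorphic[OF g]
             in \<open>auto simp: U intro!: holomorphic_intros\<close>)
      also have "\<dots> = a * (deriv ^^ j) (Text f) 1 + b * (deriv ^^ j) (Text g) 1"
        by (rule higher_deriv_lincomb[OF Text_holomorphic[OF f] Text_holomorphic[OF g]]) (auto simp: U)
      finally show ?thesis by (simp add: l_def add_divide_distrib)
    qed
    show "cmod (l j f) \<le> C * (\<Sum>j<N. 1 / (31/20) ^ j) * snorm f" if j: "j < N" and f: "f \<in> AD" for j f
    proof -
      have "cmod (l j f) \<le> C * snorm f / (31/20) ^ j" unfolding l_def
        by (rule holomorphic_coeff_bound[of _ _ "8/5"]) (use Text_holomorphic[OF f] C(2)[OF f] in \<open>auto simp: U\<close>)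
      also have "\<dots> = C * snorm f * (1 / (31/20) ^ j)" by simp
      also have "\<dots> \<le> C * snorm f * (\<Sum>j<N. 1 / (31/20) ^ j)"
        using j C(1) snorm_nonneg[OF f] by (intro mult_left_mono member_le_sum) auto
      finally show ?thesis by (simp add: mult_ac)
    qed
    show "snorm (\<lambda>z. T f z - (\<Sum>j<N. l j f * p j z)) \<le> C * q ^ N * 31 * snorm f" if f: "f \<in> AD" for f
    proof (rule snorm_le)
      fix z assume z: "z \<in> cD"
      then have z1: "cmod (z - 1) \<le> 3/2" by (simp add: cD_eq dist_norm norm_minus_commute)
      have "cmod (Text f z - (\<Sum>n<N. (deriv ^^ n) (Text f) 1 / fact n * (z - 1) ^ n)) \<le>
          C * snorm f * (cmod (z - 1) / (31/20)) ^ N / (1 - cmod (z - 1) / (31/20))"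
        by (rule holomorphic_tail_bound[of _ _ "8/5"]) (use Text_holomorphic[OF f] C(2)[OF f] z1 in \<open>auto simp: U\<close>)
      also have "\<dots> \<le> C * snorm f * q ^ N / (1 - q)"
        using z1 C(1) snorm_nonneg[OF f]
        by (intro frac_le mult_left_mono power_mono mult_nonneg_nonneg) (auto simp: q_def)
      also have "\<dots> = C * q ^ N * 31 * snorm f" by (simp add: q_def)
      finally show "cmod (T f z - (\<Sum>j<N. l j f * p j z)) \<le> C * q ^ N * 31 * snorm f"
        using z by (simp add: T_eq l_def p_def)
    qed
    show "0 \<le> C * q ^ N * 31" using C(1) by (simp add: q_def)
  qed (use N inj in auto)
  then show False using sp by (simp add: op_spectrum_iff)
qed

text \<open>The two-constants statement for \<open>Text f\<close>, rescaled. A free bound \<eta> > 0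
  stands in for \<open>snorm f\<close>, so that nothing is divided by a norm that may be 0.\<close>

lemma T_small:
  assumes "\<epsilon> > 0"
  shows "\<exists>\<delta>>0. \<forall>f\<in>AD. \<forall>\<eta>>0. snorm f \<le> \<eta> \<longrightarrow> (\<forall>x\<in>iv. cmod (T f (of_real x)) \<le> \<delta> * \<eta>) \<longrightarrow> snorm (T f) \<le> \<epsilon> * \<eta>"
proof -
  obtain C where C: "C > 0" "\<And>f z. f \<in> AD \<Longrightarrow> z \<in> disc_U \<Longrightarrow> cmod (Text f z) \<le> C * snorm f"
    using Text_bound by blast
  obtain \<delta> where d: "\<delta> > 0" "\<And>H. H holomorphic_on disc_U \<Longrightarrow> (\<forall>z\<in>disc_U. cmod (H z) \<le> 1) \<Longrightarrow>
     (\<forall>x\<in>iv. cmod (H (of_real x)) \<le> \<delta>) \<Longrightarrow> (\<forall>z\<in>cD. cmod (H z) \<le> \<epsilon> / C)"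
    using holomorphic_small_on_interval[of "\<epsilon> / C"] assms C(1) by auto
  show ?thesis
  proof (intro exI[of _ "\<delta> * C"] conjI ballI allI impI)
    show "0 < \<delta> * C" using d C by simp
    fix f \<eta> assume f: "f \<in> AD" and e: "0 < (\<eta>::real)" "snorm f \<le> \<eta>" and sm: "\<forall>x\<in>iv. cmod (T f (of_real x)) \<le> \<delta> * C * \<eta>"
    define s where "s = C * \<eta>"
    have s: "s > 0" using C e by (simp add: s_def)
    define H where "H z = Text f z / of_real s" for z
    have cH: "cmod (H z) = cmod (Text f z) / s" for z using s by (simp add: H_def norm_divide)
    have "H holomorphic_on disc_U" unfolding H_def[abs_def] using s by (intro holomorphic_intros Text_holomorphic[OF f]) auto
    moreover have "cmod (H z) \<le> 1" if "z \<in> disc_U" for z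
    proof -
      have "cmod (Text f z) \<le> s" unfolding s_def using C(2)[OF f that] e C(1) by (meson mult_left_mono order_trans less_imp_le)
      then show ?thesis unfolding cH using s by simp
    qed
    moreover have "cmod (H (of_real x)) \<le> \<delta>" if x: "x \<in> iv" for x
    proof -
      have "of_real x \<in> cD" using x by (intro of_real_in_cD) auto
      then have "cmod (Text f (of_real x)) \<le> \<delta> * C * \<eta>" using bspec[OF sm x] by (simp add: T_eq)
      then show ?thesis unfolding cH using s by (simp add: s_def divide_le_eq mult_ac)
    qed
    ultimately have "\<forall>z\<in>cD. cmod (H z) \<le> \<epsilon> / C" using d(2) by blast
    then show "snorm (T f) \<le> \<epsilon> * \<eta>"
      by (intro snorm_le) (use s C e in \<open>auto simp: T_eq cH s_def field_simps\<close>)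
  qed
qed

text \<open>Only the derivatives at 0 and the branch values in (0, 2] enter, and both are determined
  by f on \<open>iv\<close>. This is the bridge between the real operator and the disc
  algebra.\<close>

lemma L_op_eq_T:
  assumes h: "h \<in> AD" and f: "\<And>x. x \<in> iv \<Longrightarrow> f x = h (of_real x)" and z: "z \<in> iv"
  shows "L_op \<alpha> \<beta> f z = T h (of_real z)"
proof -
  note inD = iv_in_disc
  have v: "vderiv n f 0 / fact n = tcoef h n" for n
  proof -
    have "vderiv n f 0 = vderiv n (\<lambda>x. h (of_real x)) 0"
      by (rule vderiv_cong[of "iv"]) (use f in auto)
    also have "\<dots> = (deriv ^^ n) h 0"
      using vderiv_holomorphic[OF _ AD_holomorphic[OF h], of 0 n] inD[of 0] by (simp add: disc_D_def)
    finally show ?thesis by (simp add: tcoef_def)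
  qed
  have "lreg f m z = Tterm h m (of_real z)" for m
  proof -
    have "1 / (real (Suc m) + z) \<in> {0<..2}" using z by (intro branch_interval) auto
    then have "f (1 / (real (Suc m) + z)) = h (of_real (1 / (real (Suc m) + z)))"
      unfolding greaterThanAtMost_iff by (intro f iffD2[OF greaterThanLessThan_iff] conjI) linarith+
    then show ?thesis unfolding lreg_def Tterm_def taylor_def v by simp
  qed
  then show ?thesis using z inD[OF z] disc_subset_cD
    by (auto simp: L_op_eq T_eq Text_eq lsing_def v)
qed

text \<open>For Re \<beta> > 1/2 the zeta functions are themselves series, and adding them undoes
  the subtraction of the Taylor polynomial. Applied at t, this makes positivity of the operator
  visible.\<close>

lemma T_eq_series:
  assumes b: "1 < 2 * Re \<beta>" and f: "f \<in> AD" and z: "z \<in> cD"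
  shows "(\<lambda>m. (of_nat (Suc m) + z) powr (- (2 * \<beta>)) * f (1 / (of_nat (Suc m) + z))) sums T f z"
proof -
  have zU: "- (3/5) < Re z" using z cD_subset_U disc_U_Re by blast
  have "(\<lambda>m. (of_nat m + (z + 1)) powr (- (of_nat n + 2 * \<beta>))) sums hurwitz_zeta (of_nat n + 2 * \<beta>) (z + 1)" for n
    using b zU by (intro hurwitz_zeta_sums) auto
  moreover have "(of_nat m + (z + 1)) powr (- (of_nat n + 2 * \<beta>)) = (of_nat (Suc m) + z) powr (- (2 * \<beta>)) * (1 / (of_nat (Suc m) + z)) ^ n" for n m
  proof -
    define u where "u = of_nat (Suc m) + z"
    have "Re u > 0" using zU by (simp add: u_def)
    then have u0: "u \<noteq> 0" by auto
    have "u powr (- (of_nat n + 2 * \<beta>)) = u powr (- (2 * \<beta>)) * u powr (- of_nat n)"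
      unfolding powr_add[symmetric] by (simp add: algebra_simps)
    also have "u powr (- of_nat n) = (1 / u) ^ n" using u0 by (simp add: powr_minus powr_nat' power_inverse divide_inverse)
    finally show ?thesis by (simp add: u_def add_ac)
  qed
  ultimately have "(\<lambda>m. \<Sum>n\<le>deg. tcoef f n * ((of_nat (Suc m) + z) powr (- (2 * \<beta>)) * (1 / (of_nat (Suc m) + z)) ^ n))
      sums (\<Sum>n\<le>deg. tcoef f n * hurwitz_zeta (of_nat n + 2 * \<beta>) (z + 1))"
    by (intro sums_sum sums_mult) auto
  from sums_add[OF this summable_sums[OF Tterm_summable[OF f zU]]]
  have "(\<lambda>m. (\<Sum>n\<le>deg. tcoef f n * ((of_nat (Suc m) + z) powr (- (2 * \<beta>)) * (1 / (of_nat (Suc m) + z)) ^ n)) + Tterm f m z) sums Text f z"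
    unfolding Text_eq .
  moreover have "(\<Sum>n\<le>deg. tcoef f n * ((of_nat (Suc m) + z) powr (- (2 * \<beta>)) * (1 / (of_nat (Suc m) + z)) ^ n)) + Tterm f m z =
      (of_nat (Suc m) + z) powr (- (2 * \<beta>)) * f (1 / (of_nat (Suc m) + z))" for m
    unfolding Tterm_def right_diff_distrib sum_distrib_left by (simp add: mult_ac)
  ultimately show ?thesis using z by (simp add: T_eq)
qed

end

section \<open>Words of inverse branches\<close>

text \<open>
  The letter \<open>m\<close> stands for the branch \<open>z \<mapsto> 1 / (m + 1 + z)\<close>, and the head of a word is applied
  first. The denominator of the resulting Moebius map is \<open>wc w * z + wd w\<close>.
\<close>

fun wc :: "nat list \<Rightarrow> nat" and wd :: "nat list \<Rightarrow> nat" where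
  "wc [] = 0"
| "wc (m # w) = wd w"
| "wd [] = 1"
| "wd (m # w) = wc w + Suc m * wd w"

definition den :: "nat list \<Rightarrow> 'a::real_normed_field \<Rightarrow> 'a" where
  "den w z = of_nat (wc w) * z + of_nat (wd w)"

primrec phi :: "nat list \<Rightarrow> 'a::real_normed_field \<Rightarrow> 'a" where
  "phi [] z = z"
| "phi (m # w) z = phi w (1 / (of_nat (Suc m) + z))"

lemma wc_wd: "wc w \<le> wd w \<and> 1 \<le> wd w"
  by (induction w) auto

lemma wd_Cons_bounds: "Suc m * wd w \<le> wd (m # w)" "wd (m # w) \<le> 2 * (Suc m * wd w)"
  using wc_wd[of w] by auto

lemma den_0 [simp]: "den w 0 = of_nat (wd w)" by (simp add: den_def)

lemma den_Cons:
  assumes "of_nat (Suc m) + z \<noteq> 0"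
  shows "den (m # w) z = (of_nat (Suc m) + z) * den w (1 / (of_nat (Suc m) + z))"
proof -
  define u where "u = of_nat (Suc m) + z"
  have "u * (of_nat (wc w) * (1 / u) + of_nat (wd w)) = of_nat (wc w) + of_nat (wd w) * u"
    using assms[folded u_def] by (simp add: distrib_left mult.commute)
  then show ?thesis unfolding den_def u_def[symmetric] by (simp add: u_def algebra_simps)
qed

lemma of_real_den: "of_real (den w x) = den w (of_real x)" by (simp add: den_def)

lemma of_real_phi: "of_real (phi w x) = phi w (of_real x)"
  by (induction w arbitrary: x) (auto simp del: of_nat_Suc)

lemma Re_branch: "- (1/2) \<le> Re z \<Longrightarrow> 0 \<le> Re (1 / (of_nat (Suc m) + z))"
  by (simp add: Re_divide)

lemma branch_nz: "- (1/2) \<le> Re z \<Longrightarrow> of_nat (Suc m) + z \<noteq> 0"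
  by (auto simp: complex_eq_iff)

lemma Re_den: assumes "- (1/2) \<le> Re z" shows "real (wd w) / 2 \<le> Re (den w z)"
proof -
  have "real (wc w) * (- (1/2)) \<le> real (wc w) * Re z" using assms by (intro mult_left_mono) auto
  moreover have "real (wc w) \<le> real (wd w)" using wc_wd[of w] by simp
  ultimately show ?thesis by (simp add: den_def)
qed

lemma wd_pos: "0 < real (wd w)" using wc_wd[of w] by simp

lemma den_nz: "- (1/2) \<le> Re z \<Longrightarrow> den w z \<noteq> 0"
  using Re_den[of z w] wd_pos[of w] by auto

text \<open>\<open>phi w\<close> is a Moebius map with denominator \<open>den w\<close> and
  determinant (-1)^|w|. This is the usual difference formula, by an induction in which the numerator
  never has to be named.\<close>

lemma phi_diff:
  fixes z y :: complex
  assumes "- (1/2) \<le> Re z" "- (1/2) \<le> Re y"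
  shows "phi w z - phi w y = (-1) ^ length w * (z - y) / (den w z * den w y)"
  using assms
proof (induction w arbitrary: z y)
  case Nil
  then show ?case by (simp add: den_def)
next
  case (Cons m w)
  define u where "u = of_nat (Suc m) + z"
  define v where "v = of_nat (Suc m) + y"
  have u: "u \<noteq> 0" "v \<noteq> 0" using branch_nz Cons.prems by (auto simp: u_def v_def simp del: of_nat_Suc)
  have R: "- (1/2) \<le> Re (1 / u)" "- (1/2) \<le> Re (1 / v)"
    using Re_branch[OF Cons.prems(1), of m] Re_branch[OF Cons.prems(2), of m] by (auto simp: u_def v_def simp del: of_nat_Suc)
  have d: "den (m # w) z = u * den w (1 / u)" "den (m # w) y = v * den w (1 / v)"
    using den_Cons u by (auto simp: u_def v_def simp del: of_nat_Suc)
  have uv: "1 / u - 1 / v = - (z - y) / (u * v)" using u by (simp add: field_simps) (simp add: u_def v_def)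
  have "phi (m # w) z - phi (m # w) y = phi w (1 / u) - phi w (1 / v)" by (simp add: u_def v_def)
  also have "\<dots> = (-1) ^ length w * (1 / u - 1 / v) / (den w (1 / u) * den w (1 / v))" by (rule Cons.IH[OF R])
  also have "\<dots> = (-1) ^ length (m # w) * (z - y) / ((u * den w (1 / u)) * (v * den w (1 / v)))"
    unfolding uv using u den_nz[OF R(1), of w] den_nz[OF R(2), of w] by (simp add: field_simps)
  finally show ?case unfolding d .
qed

text \<open>The normal form \<open>phi w 0\<close> + \<delta> \<psi>(x) with |\<delta>| = 1 / d_w^2
  and \<psi>(x) = x / (\<kappa> x + 1), where \<kappa> = c_w / d_w is in [0, 1]: the contraction
  sits in \<delta> alone, and \<psi> ranges over a bounded family with \<psi>(0) = 0.\<close>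

lemma phi_diff_real:
  fixes x :: real
  assumes "- (1/2) \<le> x"
  shows "phi w x = phi w 0 + (-1) ^ length w / (real (wd w))\<^sup>2 * (x / (real (wc w) / real (wd w) * x + 1))"
proof -
  have d: "den w x = real (wd w) * (real (wc w) / real (wd w) * x + 1)" using wd_pos[of w] by (simp add: den_def field_simps)
  have "complex_of_real (phi w x - phi w 0) = of_real ((-1) ^ length w * x / (den w x * den w 0))"
    using phi_diff[of "of_real x" 0 w] assms by (simp add: of_real_phi of_real_den)
  then have "phi w x - phi w 0 = (-1) ^ length w * x / (den w x * den w 0)" by (simp only: of_real_eq_iff)
  then show ?thesis unfolding d by (simp add: power2_eq_square field_simps)
qed

lemma cmod_le_cD: "z \<in> cD \<Longrightarrow> - (1/2) \<le> Re z" "z \<in> cD \<Longrightarrow> cmod z \<le> 5/2"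
  using abs_Re_le_cmod[of "1 - z"] norm_triangle_ineq2[of z 1] by (auto simp: cD_eq dist_norm norm_minus_commute)

lemma cmod_den_bounds:
  assumes "z \<in> cD"
  shows "real (wd w) / 2 \<le> cmod (den w z)" "cmod (den w z) \<le> 7/2 * real (wd w)"
proof -
  show "real (wd w) / 2 \<le> cmod (den w z)"
    using Re_den[OF cmod_le_cD(1)[OF assms], of w] complex_Re_le_cmod[of "den w z"] by linarith
  have "cmod (den w z) \<le> real (wc w) * cmod z + real (wd w)"
    unfolding den_def by (rule order_trans[OF norm_triangle_ineq]) (simp add: norm_mult)
  also have "real (wc w) * cmod z \<le> real (wd w) * (5/2)"
    using wc_wd[of w] cmod_le_cD(2)[OF assms] by (intro mult_mono) auto
  finally show "cmod (den w z) \<le> 7/2 * real (wd w)" by simp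
qed

lemma phi_interval:
  assumes "x \<in> iv" shows "phi w x \<in> iv"
  using assms
proof (induction w arbitrary: x)
  case (Cons m w)
  have "1 / (real (Suc m) + x) \<in> {0<..2}" using Cons.prems by (intro branch_interval) auto
  then have "1 / (real (Suc m) + x) \<in> iv"
    unfolding greaterThanAtMost_iff by (intro iffD2[OF greaterThanLessThan_iff] conjI) linarith+
  from Cons.IH[OF this] show ?case by simp
qed simp

text \<open>Words are enumerated by \<open>list_decode\<close>, so that the results on ordinary
  series of functions apply directly; where regrouping is needed, absolute convergence leads to
  unordered sums.\<close>

definition lsum :: "(nat list \<Rightarrow> 'a::real_normed_vector) \<Rightarrow> 'a" where
  "lsum f = (\<Sum>i. f (list_decode i))"

definition lsummable :: "(nat list \<Rightarrow> real) \<Rightarrow> bool" where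
  "lsummable f \<longleftrightarrow> summable (\<lambda>i. f (list_decode i))"

lemma lsummable_iff:
  assumes "\<And>w. 0 \<le> f w" shows "lsummable f \<longleftrightarrow> f summable_on UNIV"
  unfolding lsummable_def using summable_on_UNIV_nonneg_real_iff[of "\<lambda>i. f (list_decode i)"]
    summable_on_reindex_bij_betw[OF bij_list_decode, of f] assms by simp

lemma lsummable_comparison:
  assumes "lsummable g" "\<And>w. norm (f w) \<le> g w"
  shows "summable (\<lambda>i. norm (f (list_decode i)))"
  by (rule summable_comparison_test'[OF assms(1)[unfolded lsummable_def], of 0]) (use assms(2) in auto)

text \<open>A nonempty word is a first letter and a tail, so this is Fubini for an absolutely
  summable family. It is how the operator, applied to a sum over words, gives a sum over words
  longer by one letter.\<close>

lemma lsum_Cons: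
  fixes f :: "nat list \<Rightarrow> complex"
  assumes s: "summable (\<lambda>i. norm (f (list_decode i)))"
  shows "summable (\<lambda>i. norm (f (m # list_decode i)))"
    and "(\<lambda>m. lsum (\<lambda>w. f (m # w))) sums (lsum f - f [])"
proof -
  have as: "(\<lambda>w. norm (f w)) summable_on UNIV"
    using iffD1[OF lsummable_iff, of "\<lambda>w. norm (f w)"] s unfolding lsummable_def by (simp only: norm_ge_zero)
  have sm: "summable (\<lambda>i. norm (f (m # list_decode i)))" for m
  proof -
    have "(\<lambda>w. norm (f w)) summable_on range ((#) m)" by (rule summable_on_subset_banach[OF as]) auto
    then have "((\<lambda>w. norm (f w)) \<circ> (#) m) summable_on UNIV"
      by (rule iffD1[OF summable_on_reindex, rotated]) (rule injI, simp)
    then have "lsummable (\<lambda>w. norm (f (m # w)))" by (subst lsummable_iff) (simp_all only: norm_ge_zero o_def)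
    then show ?thesis by (simp only: lsummable_def)
  qed
  then show "summable (\<lambda>i. norm (f (m # list_decode i)))" .
  have hs: "(g has_sum lsum g) UNIV" if "summable (\<lambda>i. norm (g (list_decode i)))" for g :: "nat list \<Rightarrow> complex"
  proof -
    have "((\<lambda>i. g (list_decode i)) has_sum lsum g) UNIV"
      unfolding lsum_def by (rule norm_summable_imp_has_sum[OF that summable_sums[OF summable_norm_cancel[OF that]]])
    then show ?thesis using has_sum_reindex_bij_betw[OF bij_list_decode, of g "lsum g"] by simp
  qed
  have "(f has_sum (lsum f - f [])) (UNIV - {[]})"
    by (rule has_sum_Diff[OF hs[OF s]]) (use has_sum_finite[of "{[]}" f] in auto)
  moreover have bij: "bij_betw (\<lambda>(m, w). m # w) (UNIV \<times> UNIV) (UNIV - {[]})"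
    by (rule bij_betwI[where g = "\<lambda>v. (hd v, tl v)"]) auto
  ultimately have "((\<lambda>p. f (case p of (m, w) \<Rightarrow> m # w)) has_sum (lsum f - f [])) (UNIV \<times> UNIV)"
    using has_sum_reindex_bij_betw[OF bij, of f "lsum f - f []"] by simp
  then have "((\<lambda>m. lsum (\<lambda>w. f (m # w))) has_sum (lsum f - f [])) UNIV"
    by (rule has_sum_SigmaD) (use hs[OF sm] in auto)
  then show "(\<lambda>m. lsum (\<lambda>w. f (m # w))) sums (lsum f - f [])" by (rule has_sum_imp_sums)
qed

section \<open>Summability of the word weights from the spectral radius\<close>

locale transfer_main = transfer_params +
  fixes lam :: complex
  assumes lam: "lam \<noteq> 0"
    and rad: "op_spectral_radius disc_D (transfer_op \<alpha> (of_real (Re \<beta> + \<alpha>))) < cmod lam"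
begin

abbreviation (input) tt :: real where "tt \<equiv> Re \<beta> + \<alpha>"

lemma tt: "1 < 2 * tt" using expo alpha_pos by simp

interpretation P: transfer_params \<alpha> "of_real tt"
proof
  show "complex_of_real tt \<noteq> (1 - of_nat j) / 2" for j
  proof
    assume "complex_of_real tt = (1 - of_nat j) / 2"
    then have "Re (complex_of_real tt) = Re ((1 - of_nat j) / 2)" by (rule arg_cong)
    then show False using tt by simp
  qed
  show "(1 - \<alpha>) / 2 < Re (complex_of_real tt)" using tt alpha_pos by (simp add: field_simps)
qed (rule alpha_pos)

lemma P_pos_op: "pos_op P.T"
  unfolding pos_op_def pos_fun_def
proof (intro ballI impI)
  fix f and x :: real assume f: "f \<in> AD" "\<forall>x\<in>{-1/2..5/2}. f (of_real x) \<in> \<real>\<^sub>\<ge>\<^sub>0" and x: "x \<in> {-1/2..5/2}"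
  note xD = of_real_in_cD[OF x]
  have "(\<lambda>m. (of_nat (Suc m) + of_real x) powr (- (2 * of_real tt)) * f (1 / (of_nat (Suc m) + of_real x))) sums P.T f (of_real x)"
    using P.T_eq_series[OF _ f(1) xD] tt by simp
  then show "P.T f (of_real x) \<in> \<real>\<^sub>\<ge>\<^sub>0"
  proof (rule nonneg_Reals_sums[rotated])
    fix m
    have zz: "0 < real (Suc m) + x" using x by auto
    have "1 / (real (Suc m) + x) \<in> {-1/2..5/2}"
      using branch_interval[OF x, of m] unfolding greaterThanAtMost_iff atLeastAtMost_iff by linarith
    then have "f (of_real (1 / (real (Suc m) + x))) \<in> \<real>\<^sub>\<ge>\<^sub>0" using f by blast
    moreover have "complex_of_real (real (Suc m) + x) powr of_real (- (2 * tt)) = of_real ((real (Suc m) + x) powr (- (2 * tt)))"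
      using zz by (intro powr_of_real) auto
    then have "complex_of_real (real (Suc m) + x) powr of_real (- (2 * tt)) \<in> \<real>\<^sub>\<ge>\<^sub>0" by (simp add: nonneg_Reals_of_real_iff)
    ultimately have "complex_of_real (real (Suc m) + x) powr of_real (- (2 * tt)) * f (of_real (1 / (real (Suc m) + x))) \<in> \<real>\<^sub>\<ge>\<^sub>0"
      by (rule nonneg_Reals_mult_I[rotated])
    then show "(of_nat (Suc m) + complex_of_real x) powr (- (2 * of_real tt)) * f (1 / (of_nat (Suc m) + of_real x)) \<in> \<real>\<^sub>\<ge>\<^sub>0"
      by simp
  qed
qed

text \<open>\<open>op_spectral_radius\<close> is a supremum of reals, so it can be used as an upper
  bound only once the spectrum is known to be bounded; \<open>resolvent_large\<close> gives
  this.\<close>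

lemma P_resolvent: "cmod lam \<le> cmod \<mu> \<Longrightarrow> \<exists>S. is_resolvent P.T \<mu> S"
proof (rule ccontr)
  assume m: "cmod lam \<le> cmod \<mu>" and "\<not> (\<exists>S. is_resolvent P.T \<mu> S)"
  then have sp: "\<mu> \<in> op_spectrum disc_D P.T" by (simp add: op_spectrum_iff)
  obtain C where C: "op_bound P.T C" using P.T_op_bound by blast
  have "bdd_above (norm ` op_spectrum disc_D P.T)"
  proof (rule bdd_aboveI2)
    show "norm \<nu> \<le> C" if "\<nu> \<in> op_spectrum disc_D P.T" for \<nu>
      using that resolvent_large[OF C, of \<nu>] unfolding op_spectrum_iff by (meson not_le)
  qed
  then have "cmod \<mu> \<le> op_spectral_radius disc_D P.T" unfolding op_spectral_radius_def using sp by (intro cSUP_upper) auto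
  then show False using m rad unfolding P.T_def by linarith
qed

definition bw :: "nat list \<Rightarrow> real" where
  "bw w = inverse (cmod lam) ^ length w * real (wd w) powr (- (2 * tt))"

lemma bw_nonneg: "0 \<le> bw w" by (simp add: bw_def)

text \<open>Let h be the resolvent at |lam| of the operator at t, applied to 1; it is nonnegative on
  the real interval. From |lam| h = 1 + L_t h, induction on word length bounds every finite sum of
  weights at x by |lam| h(x): the empty word accounts for the 1, and the words beginning with m for
  the m-th term of L_t h(x).\<close>

lemma lsummable_bw: "lsummable bw"
proof -
  define L where "L = cmod lam"
  have L: "L > 0" using lam by (simp add: L_def)
  obtain C where C: "op_bound P.T C" using P.T_op_bound by blast
  obtain S where S: "is_resolvent P.T (of_real L) S" "pos_op S"
    using positive_resolvent[OF C P_pos_op L] P_resolvent L_def by (metis abs_of_nonneg norm_ge_zero norm_of_real order_trans)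
  define one where "one z = (if z \<in> cD then 1 else 0 :: complex)" for z
  have one: "one \<in> AD" unfolding one_def[abs_def] by (rule AD_restrict[of UNIV]) auto
  define h where "h = S one"
  have h: "h \<in> AD" unfolding h_def using S(1) one by (auto simp: is_resolvent_def bounded_op_def)
  have eqn: "of_real L * h z - P.T h z = one z" for z
    unfolding h_def using S(1) one unfolding is_resolvent_def by (metis (no_types, lifting))
  note xD = of_real_in_cD
  have "pos_fun one" unfolding pos_fun_def one_def using xD by (simp add: complex_nonneg_Reals_iff)
  then have hp: "h (of_real x) \<in> \<real>\<^sub>\<ge>\<^sub>0" if "x \<in> {-1/2..5/2}" for x
    using S(2) one that unfolding pos_op_def pos_fun_def h_def by blast
  define hr where "hr x = Re (h (of_real x))" for x
  have hr: "0 \<le> hr x" if "x \<in> {-1/2..5/2}" for x using hp[OF that] by (simp add: hr_def complex_nonneg_Reals_iff)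
  have ser: "(\<lambda>m. (real (Suc m) + x) powr (- (2 * tt)) * hr (1 / (real (Suc m) + x))) sums (L * hr x - 1)" if x: "x \<in> {0..1}" for x
  proof -
    have x': "x \<in> {-1/2..5/2}" using x by auto
    have "(\<lambda>m. (of_nat (Suc m) + of_real x) powr (- (2 * of_real tt)) * h (1 / (of_nat (Suc m) + of_real x))) sums P.T h (of_real x)"
      using P.T_eq_series[OF _ h xD[OF x']] tt by simp
    then have "(\<lambda>m. Re ((of_nat (Suc m) + of_real x) powr (- (2 * of_real tt)) * h (1 / (of_nat (Suc m) + of_real x)))) sums Re (P.T h (of_real x))"
      by (simp add: sums_complex_iff)
    moreover have "Re ((of_nat (Suc m) + of_real x) powr (- (2 * of_real tt)) * h (1 / (of_nat (Suc m) + of_real x)))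
        = (real (Suc m) + x) powr (- (2 * tt)) * hr (1 / (real (Suc m) + x))" for m
    proof -
      have "complex_of_real (real (Suc m) + x) powr of_real (- (2 * tt)) = of_real ((real (Suc m) + x) powr (- (2 * tt)))"
        using x by (intro powr_of_real) auto
      then have "(of_nat (Suc m) + complex_of_real x) powr (- (2 * of_real tt)) = of_real ((real (Suc m) + x) powr (- (2 * tt)))" by simp
      moreover have "(1 / (of_nat (Suc m) + complex_of_real x)) = of_real (1 / (real (Suc m) + x))" by simp
      moreover have "Re (of_real a * c) = a * Re c" for a c by simp
      ultimately show ?thesis unfolding hr_def by (simp only:)
    qed
    moreover have "Re (P.T h (of_real x)) = L * hr x - 1"
    proof -
      have "P.T h (of_real x) = of_real L * h (of_real x) - 1" using eqn[of "of_real x"] xD[OF x'] by (simp add: one_def algebra_simps)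
      then show ?thesis by (simp add: hr_def)
    qed
    ultimately show ?thesis by simp
  qed
  define g where "g x w = inverse L ^ length w * den w x powr (- (2 * tt))" for x :: real and w
  have g0: "0 \<le> g x w" for x w using L by (simp add: g_def)
  have br01: "1 / (real (Suc m) + x) \<in> {0..1}" if "x \<in> {0..1}" for m x using that by (auto simp: divide_le_eq)
  have hr01: "0 \<le> (real (Suc m) + x) powr (- (2 * tt)) * hr (1 / (real (Suc m) + x))" if "x \<in> {0..1}" for m x
  proof -
    have "1 / (real (Suc m) + x) \<in> {-1/2..5/2}" using br01[OF that, of m] unfolding atLeastAtMost_iff by linarith
    then show ?thesis using hr by (intro mult_nonneg_nonneg) auto
  qed
  have gC: "g x (m # w) = inverse L * ((real (Suc m) + x) powr (- (2 * tt)) * g (1 / (real (Suc m) + x)) w)" if "x \<in> {0..1}" for x m w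
  proof -
    have p: "0 < real (Suc m) + x" using that by auto
    then have "den (m # w) x = (real (Suc m) + x) * den w (1 / (real (Suc m) + x))" by (intro den_Cons) auto
    then have "den (m # w) x powr (- (2 * tt)) = (real (Suc m) + x) powr (- (2 * tt)) * den w (1 / (real (Suc m) + x)) powr (- (2 * tt))"
      by (simp only: powr_mult)
    then show ?thesis by (simp add: g_def mult_ac)
  qed
  \<comment> \<open>The interval [0, 1] is invariant under all branches and contains 0, where the
    weights \<open>g\<close> are those of \<open>bw\<close>.\<close>
  have main: "sum (g x) F \<le> L * hr x" if "x \<in> {0..1}" "finite F" "\<And>w. w \<in> F \<Longrightarrow> length w \<le> n" for n x F
    using that
  proof (induction n arbitrary: x F)
    case 0
    have "sum (g x) F \<le> sum (g x) {[]}" using 0 g0 by (intro sum_mono2) auto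
    also have "\<dots> = 1" by (simp add: g_def den_def)
    also have "1 \<le> L * hr x"
    proof -
      have "0 \<le> L * hr x - 1"
        by (rule sums_le[OF hr01[OF 0(1)] sums_zero ser[OF 0(1)]])
      then show ?thesis by simp
    qed
    finally show ?case .
  next
    case (Suc n)
    define H where "H = hd ` (F - {[]})"
    define G where "G m = {w. m # w \<in> F}" for m
    have fH: "finite H" using Suc.prems by (simp add: H_def)
    have fG: "finite (G m)" for m
    proof -
      have "G m \<subseteq> tl ` F" by (force simp: G_def)
      then show ?thesis using Suc.prems(2) finite_surj by blast
    qed
    have "sum (g x) F \<le> sum (g x) {[]} + sum (g x) (F - {[]})"
      using g0 Suc.prems(2) by (subst sum.union_disjoint[symmetric]) (auto intro!: sum_mono2)
    also have "sum (g x) {[]} = 1" by (simp add: g_def den_def)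
    also have "sum (g x) (F - {[]}) = (\<Sum>(m, w)\<in>(SIGMA m:H. G m). g x (m # w))"
      by (rule sum.reindex_bij_witness[where j = "\<lambda>v. (hd v, tl v)" and i = "\<lambda>(m, w). m # w"])
         (auto simp: H_def G_def image_iff neq_Nil_conv)
    also have "\<dots> = (\<Sum>m\<in>H. \<Sum>w\<in>G m. g x (m # w))" using fH fG by (subst sum.Sigma) auto
    also have "\<dots> \<le> (\<Sum>m\<in>H. (real (Suc m) + x) powr (- (2 * tt)) * hr (1 / (real (Suc m) + x)))"
    proof (rule sum_mono)
      fix m
      have "(\<Sum>w\<in>G m. g x (m # w)) = inverse L * ((real (Suc m) + x) powr (- (2 * tt)) * sum (g (1 / (real (Suc m) + x))) (G m))"
        unfolding gC[OF Suc.prems(1)] sum_distrib_left ..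
      also have "\<dots> \<le> inverse L * ((real (Suc m) + x) powr (- (2 * tt)) * (L * hr (1 / (real (Suc m) + x))))"
      proof (intro mult_left_mono)
        show "sum (g (1 / (real (Suc m) + x))) (G m) \<le> L * hr (1 / (real (Suc m) + x))"
          by (rule Suc.IH[OF br01[OF Suc.prems(1)] fG]) (use Suc.prems(3) in \<open>force simp: G_def\<close>)
      qed (use L in auto)
      also have "\<dots> = (real (Suc m) + x) powr (- (2 * tt)) * hr (1 / (real (Suc m) + x))" using L by simp
      finally show "(\<Sum>w\<in>G m. g x (m # w)) \<le> (real (Suc m) + x) powr (- (2 * tt)) * hr (1 / (real (Suc m) + x))" .
    qed
    also have "\<dots> \<le> L * hr x - 1"
    proof -
      have "(\<Sum>m\<in>H. (real (Suc m) + x) powr (- (2 * tt)) * hr (1 / (real (Suc m) + x))) \<le> (\<Sum>m. (real (Suc m) + x) powr (- (2 * tt)) * hr (1 / (real (Suc m) + x)))"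
        by (rule sum_le_suminf[OF sums_summable[OF ser[OF Suc.prems(1)]] fH hr01[OF Suc.prems(1)]])
      then show ?thesis using sums_unique[OF ser[OF Suc.prems(1)]] by simp
    qed
    finally show ?case by simp
  qed
  have "bw summable_on UNIV"
  proof (rule nonneg_bdd_above_summable_on)
    show "bdd_above (sum bw ` {F. F \<subseteq> UNIV \<and> finite F})"
    proof (rule bdd_aboveI2)
      fix F :: "nat list set" assume "F \<in> {F. F \<subseteq> UNIV \<and> finite F}"
      then have fF: "finite F" by simp
      have "sum (g 0) F \<le> L * hr 0"
        by (rule main[where n = "Max (length ` F)"]) (use fF in auto)
      moreover have "g 0 w = bw w" for w by (simp add: g_def bw_def L_def)
      ultimately show "sum bw F \<le> L * hr 0" by simp
    qed
  qed (rule bw_nonneg)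
  then show ?thesis using lsummable_iff[of bw] bw_nonneg by blast
qed

end

section \<open>Sums of Taylor remainders over words\<close>

lemma iv_in_cD: "x \<in> iv \<Longrightarrow> complex_of_real x \<in> cD"
  using iv_in_disc disc_subset_cD by blast

lemma branch_iv:
  assumes "x \<in> iv" shows "1 / (real (Suc m) + x) \<in> iv"
  using phi_interval[OF assms, of "[m]"] by simp

lemma den_pos: assumes "x \<in> iv" shows "0 < den w x"
proof -
  have "real (wd w) / 2 \<le> Re (den w (complex_of_real x))" using assms by (intro Re_den) auto
  then show ?thesis using wd_pos[of w] by (simp add: of_real_den[symmetric])
qed

lemma phi_holomorphic: "phi w holomorphic_on {z. - (3/5) < Re z}"
proof (induction w)
  case Nil
  show ?case by (simp add: holomorphic_on_ident)
next
  case (Cons m w)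
  have nz: "of_nat (Suc m) + z \<noteq> 0" if "- (3/5) < Re z" for z using that by (auto simp: complex_eq_iff)
  have "(\<lambda>z. 1 / (of_nat (Suc m) + z)) holomorphic_on {z. - (3/5) < Re z}"
    using nz by (intro holomorphic_intros) auto
  moreover have "- (3/5) < Re (1 / (of_nat (Suc m) + z))" if "- (3/5) < Re z" for z
  proof -
    have "0 \<le> Re (1 / (of_nat (Suc m) + z))" using that by (simp add: Re_divide)
    then show ?thesis by linarith
  qed
  ultimately have "(\<lambda>z. phi w (1 / (of_nat (Suc m) + z))) holomorphic_on {z. - (3/5) < Re z}"
    using holomorphic_on_compose_gen[OF _ Cons.IH, of "\<lambda>z. 1 / (of_nat (Suc m) + z)"] by (auto simp: o_def)
  then show ?case by (simp add: phi.simps(2)[abs_def])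
qed

lemma taylor_holomorphic: "taylor k q x0 holomorphic_on S"
  unfolding taylor_def[abs_def] by (intro holomorphic_intros)

text \<open>\<open>phi (m # w) z\<close> is \<open>phi w\<close> at a point of modulus at most 2 /
  (m + 1), and \<open>phi w\<close> contracts by at least 2 / d_w^2 from 0 to there. At z = 0 the
  same bound controls the distance of the two expansion points.\<close>

lemma phi_Cons_dist:
  assumes z: "z \<in> cD"
  shows "cmod (phi (m # w) z - of_real (phi w 0)) \<le> 4 / (real (Suc m) * (real (wd w))\<^sup>2)"
proof -
  define y where "y = 1 / (of_nat (Suc m) + z)"
  have Rz: "- (1/2) \<le> Re z" by (rule cmod_le_cD(1)[OF z])
  have "Re y \<ge> 0" unfolding y_def by (rule Re_branch[OF Rz])
  then have Ry: "- (1/2) \<le> Re y" by linarith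
  have "real (Suc m) / 2 \<le> Re (of_nat (Suc m) + z)" using Rz by simp
  then have "real (Suc m) / 2 \<le> cmod (of_nat (Suc m) + z)" using complex_Re_le_cmod order_trans by blast
  then have "1 / cmod (of_nat (Suc m) + z) \<le> 1 / (real (Suc m) / 2)" by (intro divide_left_mono mult_pos_pos) (auto intro: order_less_le_trans[of 0 "real (Suc m) / 2"])
  then have y: "cmod y \<le> 2 / real (Suc m)" by (simp add: y_def norm_divide del: of_nat_Suc)
  have d: "real (wd w) / 2 \<le> cmod (den w y)" using Re_den[OF Ry, of w] complex_Re_le_cmod[of "den w y"] by linarith
  have "cmod (phi w y - phi w 0) = cmod y / (cmod (den w y) * real (wd w))"
    using phi_diff[OF Ry, of 0 w] by (simp add: norm_divide norm_mult norm_power)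
  also have "\<dots> \<le> (2 / real (Suc m)) / (real (wd w) / 2 * real (wd w))"
    using y d wd_pos[of w] by (intro frac_le mult_right_mono mult_pos_pos) auto
  also have "\<dots> = 4 / (real (Suc m) * (real (wd w))\<^sup>2)" by (simp add: power2_eq_square del: of_nat_Suc)
  finally show ?thesis by (simp add: y_def of_real_phi del: of_nat_Suc)
qed

lemma unit_mult_le: "cmod a \<le> 1 \<Longrightarrow> 0 \<le> b \<Longrightarrow> cmod a * b \<le> b"
  by (simp add: mult_left_le_one_le)

context transfer_main
begin

definition eterm :: "(real \<Rightarrow> complex) \<Rightarrow> nat list \<Rightarrow> real \<Rightarrow> complex" where
  "eterm q w x = inverse lam ^ length w * (of_real (den w x) powr (- (2 * \<beta>)) *
     (q (phi w x) - taylor deg q (phi w 0) (of_real (phi w x))))"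

text \<open>The factor \<sigma> weights whole levels: the constant 1 gives the sum of all E_n, the
  indicator of n gives E_n, and \<open>case_nat 0 \<sigma>\<close> shifts the levels by one. One
  recursion thus serves existence and uniqueness.\<close>

definition E :: "(nat \<Rightarrow> complex) \<Rightarrow> (real \<Rightarrow> complex) \<Rightarrow> real \<Rightarrow> complex" where
  "E \<sigma> q x = lsum (\<lambda>w. \<sigma> (length w) * eterm q w x)"

text \<open>The cost of moving the expansion point from \<open>phi w 0\<close> to
  \<open>phi v 0\<close> for v = m # w. It arises when the operator acts on the summand of w, so
  \<sigma> is taken at the length of w, not of v.\<close>

definition dterm :: "(nat \<Rightarrow> complex) \<Rightarrow> (real \<Rightarrow> complex) \<Rightarrow> nat list \<Rightarrow> complex \<Rightarrow> complex" where
  "dterm \<sigma> q v z = (case v of [] \<Rightarrow> 0 | m # w \<Rightarrow> \<sigma> (length w) * inverse lam ^ length v *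
     (den v z powr (- (2 * \<beta>)) * (taylor deg q (phi v 0) (phi v z) - taylor deg q (phi w 0) (phi v z))))"

definition dfun :: "(nat \<Rightarrow> complex) \<Rightarrow> (real \<Rightarrow> complex) \<Rightarrow> complex \<Rightarrow> complex" where
  "dfun \<sigma> q z = (if z \<in> cD then lsum (\<lambda>v. dterm \<sigma> q v z) else 0)"

definition bd :: "nat list \<Rightarrow> real" where
  "bd v = (case v of [] \<Rightarrow> 0 | m # w \<Rightarrow> bw w * real (Suc m) powr (- (2 * Re \<beta> + \<alpha>)))"

lemma bd_nonneg: "0 \<le> bd v" by (simp add: bd_def bw_nonneg split: list.split)

text \<open>A product of two convergent sums: over w by \<open>lsummable_bw\<close>, over m because
  2 Re \<beta> + \<alpha> > 1.\<close>

lemma lsummable_bd: "lsummable bd"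
proof -
  let ?s = "\<lambda>m. real (Suc m) powr (- (2 * Re \<beta> + \<alpha>))"
  have bw: "bw summable_on UNIV" using lsummable_bw lsummable_iff[of bw] bw_nonneg by blast
  have s: "?s summable_on UNIV" using summable_Suc_powr[OF expo] by (subst summable_on_UNIV_nonneg_real_iff) auto
  have "(\<lambda>p. norm (case p of (m, w) \<Rightarrow> bw w * ?s m)) summable_on Sigma UNIV (\<lambda>_. UNIV)"
  proof (rule iffD2[OF Infinite_Sum.abs_summable_on_Sigma_iff], intro conjI ballI)
    show "(\<lambda>y. norm (case (m, y) of (m, w) \<Rightarrow> bw w * ?s m)) summable_on UNIV" for m
      using summable_on_cmult_left[OF bw, of "?s m"] bw_nonneg by simp
    have "(\<lambda>m. infsum bw UNIV * ?s m) summable_on UNIV" by (rule summable_on_cmult_right[OF s])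
    then show "(\<lambda>x. norm (\<Sum>\<^sub>\<infinity>y. norm (case (x, y) of (m, w) \<Rightarrow> bw w * ?s m))) summable_on UNIV"
      using bw_nonneg infsum_nonneg[of UNIV bw] by (simp add: infsum_cmult_left' abs_mult)
  qed
  then have "(\<lambda>p. case p of (m, w) \<Rightarrow> bw w * ?s m) summable_on UNIV \<times> UNIV"
    by (rule Infinite_Sum.abs_summable_summable)
  then have "(\<lambda>p. bd (case p of (m, w) \<Rightarrow> m # w)) summable_on UNIV \<times> UNIV"
    by (simp add: bd_def case_prod_unfold)
  moreover have bij: "bij_betw (\<lambda>(m, w). m # w) (UNIV \<times> UNIV) (UNIV - {[]})"
    by (rule bij_betwI[where g = "\<lambda>v. (hd v, tl v)"]) auto
  ultimately have "bd summable_on (UNIV - {[]})" using summable_on_reindex_bij_betw[OF bij, of bd] by simp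
  then have "bd summable_on UNIV" by (rule summable_on_cong_neutral[THEN iffD1, rotated -1]) (auto simp: bd_def)
  then show ?thesis using lsummable_iff[of bd] bd_nonneg by blast
qed

definition CW :: real where
  "CW = ((1/2) powr (- (2 * Re \<beta>)) + 7 powr (- (2 * Re \<beta>))) * exp (pi * \<bar>Im (- (2 * \<beta>))\<bar>)"

text \<open>The modulus of \<open>den (m # w) z\<close> lies between N / 2 and 7 N for N = (m + 1)
  d_w. The two powers in \<open>CW\<close> cover both signs of Re \<beta>, and the exponential
  bounds the effect of Im \<beta>.\<close>

lemma weight_bound:
  assumes z: "z \<in> cD"
  shows "cmod (den (m # w) z powr (- (2 * \<beta>))) \<le> CW * (real (Suc m) * real (wd w)) powr (- (2 * Re \<beta>))"
proof -
  define N where "N = real (Suc m) * real (wd w)"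
  have N: "0 < N" using wd_pos[of w] by (simp add: N_def)
  have "real (Suc m * wd w) \<le> real (wd (m # w))" "real (wd (m # w)) \<le> real (2 * (Suc m * wd w))"
    using wd_Cons_bounds of_nat_le_iff by blast+
  then have wdN: "N \<le> real (wd (m # w))" "real (wd (m # w)) \<le> 2 * N" by (simp_all only: N_def of_nat_mult of_nat_numeral)
  have den: "N / 2 \<le> cmod (den (m # w) z)" "cmod (den (m # w) z) \<le> 7 * N"
    using cmod_den_bounds[OF z, of "m # w"] wdN by linarith+
  define \<rho> where "\<rho> = cmod (den (m # w) z) / N"
  have \<rho>: "1/2 \<le> \<rho>" "\<rho> \<le> 7" using den N by (auto simp: \<rho>_def field_simps)
  have "cmod (den (m # w) z) = \<rho> * N" using N by (simp add: \<rho>_def)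
  then have "cmod (den (m # w) z) powr (- (2 * Re \<beta>)) = \<rho> powr (- (2 * Re \<beta>)) * N powr (- (2 * Re \<beta>))"
    by (simp only: powr_mult)
  also have "\<dots> \<le> ((1/2) powr (- (2 * Re \<beta>)) + 7 powr (- (2 * Re \<beta>))) * N powr (- (2 * Re \<beta>))"
    by (intro mult_right_mono powr_between \<rho>) auto
  finally have 1: "cmod (den (m # w) z) powr (- (2 * Re \<beta>)) \<le> ((1/2) powr (- (2 * Re \<beta>)) + 7 powr (- (2 * Re \<beta>))) * N powr (- (2 * Re \<beta>))" .
  have "den (m # w) z \<noteq> 0" using den N by auto
  from cmod_powr_le[OF this, of "- (2 * \<beta>)"]
  have "cmod (den (m # w) z powr (- (2 * \<beta>))) \<le> cmod (den (m # w) z) powr (- (2 * Re \<beta>)) * exp (pi * \<bar>Im (- (2 * \<beta>))\<bar>)" by simp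
  also have "\<dots> \<le> (((1/2) powr (- (2 * Re \<beta>)) + 7 powr (- (2 * Re \<beta>))) * N powr (- (2 * Re \<beta>))) * exp (pi * \<bar>Im (- (2 * \<beta>))\<bar>)"
    using 1 by (intro mult_right_mono) auto
  finally show ?thesis unfolding CW_def N_def by (simp only: mult_ac)
qed

text \<open>Bookkeeping of exponents: the weight and the power \<alpha> of the distance combine to
  (m + 1)^(-2 Re \<beta> - \<alpha>) and d_w^(-2 Re \<beta> - 2 \<alpha>), and the latter is
  d_w^(-2t).\<close>

lemma bd_combine:
  "inverse (cmod lam) ^ length w * ((real (Suc m) * real (wd w)) powr (- (2 * Re \<beta>)) * (4 / (real (Suc m) * (real (wd w))\<^sup>2)) powr \<alpha>)
     = 4 powr \<alpha> * bd (m # w)"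
proof -
  define a where "a = real (Suc m)"
  define d where "d = real (wd w)"
  have ad: "0 < a" "0 < d" using wd_pos[of w] by (auto simp: a_def d_def)
  have "d\<^sup>2 = d powr 2" using ad by simp
  then have "(d\<^sup>2) powr \<alpha> = d powr (2 * \<alpha>)" by (simp only: powr_powr)
  then have e1: "(4 / (a * d\<^sup>2)) powr \<alpha> = 4 powr \<alpha> * (a powr (- \<alpha>) * d powr (- (2 * \<alpha>)))"
    using ad by (simp only: powr_divide powr_mult powr_minus_divide) simp
  have e2: "(a * d) powr (- (2 * Re \<beta>)) = a powr (- (2 * Re \<beta>)) * d powr (- (2 * Re \<beta>))" by (rule powr_mult)
  have e3: "a powr (- (2 * Re \<beta> + \<alpha>)) = a powr (- (2 * Re \<beta>)) * a powr (- \<alpha>)" by (simp flip: powr_add)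
  have e4: "d powr (- (2 * tt)) = d powr (- (2 * Re \<beta>)) * d powr (- (2 * \<alpha>))"
    unfolding powr_add[symmetric] by (simp add: algebra_simps)
  show ?thesis unfolding bd_def bw_def list.case a_def[symmetric] d_def[symmetric] e1 e2 e3 e4
    by (simp only: mult_ac)
qed

context
  fixes q :: "real \<Rightarrow> complex" and B :: real
  assumes qB: "C_bound deg hexp B iv False q"
begin

lemma qB_nonneg: "0 \<le> B" using C_bound_nonneg[OF qB, of 0] by simp

text \<open>In the normal form of \<open>phi w\<close> the weight is d_w^(-2 \<beta>) times a power
  of \<kappa> x + 1, and the remainder gains |\<delta>|^\<alpha> = d_w^(-2 \<alpha>). All other
  factors are bounded uniformly in w.\<close>

lemma eterm_C_bound: "\<exists>K\<ge>0. \<forall>w. C_bound deg hexp (K * bw w) iv True (eterm q w)"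
proof -
  note g = deg_hexp(2,3)
  \<comment> \<open>6 exceeds both the length 3 of \<open>iv\<close> and the bound 5 for |\<psi>|,
    which is 5/2 divided by 1/2.\<close>
  define R where "R = (6::real)"
  have R1: "1 \<le> R" by (simp add: R_def)
  have dR: "\<bar>x - y\<bar> \<le> R" if "x \<in> iv" "y \<in> iv" for x y using that by (auto simp: R_def)
  have m1: "-1 < (- 1 / 2 :: real)" by simp
  obtain C1 where C1: "0 \<le> C1" "\<And>\<kappa>. 0 \<le> \<kappa> \<Longrightarrow> \<kappa> \<le> 1 \<Longrightarrow> C_bound deg hexp C1 iv False (\<lambda>x. of_real (\<kappa> * x + 1) powr (- (2 * \<beta>)))"
    using C_bound_affine_powr[OF m1 g] by blast
  obtain C2 where C2: "0 \<le> C2" "\<And>\<kappa>. 0 \<le> \<kappa> \<Longrightarrow> \<kappa> \<le> 1 \<Longrightarrow> C_bound deg hexp C2 iv False (\<lambda>x. of_real (\<kappa> * x + 1) powr (- 2))"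
    using C_bound_affine_powr[OF m1 g] by blast
  obtain K where K: "K \<ge> 1" "\<And>\<gamma> I J p \<psi> \<psi>' B z. 0 \<le> \<gamma> \<Longrightarrow> \<gamma> \<le> 1 \<Longrightarrow> convex I \<Longrightarrow> (\<forall>x\<in>I. \<forall>y\<in>I. \<bar>x - y\<bar> \<le> R) \<Longrightarrow>
    C_bound deg \<gamma> B J z p \<Longrightarrow> \<psi> ` I \<subseteq> J \<Longrightarrow> (\<forall>x\<in>I. (\<psi> has_real_derivative \<psi>' x) (at x)) \<Longrightarrow>
    C_bound deg \<gamma> C2 I False (\<lambda>x. of_real (\<psi>' x)) \<Longrightarrow> (z \<longrightarrow> \<psi> 0 = 0) \<Longrightarrow>
    C_bound deg \<gamma> (K * B) I z (\<lambda>x. p (\<psi> x))"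
    using C_bound_compose[OF R1, of deg C2] by blast
  define Cst where "Cst = 2 * (2 * R) ^ deg * C1 * (K * (R ^ Suc deg * B))"
  have "C_bound deg hexp (Cst * bw w) iv True (eterm q w)" for w
  proof -
    define d where "d = real (wd w)"
    have d: "0 < d" using wd_pos by (simp add: d_def)
    define \<kappa> where "\<kappa> = real (wc w) / d"
    define x0 where "x0 = (phi w 0 :: real)"
    define \<delta> where "\<delta> = (-1) ^ length w / d\<^sup>2"
    have x0: "x0 \<in> iv" unfolding x0_def by (rule phi_interval) auto
    have \<delta>: "\<delta> \<noteq> 0" "\<bar>\<delta>\<bar> = 1 / d\<^sup>2" using d by (auto simp: \<delta>_def abs_mult power_abs)
    have k: "0 \<le> \<kappa>" "\<kappa> \<le> 1" using wc_wd[of w] d by (auto simp: \<kappa>_def d_def)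
    have pos: "1/2 < \<kappa> * x + 1" if "x \<in> iv" for x
    proof (cases "x \<ge> 0")
      case True then show ?thesis using k mult_nonneg_nonneg[of \<kappa> x] by linarith
    next
      case False
      then have "1 * x \<le> \<kappa> * x" using k by (intro mult_right_mono_neg) auto
      then show ?thesis using that by auto
    qed
    let ?\<psi> = "\<lambda>x. x / (\<kappa> * x + 1)"
    let ?\<psi>' = "\<lambda>x. 1 / (\<kappa> * x + 1)\<^sup>2"
    have ph: "phi w x = x0 + \<delta> * ?\<psi> x" if "x \<in> iv" for x
      unfolding x0_def \<delta>_def \<kappa>_def d_def by (rule phi_diff_real) (use that in auto)
    have dn: "den w x = d * (\<kappa> * x + 1)" for x using d by (simp add: den_def \<kappa>_def d_def field_simps)
    let ?J = "{y. x0 + \<delta> * y \<in> iv} \<inter> {-R<..<R}"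
    let ?p = "\<lambda>y. q (x0 + \<delta> * y) - taylor deg q x0 (of_real (x0 + \<delta> * y))"
    have p: "C_bound deg hexp (R ^ Suc deg * B * \<bar>\<delta>\<bar> powr \<alpha>) ?J True ?p"
      using C_bound_taylor[OF _ _ g R1 x0 \<delta>(1) qB] deg_hexp(1) by simp
    have img: "?\<psi> ` iv \<subseteq> ?J"
    proof clarify
      fix x assume x: "x \<in> iv"
      have "x0 + \<delta> * ?\<psi> x \<in> iv" using phi_interval[OF x, of w] ph[OF x] by simp
      moreover have "\<bar>?\<psi> x\<bar> < R"
      proof -
        have "\<bar>?\<psi> x\<bar> = \<bar>x\<bar> / (\<kappa> * x + 1)" using pos[OF x] by (simp add: abs_divide)
        also have "\<dots> \<le> (5/2) / (1/2)" using pos[OF x] x by (intro frac_le) auto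
        finally show ?thesis by (simp add: R_def)
      qed
      then have "?\<psi> x \<in> {-R<..<R}" unfolding greaterThanLessThan_iff by linarith
      ultimately show "?\<psi> x \<in> ?J" by blast
    qed
    have der: "\<forall>x\<in>iv. (?\<psi> has_real_derivative ?\<psi>' x) (at x)"
    proof
      fix x assume "x \<in> iv"
      then have "\<kappa> * x + 1 \<noteq> 0" using pos[of x] by linarith
      then show "(?\<psi> has_real_derivative ?\<psi>' x) (at x)"
        by (auto intro!: derivative_eq_intros simp: power2_eq_square algebra_simps)
    qed
    have psi': "C_bound deg hexp C2 iv False (\<lambda>x. of_real (?\<psi>' x))"
    proof (rule C_bound_cong[OF _ _ C2(2)[OF k]])
      fix x assume "x \<in> iv"
      then have "0 < \<kappa> * x + 1" using pos[of x] by linarith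
      then show "complex_of_real (\<kappa> * x + 1) powr (- 2) = of_real (?\<psi>' x)"
        using powr_of_real[of "\<kappa> * x + 1" "-2"] by (simp add: powr_minus_divide del: of_real_add of_real_mult)
    qed auto
    have 1: "C_bound deg hexp (K * (R ^ Suc deg * B * \<bar>\<delta>\<bar> powr \<alpha>)) iv True (\<lambda>x. ?p (?\<psi> x))"
      by (rule K(2)[OF g _ _ p img der psi']) (use dR in auto)
    have 2: "C_bound deg hexp (2 * (2 * R) ^ deg * C1 * (K * (R ^ Suc deg * B * \<bar>\<delta>\<bar> powr \<alpha>))) iv True
        (\<lambda>x. of_real (\<kappa> * x + 1) powr (- (2 * \<beta>)) * ?p (?\<psi> x))"
      using C_bound_mult[OF _ dR R1 g C1(2)[OF k] 1] by simp
    define c where "c = inverse lam ^ length w * of_real d powr (- (2 * \<beta>))"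
    have 3: "C_bound deg hexp (cmod c * (2 * (2 * R) ^ deg * C1 * (K * (R ^ Suc deg * B * \<bar>\<delta>\<bar> powr \<alpha>)))) iv True
        (\<lambda>x. c * (of_real (\<kappa> * x + 1) powr (- (2 * \<beta>)) * ?p (?\<psi> x)))"
      by (rule C_bound_cmult[OF 2])
    have e1: "cmod c = inverse (cmod lam) ^ length w * d powr (- (2 * Re \<beta>))"
      unfolding c_def norm_mult norm_power norm_inverse using cmod_of_real_powr[OF d, of "- (2 * \<beta>)"] by simp
    have e2: "\<bar>\<delta>\<bar> powr \<alpha> = d powr (- (2 * \<alpha>))"
    proof -
      have "\<bar>\<delta>\<bar> = d powr (- 2)" unfolding \<delta>(2) using d by (simp add: powr_minus_divide)
      then show ?thesis by (simp add: powr_powr)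
    qed
    have e3: "bw w = inverse (cmod lam) ^ length w * (d powr (- (2 * Re \<beta>)) * d powr (- (2 * \<alpha>)))"
      unfolding bw_def d_def by (simp add: algebra_simps flip: powr_add)
    have "cmod c * (2 * (2 * R) ^ deg * C1 * (K * (R ^ Suc deg * B * \<bar>\<delta>\<bar> powr \<alpha>))) = Cst * bw w"
      unfolding e1 e2 e3 Cst_def by (simp only: mult_ac)
    with 3 have 4: "C_bound deg hexp (Cst * bw w) iv True (\<lambda>x. c * (of_real (\<kappa> * x + 1) powr (- (2 * \<beta>)) * ?p (?\<psi> x)))"
      by simp
    show ?thesis
    proof (rule C_bound_cong[OF _ _ 4])
      fix x assume x: "x \<in> iv"
      then have "0 < \<kappa> * x + 1" using pos[of x] by linarith
      then have "of_real (den w x) powr (- (2 * \<beta>)) = of_real d powr (- (2 * \<beta>)) * of_real (\<kappa> * x + 1) powr (- (2 * \<beta>))"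
        unfolding dn using powr_times_real[of "of_real d" "of_real (\<kappa> * x + 1)" "- (2 * \<beta>)"] d by simp
      then show "c * (of_real (\<kappa> * x + 1) powr (- (2 * \<beta>)) * ?p (?\<psi> x)) = eterm q w x"
        unfolding eterm_def c_def ph[OF x, symmetric] x0_def[symmetric] by (simp only: mult.assoc)
    qed auto
  qed
  moreover have "0 \<le> Cst" unfolding Cst_def using C1(1) K(1) qB_nonneg R1 by (intro mult_nonneg_nonneg) auto
  ultimately show ?thesis by blast
qed

lemma eterm_bound: "\<exists>K\<ge>0. \<forall>w. \<forall>x\<in>iv. cmod (eterm q w x) \<le> K * bw w"
  using eterm_C_bound C_bound_norm by blast

lemma eterm_summable:
  assumes s: "\<And>n. cmod (\<sigma> n) \<le> 1" and x: "x \<in> iv"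
  shows "summable (\<lambda>i. cmod (\<sigma> (length (list_decode i)) * eterm q (list_decode i) x))"
proof -
  obtain K where K: "K \<ge> 0" "\<And>w x. x \<in> iv \<Longrightarrow> cmod (eterm q w x) \<le> K * bw w" using eterm_bound by blast
  show ?thesis
  proof (rule lsummable_comparison[of "\<lambda>w. K * bw w"])
    show "lsummable (\<lambda>w. K * bw w)" using lsummable_bw unfolding lsummable_def by (rule summable_mult)
    show "cmod (\<sigma> (length w) * eterm q w x) \<le> K * bw w" for w
      using K(2)[OF x, of w] unit_mult_le[OF s[of "length w"] norm_ge_zero[of "eterm q w x"]]
      by (simp add: norm_mult)
  qed
qed

lemma E_C_bound:
  assumes s: "\<And>n. cmod (\<sigma> n) \<le> 1"
  shows "\<exists>K. C_bound deg hexp K iv True (E \<sigma> q)"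
proof -
  obtain K where K: "K \<ge> 0" "\<And>w. C_bound deg hexp (K * bw w) iv True (eterm q w)" using eterm_C_bound by blast
  have "C_bound deg hexp (K * bw w) iv True (\<lambda>x. \<sigma> (length w) * eterm q w x)" for w
    by (rule C_bound_mono[OF C_bound_cmult[OF K(2)[of w], of "\<sigma> (length w)"]])
       (use unit_mult_le[OF s[of "length w"], of "K * bw w"] K(1) bw_nonneg in auto)
  moreover have "summable (\<lambda>i. K * bw (list_decode i))"
    using lsummable_bw unfolding lsummable_def by (rule summable_mult)
  ultimately have "C_bound deg hexp (\<Sum>i. K * bw (list_decode i)) iv True (\<lambda>x. \<Sum>i. \<sigma> (length (list_decode i)) * eterm q (list_decode i) x)"
    by (intro C_bound_suminf) auto
  then show ?thesis unfolding E_def[abs_def] lsum_def by blast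
qed

text \<open>The argument and the expansion point of v are within 4 / ((m + 1) d_w^2) of
  \<open>phi w 0\<close>, so the comparison of Taylor polynomials applies even at complex z. The
  level weight is kept in the bound so that single levels can be estimated.\<close>

lemma dterm_bound:
  "\<exists>K\<ge>0. \<forall>\<sigma> v. \<forall>z\<in>cD. cmod (dterm \<sigma> q v z) \<le> K * (cmod (\<sigma> (length v - 1)) * bd v)"
proof -
  define K where "K = inverse (cmod lam) * (CW * (2 ^ (deg + 2) * B * 4 powr \<alpha>))"
  have CW: "0 \<le> CW" by (simp add: CW_def)
  have "cmod (dterm \<sigma> q v z) \<le> K * (cmod (\<sigma> (length v - 1)) * bd v)" if z: "z \<in> cD" for \<sigma> v z
  proof (cases v)
    case Nil then show ?thesis by (simp add: dterm_def bd_def)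
  next
    case (Cons m w)
    define \<delta> where "\<delta> = 4 / (real (Suc m) * (real (wd w))\<^sup>2)"
    have "0 < \<delta>" using wd_pos[of w] by (simp add: \<delta>_def)
    have 0: "0 \<in> cD" using iv_in_cD[of 0] by simp
    have "cmod (of_real (phi (m # w) 0) - of_real (phi w 0)) \<le> \<delta>"
      using phi_Cons_dist[OF 0, of m w] by (simp add: \<delta>_def of_real_phi del: phi.simps)
    then have "\<bar>phi w 0 - phi (m # w) (0::real)\<bar> \<le> \<delta>"
      by (metis abs_minus_commute norm_of_real of_real_diff)
    moreover have "cmod (phi (m # w) z - of_real (phi w 0)) \<le> \<delta>" unfolding \<delta>_def by (rule phi_Cons_dist[OF z])
    moreover have "phi w (0::real) \<in> iv" "phi (m # w) (0::real) \<in> iv" by (rule phi_interval, simp)+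
    ultimately have "cmod (taylor deg q (phi w 0) (phi (m # w) z) - taylor deg q (phi (m # w) 0) (phi (m # w) z)) \<le> 2 ^ (deg + 2) * B * \<delta> powr \<alpha>"
      using taylor_diff_bound[OF _ _ deg_hexp(2,3) _ _ _ _ \<open>0 < \<delta>\<close> qB, of "phi w 0" "phi (m # w) 0"] deg_hexp(1) by simp
    then have t: "cmod (taylor deg q (phi (m # w) 0) (phi (m # w) z) - taylor deg q (phi w 0) (phi (m # w) z)) \<le> 2 ^ (deg + 2) * B * \<delta> powr \<alpha>"
      by (subst norm_minus_commute)
    have "cmod (dterm \<sigma> q v z) \<le> cmod (\<sigma> (length w)) * inverse (cmod lam) ^ length v *
       ((CW * (real (Suc m) * real (wd w)) powr (- (2 * Re \<beta>))) * (2 ^ (deg + 2) * B * \<delta> powr \<alpha>))"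
      unfolding dterm_def Cons list.case norm_mult norm_power norm_inverse
      by (intro mult_left_mono mult_mono weight_bound[OF z] t) (use CW in auto)
    also have "\<dots> = (inverse (cmod lam) * (CW * (2 ^ (deg + 2) * B))) * (cmod (\<sigma> (length w)) *
        (inverse (cmod lam) ^ length w * ((real (Suc m) * real (wd w)) powr (- (2 * Re \<beta>)) * \<delta> powr \<alpha>)))"
      unfolding Cons length_Cons power_Suc by (simp only: mult_ac)
    also have "\<dots> = K * (cmod (\<sigma> (length v - 1)) * bd v)"
      unfolding \<delta>_def bd_combine K_def Cons by (simp add: mult_ac)
    finally show ?thesis .
  qed
  moreover have "0 \<le> K" unfolding K_def using CW qB_nonneg by simp
  ultimately show ?thesis by blast
qed

lemma dterm_summable:
  assumes s: "\<And>n. cmod (\<sigma> n) \<le> 1" and z: "z \<in> cD"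
  shows "summable (\<lambda>i. cmod (dterm \<sigma> q (list_decode i) z))"
proof -
  obtain K where K: "K \<ge> 0" "\<And>\<sigma> v z. z \<in> cD \<Longrightarrow> cmod (dterm \<sigma> q v z) \<le> K * (cmod (\<sigma> (length v - 1)) * bd v)"
    using dterm_bound by blast
  show ?thesis
  proof (rule lsummable_comparison[of "\<lambda>w. K * bd w"])
    show "lsummable (\<lambda>w. K * bd w)" using lsummable_bd unfolding lsummable_def by (rule summable_mult)
    show "cmod (dterm \<sigma> q w z) \<le> K * bd w" for w
      by (rule order_trans[OF K(2)[OF z] mult_left_mono[OF unit_mult_le[OF s bd_nonneg] K(1)]])
  qed
qed

lemma dfun_AD:
  assumes s: "\<And>n. cmod (\<sigma> n) \<le> 1" shows "dfun \<sigma> q \<in> AD"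
proof -
  obtain K where K: "K \<ge> 0" "\<And>\<sigma> v z. z \<in> cD \<Longrightarrow> cmod (dterm \<sigma> q v z) \<le> K * (cmod (\<sigma> (length v - 1)) * bd v)"
    using dterm_bound by blast
  have "(\<lambda>z. \<Sum>i. if z \<in> cD then dterm \<sigma> q (list_decode i) z else 0) \<in> AD"
  proof (rule AD_suminf)
    show "summable (\<lambda>i. K * bd (list_decode i))" using lsummable_bd unfolding lsummable_def by (rule summable_mult)
    show "cmod (if z \<in> cD then dterm \<sigma> q (list_decode i) z else 0) \<le> K * bd (list_decode i)" if z: "z \<in> cD" for i z
      using order_trans[OF K(2)[OF z, of \<sigma> "list_decode i"] mult_left_mono[OF unit_mult_le[OF s bd_nonneg] K(1)]] z by simp
    show "(\<lambda>z. if z \<in> cD then dterm \<sigma> q (list_decode i) z else 0) \<in> AD" for i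
    proof (rule AD_restrict[OF _ cD_subset_U])
      have sub: "disc_U \<subseteq> {z. - (3/5) < Re z}" using disc_U_Re by blast
      show "dterm \<sigma> q v holomorphic_on disc_U" for v
      proof (cases v)
        case Nil then show ?thesis by (simp add: dterm_def[abs_def])
      next
        case (Cons m w)
        have ph: "phi v holomorphic_on disc_U" by (rule holomorphic_on_subset[OF phi_holomorphic sub])
        have ty: "(\<lambda>z. taylor deg q x (phi v z)) holomorphic_on disc_U" for x
          using holomorphic_on_compose[OF ph taylor_holomorphic[of deg q x]] by (simp add: o_def)
        have "den v z \<notin> \<real>\<^sub>\<le>\<^sub>0" if "z \<in> disc_U" for z
        proof (rule Re_pos_not_nonpos)
          have "real (wc v) * (- (3/5)) \<le> real (wc v) * Re z" using disc_U_Re[OF that] by (intro mult_left_mono) auto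
          moreover have "real (wc v) \<le> real (wd v)" using wc_wd[of v] by simp
          ultimately show "0 < Re (den v z)" using wd_pos[of v] by (simp add: den_def)
        qed
        then have "(\<lambda>z. den v z powr (- (2 * \<beta>))) holomorphic_on disc_U"
          unfolding den_def by (intro holomorphic_intros) auto
        then have "(\<lambda>z. \<sigma> (length w) * inverse lam ^ length v * (den v z powr (- (2 * \<beta>)) *
            (taylor deg q (phi v 0) (phi v z) - taylor deg q (phi w 0) (phi v z)))) holomorphic_on disc_U"
          by (intro holomorphic_on_mult holomorphic_on_diff holomorphic_on_const ty)
        then show ?thesis by (simp add: dterm_def[abs_def] Cons)
      qed
    qed (simp add: disc_U_def)
  qed
  moreover have "(\<lambda>z. \<Sum>i. if z \<in> cD then dterm \<sigma> q (list_decode i) z else 0) = dfun \<sigma> q"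
    by (auto simp: dfun_def lsum_def fun_eq_iff)
  ultimately show ?thesis by simp
qed

text \<open>Composing with a branch prefixes a letter to the word, while the expansion point remains
  that of the tail. Moving it to the point of the new word splits each summand into an
  \<open>eterm\<close> and a \<open>dterm\<close>.\<close>

lemma E_recursion:
  assumes s: "\<And>n. cmod (\<sigma> n) \<le> 1" and z: "z \<in> iv"
  shows "E (case_nat 0 \<sigma>) q z = inverse lam * L_op \<alpha> \<beta> (E \<sigma> q) z - dfun \<sigma> q (of_real z)"
proof -
  obtain K where EB: "C_bound deg hexp K iv True (E \<sigma> q)" using E_C_bound[of \<sigma>, OF s] by blast
  have v0: "vderiv n (E \<sigma> q) 0 = 0" if "n \<le> deg" for n
    by (rule C_bound_flat_vderiv[OF _ EB that]) auto
  have z1: "z > -1" using z by auto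
  have L1: "L_op \<alpha> \<beta> (E \<sigma> q) z = (\<Sum>m. of_real (real (Suc m) + z) powr (- (2 * \<beta>)) * E \<sigma> q (1 / (real (Suc m) + z)))"
    unfolding L_op_eq[OF z1] lsing_def lreg_def taylor_def by (simp add: v0)
  define g where "g v = (case v of [] \<Rightarrow> 0 | m # w \<Rightarrow> \<sigma> (length w) * (inverse lam ^ length w * (of_real (den v z) powr (- (2 * \<beta>)) *
     (q (phi v z) - taylor deg q (phi w 0) (of_real (phi v z))))))" for v
  have gm: "of_real (real (Suc m) + z) powr (- (2 * \<beta>)) * E \<sigma> q (1 / (real (Suc m) + z)) = lsum (\<lambda>w. g (m # w))" for m
  proof -
    define y where "y = 1 / (real (Suc m) + z)"
    have y: "y \<in> iv" unfolding y_def by (rule branch_iv[OF z])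
    have p: "0 < real (Suc m) + z" using z by auto
    have "of_real (real (Suc m) + z) powr (- (2 * \<beta>)) * (\<sigma> (length w) * eterm q w y) = g (m # w)" for w
    proof -
      have "den (m # w) z = (real (Suc m) + z) * den w y" unfolding y_def by (rule den_Cons) (use p in auto)
      then have "of_real (den (m # w) z) powr (- (2 * \<beta>)) = of_real (real (Suc m) + z) powr (- (2 * \<beta>)) * of_real (den w y) powr (- (2 * \<beta>))"
        using powr_times_real[of "of_real (real (Suc m) + z)" "of_real (den w y)" "- (2 * \<beta>)"] p den_pos[OF y, of w]
        by (simp del: of_real_add of_nat_Suc)
      moreover have "phi (m # w) z = phi w y" by (simp add: y_def)
      ultimately show ?thesis unfolding g_def list.case eterm_def by (simp only: mult_ac)
    qed
    then show ?thesis unfolding E_def lsum_def y_def[symmetric]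
      using suminf_mult[OF summable_norm_cancel[OF eterm_summable[of \<sigma>, OF s y]], of "of_real (real (Suc m) + z) powr (- (2 * \<beta>))"] by simp
  qed
  define \<sigma>' where "\<sigma>' = case_nat 0 \<sigma>"
  have s': "cmod (\<sigma>' n) \<le> 1" for n using s by (simp add: \<sigma>'_def split: nat.split)
  have split: "inverse lam * g v = \<sigma>' (length v) * eterm q v z + dterm \<sigma> q v (of_real z)" for v
  proof (cases v)
    case Nil then show ?thesis by (simp add: g_def \<sigma>'_def dterm_def)
  next
    case (Cons m w)
    have "complex_of_real (den v z) = den v (of_real z)" "complex_of_real (phi v z) = phi v (of_real z)"
      by (simp_all add: of_real_den of_real_phi)
    then show ?thesis unfolding g_def \<sigma>'_def dterm_def eterm_def Cons list.case length_Cons nat.case power_Suc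
      by (simp add: algebra_simps)
  qed
  have sg: "summable (\<lambda>i. cmod (inverse lam * g (list_decode i)))"
  proof (rule summable_comparison_test'[OF summable_add[OF eterm_summable[of \<sigma>', OF s' z] dterm_summable[of \<sigma>, OF s iv_in_cD[OF z]]], of 0])
    show "norm (cmod (inverse lam * g (list_decode i))) \<le> cmod (\<sigma>' (length (list_decode i)) * eterm q (list_decode i) z) + cmod (dterm \<sigma> q (list_decode i) (of_real z))" for i
      unfolding split by (simp add: norm_triangle_ineq)
  qed
  have sg': "summable (\<lambda>i. cmod (g (list_decode i)))"
  proof -
    have "cmod (g v) = cmod lam * cmod (inverse lam * g v)" for v using lam by (simp add: norm_mult norm_inverse)
    then show ?thesis using summable_mult[OF sg, of "cmod lam"] by simp
  qed
  have "L_op \<alpha> \<beta> (E \<sigma> q) z = lsum g - g []"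
    unfolding L1 gm using lsum_Cons(2)[OF sg'] by (simp add: sums_iff)
  then have "inverse lam * L_op \<alpha> \<beta> (E \<sigma> q) z = lsum (\<lambda>v. inverse lam * g v)"
    unfolding lsum_def using suminf_mult[OF summable_norm_cancel[OF sg'], of "inverse lam"] by (simp add: g_def)
  also have "\<dots> = E \<sigma>' q z + dfun \<sigma> q (of_real z)"
    unfolding split E_def dfun_def lsum_def using iv_in_cD[OF z]
    by (simp add: suminf_add[OF summable_norm_cancel[OF eterm_summable[of \<sigma>', OF s' z]] summable_norm_cancel[OF dterm_summable[of \<sigma>, OF s iv_in_cD[OF z]]]])
  finally show ?thesis by (simp add: \<sigma>'_def)
qed

end

end

section \<open>Solving the functional equation\<close>

text \<open>Tannery's theorem: each word has only one level, so each summand is eventually 0 in n,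
  and b dominates throughout.\<close>

lemma lsum_level_tendsto_0:
  assumes b: "lsummable b" "\<And>w. 0 \<le> b w"
  shows "(\<lambda>n. lsum (\<lambda>w. if l w = n then b w else 0)) \<longlonglongrightarrow> (0::real)"
proof -
  let ?a = "\<lambda>i n. if l (list_decode i) = n then b (list_decode i) else 0"
  have "eventually (\<lambda>n. summable (\<lambda>k. norm (?a k n))) sequentially \<and> summable (\<lambda>n. norm (0::real)) \<and>
     ((\<lambda>n. suminf (\<lambda>k. ?a k n)) \<longlongrightarrow> suminf (\<lambda>k. 0)) sequentially"
  proof (rule tannerys_theorem)
    show "(\<lambda>n. ?a k n) \<longlonglongrightarrow> 0" for k
    proof (rule tendsto_eventually)
      show "\<forall>\<^sub>F n in sequentially. ?a k n = 0"
        using eventually_gt_at_top[of "l (list_decode k)"] by eventually_elim auto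
    qed
    show "\<forall>\<^sub>F (k, n) in sequentially \<times>\<^sub>F sequentially. norm (?a k n) \<le> b (list_decode k)"
      by (rule always_eventually) (use b(2) in auto)
    show "summable (\<lambda>k. b (list_decode k))" using b(1) by (simp add: lsummable_def)
  qed simp
  then show ?thesis by (simp add: lsum_def)
qed

lemma contraction_tendsto_0:
  fixes a :: "nat \<Rightarrow> real"
  assumes a: "\<And>n. 0 \<le> a n" "\<And>n. a (Suc n) \<le> a n / 2 + t n" and t: "t \<longlonglongrightarrow> 0"
  shows "a \<longlonglongrightarrow> 0"
proof (rule LIMSEQ_I)
  fix e :: real assume e: "0 < e"
  have "eventually (\<lambda>n. t n < e / 4) sequentially" using t e by (intro order_tendstoD(2)) auto
  then obtain N where N: "\<And>n. n \<ge> N \<Longrightarrow> t n < e / 4" unfolding eventually_sequentially by blast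
  have bd: "a (N + k) \<le> e / 2 + (1/2) ^ k * a N" for k
  proof (induction k)
    case 0 then show ?case using e by simp
  next
    case (Suc k)
    have "a (N + Suc k) \<le> a (N + k) / 2 + t (N + k)" using a(2)[of "N + k"] by simp
    also have "\<dots> \<le> (e / 2 + (1/2) ^ k * a N) / 2 + e / 4" 
    proof (rule add_mono)
      show "a (N + k) / 2 \<le> (e / 2 + (1/2) ^ k * a N) / 2" using Suc by (intro divide_right_mono) auto
      show "t (N + k) \<le> e / 4" using N[of "N + k"] by simp
    qed
    finally show ?case by (simp add: field_simps)
  qed
  have "(\<lambda>k. (1/2) ^ k * a N) \<longlonglongrightarrow> 0 * a N" by (intro tendsto_mult tendsto_const LIMSEQ_power_zero) auto
  then have "eventually (\<lambda>k. (1/2) ^ k * a N < e / 2) sequentially" using e by (intro order_tendstoD(2)[of _ "0 * a N"]) auto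
  then obtain M where M: "\<And>k. k \<ge> M \<Longrightarrow> (1/2) ^ k * a N < e / 2" unfolding eventually_sequentially by blast
  show "\<exists>no. \<forall>n\<ge>no. norm (a n - 0) < e"
  proof (intro exI[of _ "N + M"] allI impI)
    fix n assume "N + M \<le> n"
    then obtain k where k: "n = N + k" "k \<ge> M" by (metis add_le_cancel_left le_add1 le_trans nat_le_iff_add)
    show "norm (a n - 0) < e" using bd[of k] M[OF k(2)] a(1)[of n] k(1) by simp
  qed
qed

lemma vderiv_zero: "vderiv n (\<lambda>x. 0) = (\<lambda>x. 0)"
  by (induction n) (simp_all add: vderiv_Suc)

lemma one_over_lt: "z > -1/2 \<Longrightarrow> 1 / (1 + z) < (2::real)"
  by (simp add: divide_less_eq)

context transfer_main
begin

text \<open>Disc algebra functions have no derivative bounds up to the boundary, hence the smaller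
  interval. It still contains 0 and all branch values of \<open>iv\<close>, which lie in (0,
  2).\<close>

lemma AD_C_bound:
  assumes h: "h \<in> AD"
  obtains B where "C_bound deg hexp B {-(1/4)<..<9/4} False (\<lambda>x. h (of_real x))"
proof -
  have "complex_of_real ` {-(1/4)..9/4} \<subseteq> disc_D" using iv_in_disc by force
  from C_bound_holomorphic[OF open_disc AD_holomorphic[OF h] this deg_hexp(2,3)] show ?thesis using that by blast
qed

lemma A_map_eq_iff:
  assumes f: "f \<in> C_alpha \<alpha>" and q: "q \<in> C_alpha \<alpha>"
  shows "A_map lam \<beta> \<alpha> f = q \<longleftrightarrow> (\<forall>z>-1. f z = q z + inverse lam * L_op \<alpha> \<beta> f z)"
proof -
  have "f z = 0" "q z = 0" "L_op \<alpha> \<beta> f z = 0" if "\<not> z > -1" for z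
    using f q that L_op_out[OF that] by (auto simp: C_alpha_def)
  then show ?thesis unfolding A_map_def fun_eq_iff by (metis (no_types, lifting) add_diff_cancel_right' diff_add_cancel diff_zero mult_zero_right)
qed

text \<open>The right-hand side at z uses f only near 0 and on (0, 1 / (1 + z)]. For z > -1/2 these
  values are below 2 and f0 suffices; the resulting F0 on the half-line above -1/2 then suffices for
  every z > -1.\<close>

lemma extend_solution:
  assumes q: "q \<in> C_alpha \<alpha>" and f0: "C_bound deg hexp B {-(1/4)<..<9/4} False f0"
    and eq: "\<And>x. x \<in> iv \<Longrightarrow> f0 x = q x + inverse lam * L_op \<alpha> \<beta> f0 x"
  obtains F where "F \<in> C_alpha \<alpha>" "A_map lam \<beta> \<alpha> F = q" "\<And>x. x \<in> iv \<Longrightarrow> F x = f0 x"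
proof -
  define F0 where "F0 z = (if z > -1/2 then q z + inverse lam * L_op \<alpha> \<beta> f0 z else 0)" for z
  define F where "F z = (if z > -1 then q z + inverse lam * L_op \<alpha> \<beta> F0 z else 0)" for z
  have F0iv: "F0 x = f0 x" if "x \<in> iv" for x using eq[OF that] that by (simp add: F0_def)
  have F0B: "\<exists>B. C_bound deg hexp B {-1/2<..<b} False F0" for b
  proof -
    obtain B1 where B1: "C_bound deg hexp B1 {-1/2<..<b} False (L_op \<alpha> \<beta> f0)"
      using L_op_C_bound[OF _ _ f0, of "-1/2" b] by auto
    obtain B2 where B2: "C_bound deg hexp B2 {-1/2<..<b} False q" using C_alpha_C_bound[OF q, of "-1/2"] by auto
    have "C_bound deg hexp (B2 + cmod (inverse lam) * B1) {-1/2<..<b} False F0"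
      by (rule C_bound_cong[OF _ _ C_bound_add[OF B2 C_bound_cmult[OF B1]]]) (auto simp: F0_def)
    then show ?thesis by blast
  qed
  have F0F: "F z = F0 z" if z: "z > -1/2" for z
  proof -
    have "L_op \<alpha> \<beta> F0 z = L_op \<alpha> \<beta> f0 z"
      by (rule L_op_cong[of "1/2" "5/2"]) (use F0iv z one_over_lt[OF z] in auto)
    then show ?thesis using z by (simp add: F_def F0_def)
  qed
  have FA: "F \<in> C_alpha \<alpha>"
  proof (rule C_alphaI)
    show "F x = 0" if "\<not> x > -1" for x using that by (simp add: F_def)
    fix a b :: real assume ab: "-1 < a" "a < b"
    define c where "c = 1 / (1 + a) + 1"
    have c: "c > 0" "1 / c - 1 < a"
    proof -
      have "0 < 1 / (1 + a)" using ab by simp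
      then show "c > 0" unfolding c_def by linarith
      have "1 / c < 1 / (1 / (1 + a))"
        using \<open>0 < 1 / (1 + a)\<close> \<open>c > 0\<close> by (intro divide_strict_left_mono mult_pos_pos) (auto simp: c_def)
      then show "1 / c - 1 < a" by simp
    qed
    obtain B0 where B0: "C_bound deg hexp B0 {-(1/2)<..<c} False F0" using F0B[of c] by auto
    obtain B1 where B1: "C_bound deg hexp B1 {a<..<b} False (L_op \<alpha> \<beta> F0)"
      using L_op_C_bound[OF _ c(1) B0 c(2)] by auto
    obtain B2 where B2: "C_bound deg hexp B2 {a<..<b} False q" using C_alpha_C_bound[OF q ab(1)] .
    have "C_bound deg hexp (B2 + cmod (inverse lam) * B1) {a<..<b} False F"
      by (rule C_bound_cong[OF _ _ C_bound_add[OF B2 C_bound_cmult[OF B1]]]) (use ab in \<open>auto simp: F_def\<close>)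
    then show "\<exists>B. C_bound deg hexp B {a<..<b} False F" by blast
  qed
  have "F z = q z + inverse lam * L_op \<alpha> \<beta> F z" if z: "z > -1" for z
  proof -
    have "0 < 1 / (1 + z)" using z by simp
    then have "0 < 1 / (1 + z) + 1" by linarith
    then have "L_op \<alpha> \<beta> F z = L_op \<alpha> \<beta> F0 z"
      by (rule L_op_cong[rotated, where \<epsilon> = "1/2"]) (use F0F z in auto)
    then show ?thesis using z by (simp add: F_def)
  qed
  then have "A_map lam \<beta> \<alpha> F = q" using A_map_eq_iff[OF FA q] by blast
  then show ?thesis using that FA F0F F0iv by auto
qed

text \<open>Index 0 of the enumeration is the empty word, whose summand is the remainder of q at 0;
  the rest is the shifted sum that \<open>E_recursion\<close> computes.\<close>

lemma E_one_split:
  assumes q: "C_bound deg hexp B iv False q" and x: "x \<in> iv"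
  shows "E (\<lambda>_. 1) q x = q x - taylor deg q 0 (of_real x) + E (case_nat 0 (\<lambda>_. 1)) q x"
proof -
  let ?\<sigma> = "\<lambda>_::nat. 1::complex"
  have s: "summable (\<lambda>i. ?\<sigma> (length (list_decode i)) * eterm q (list_decode i) x)"
    by (rule summable_norm_cancel[OF eterm_summable[OF q _ x]]) simp
  have s': "summable (\<lambda>i. case_nat 0 ?\<sigma> (length (list_decode i)) * eterm q (list_decode i) x)"
    by (rule summable_norm_cancel[OF eterm_summable[OF q _ x]]) (simp split: nat.split)
  have ne: "list_decode (Suc i) \<noteq> []" for i by (metis list_decode_inverse list_encode.simps(1) nat.distinct(1))
  have "case_nat 0 ?\<sigma> (length (list_decode (Suc i))) = ?\<sigma> (length (list_decode (Suc i)))" for i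
    using ne[of i] by (cases "list_decode (Suc i)") (auto simp del: list_decode.simps)
  then have "(\<Sum>i. case_nat 0 ?\<sigma> (length (list_decode (Suc i))) * eterm q (list_decode (Suc i)) x) = (\<Sum>i. ?\<sigma> (length (list_decode (Suc i))) * eterm q (list_decode (Suc i)) x)"
    by (simp only:)
  moreover have "eterm q [] x = q x - taylor deg q 0 (of_real x)" by (simp add: eterm_def den_def)
  moreover have "list_decode 0 = []" "length ([] :: nat list) = 0" by auto
  ultimately show ?thesis unfolding E_def lsum_def
    using suminf_split_head[OF s] suminf_split_head[OF s'] by (simp del: list_decode.simps(2))
qed

definition lev :: "nat \<Rightarrow> nat \<Rightarrow> complex" where "lev n l = (if l = n then 1 else 0)"

lemma lev_le: "cmod (lev n l) \<le> 1" by (simp add: lev_def)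

lemma case_nat_lev: "case_nat 0 (lev n) = lev (Suc n)"
  by (rule ext) (simp add: lev_def split: nat.split)

lemma E_lev_0: "E (lev 0) q x = q x - taylor deg q 0 (of_real x)"
proof -
  have ne: "list_decode (Suc i) \<noteq> []" for i by (metis list_decode_inverse list_encode.simps(1) nat.distinct(1))
  have "(\<Sum>i. lev 0 (length (list_decode i)) * eterm q (list_decode i) x) = (\<Sum>i\<in>{0}. lev 0 (length (list_decode i)) * eterm q (list_decode i) x)"
  proof (rule suminf_finite)
    fix i :: nat assume "i \<notin> {0}"
    then obtain j where "i = Suc j" by (cases i) auto
    then show "lev 0 (length (list_decode i)) * eterm q (list_decode i) x = 0" using ne[of j] by (simp add: lev_def del: list_decode.simps)
  qed simp
  then show ?thesis by (simp add: E_def lsum_def lev_def eterm_def den_def)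
qed

lemma taylor_AD: "(\<lambda>z. if z \<in> cD then taylor k q x0 z else 0) \<in> AD"
  by (rule AD_restrict[of UNIV]) (auto intro: taylor_holomorphic)

lemma solution_exists:
  assumes S: "is_resolvent T lam S" and q: "q \<in> C_alpha \<alpha>"
  obtains f where "f \<in> C_alpha \<alpha>" "A_map lam \<beta> \<alpha> f = q"
proof -
  obtain B where qB: "C_bound deg hexp B iv False q" using C_alpha_C_bound[OF q, of "-1/2"] by auto
  define e where "e = E (\<lambda>_. 1) q"
  obtain Ke where eB: "C_bound deg hexp Ke iv True e" using E_C_bound[OF qB, of "\<lambda>_. 1"] unfolding e_def by auto
  define d where "d = dfun (\<lambda>_. 1) q"
  have d: "d \<in> AD" unfolding d_def by (rule dfun_AD[OF qB]) simp
  define a where "a = (\<lambda>z. (if z \<in> cD then taylor deg q 0 z else 0) + d z)"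
  have a: "a \<in> AD" unfolding a_def by (rule AD_add[OF taylor_AD d])
  obtain CT where CT: "op_bound T CT" using T_op_bound by blast
  \<comment> \<open>The factor lam turns the resolvent of T at lam into the inverse of 1 -
    M.\<close>
  define h where "h = (\<lambda>z. lam * S a z)"
  have Sa: "S a \<in> AD" using S a by (auto simp: is_resolvent_def bounded_op_def)
  have h: "h \<in> AD" unfolding h_def by (rule AD_cmult[OF Sa])
  have ha: "h z = a z + inverse lam * T h z" for z
  proof -
    have "lam * S a z - T (S a) z = a z" using S a unfolding is_resolvent_def by (metis (no_types, lifting))
    then show ?thesis using op_cmult[OF CT Sa, of lam] lam by (simp add: h_def algebra_simps)
  qed
  obtain Bh where hB: "C_bound deg hexp Bh {-(1/4)<..<9/4} False (\<lambda>x. h (of_real x))" using AD_C_bound[OF h] .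
  have eB': "C_bound deg hexp Ke {-(1/4)<..<9/4} False e" by (rule C_bound_mono[OF eB]) auto
  let ?f0 = "\<lambda>x. e x + 1 * h (of_real x)"
  have f0B: "C_bound deg hexp (Ke + Bh) {-(1/4)<..<9/4} False ?f0" using C_bound_add[OF eB' hB] by simp
  have "?f0 x = q x + inverse lam * L_op \<alpha> \<beta> ?f0 x" if x: "x \<in> iv" for x
  proof -
    have "L_op \<alpha> \<beta> ?f0 x = L_op \<alpha> \<beta> e x + 1 * L_op \<alpha> \<beta> (\<lambda>x. h (of_real x)) x"
      by (rule L_op_lincomb[OF _ _ eB' hB]) (use x one_over_lt[of x] in auto)
    moreover have "L_op \<alpha> \<beta> (\<lambda>x. h (of_real x)) x = T h (of_real x)" by (rule L_op_eq_T[OF h _ x]) simp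
    moreover have "e x = q x - taylor deg q 0 (of_real x) + (inverse lam * L_op \<alpha> \<beta> e x - d (of_real x))"
      unfolding e_def d_def E_recursion[OF qB _ x, of "\<lambda>_. 1", simplified, symmetric] by (rule E_one_split[OF qB x])
    moreover have "a (of_real x) = taylor deg q 0 (of_real x) + d (of_real x)" using iv_in_cD[OF x] by (simp add: a_def)
    ultimately show ?thesis using ha[of "of_real x"] by (simp add: algebra_simps)
  qed
  from extend_solution[OF q f0B this] show ?thesis using that by blast
qed

lemma solution_unique:
  assumes S: "is_resolvent T lam S" and f: "f \<in> C_alpha \<alpha>" and A0: "A_map lam \<beta> \<alpha> f = (\<lambda>z. 0)"
  shows "f = (\<lambda>z. 0)"
proof -
  define L where "L = cmod lam"
  have L: "0 < L" using lam by (simp add: L_def)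
  obtain CT where CT: "op_bound T CT" using T_op_bound by blast
  obtain CS where CS: "op_bound S CS" using S bounded_op_imp_op_bound unfolding is_resolvent_def by blast
  have z0: "(\<lambda>z. 0) \<in> C_alpha \<alpha>" using A_map_C_alpha[OF f, of lam] A0 by simp
  have feq: "f z = inverse lam * L_op \<alpha> \<beta> f z" if "z > -1" for z
    using A_map_eq_iff[OF f z0] A0 that by simp
  obtain B where fB: "C_bound deg hexp B iv False f" using C_alpha_C_bound[OF f, of "-1/2"] by auto
  obtain KE where KE: "KE \<ge> 0" "\<And>w x. x \<in> iv \<Longrightarrow> cmod (eterm f w x) \<le> KE * bw w" using eterm_bound[OF fB] by blast
  obtain KD where KD: "KD \<ge> 0" "\<And>\<sigma> v z. z \<in> cD \<Longrightarrow> cmod (dterm \<sigma> f v z) \<le> KD * (cmod (\<sigma> (length v - 1)) * bd v)"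
    using dterm_bound[OF fB] by blast
  define s where "s n = lsum (\<lambda>w. if length w = n then KE * bw w else 0)" for n
  define r where "r n = lsum (\<lambda>v. if length v - 1 = n then KD * bd v else 0)" for n
  have sl: "lsummable (\<lambda>w. KE * bw w)" "lsummable (\<lambda>w. KD * bd w)"
    using lsummable_bw lsummable_bd unfolding lsummable_def by (auto intro: summable_mult)
  have s0: "s \<longlonglongrightarrow> 0" unfolding s_def by (rule lsum_level_tendsto_0[OF sl(1)]) (use KE bw_nonneg in auto)
  have r0: "r \<longlonglongrightarrow> 0" unfolding r_def by (rule lsum_level_tendsto_0[OF sl(2)]) (use KD bd_nonneg in auto)
  define En where "En n = E (lev n) f" for n
  define d where "d n = dfun (lev n) f" for n
  have dA: "d n \<in> AD" for n unfolding d_def by (rule dfun_AD[OF fB lev_le])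
  have Ele: "cmod (En n x) \<le> s n" if x: "x \<in> iv" for n x
    unfolding En_def E_def s_def lsum_def
  proof (rule norm_suminf_le)
    show "cmod (lev n (length (list_decode i)) * eterm f (list_decode i) x) \<le> (if length (list_decode i) = n then KE * bw (list_decode i) else 0)" for i
      using KE(2)[OF x] by (simp add: lev_def)
    show "summable (\<lambda>i. if length (list_decode i) = n then KE * bw (list_decode i) else 0)"
      by (rule summable_comparison_test'[OF sl(1)[unfolded lsummable_def], of 0]) (use KE bw_nonneg in auto)
  qed
  have dle: "snorm (d n) \<le> r n" for n
  proof (rule snorm_le)
    fix z assume z: "z \<in> cD"
    have "cmod (\<Sum>i. dterm (lev n) f (list_decode i) z) \<le> (\<Sum>i. if length (list_decode i) - 1 = n then KD * bd (list_decode i) else 0)"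
    proof (rule norm_suminf_le)
      show "cmod (dterm (lev n) f (list_decode i) z) \<le> (if length (list_decode i) - 1 = n then KD * bd (list_decode i) else 0)" for i
        using KD(2)[OF z, of "lev n" "list_decode i"] by (simp add: lev_def split: if_splits)
      show "summable (\<lambda>i. if length (list_decode i) - 1 = n then KD * bd (list_decode i) else 0)"
        by (rule summable_comparison_test'[OF sl(2)[unfolded lsummable_def], of 0]) (use KD bd_nonneg in auto)
    qed
    then show "cmod (d n z) \<le> r n" using z by (simp add: d_def dfun_def r_def lsum_def)
  qed
  have EB: "\<exists>K. C_bound deg hexp K iv False (En n)" for n
    using E_C_bound[OF fB, of "lev n", OF lev_le] C_bound_mono[of deg hexp _ iv True "En n" _ iv False] unfolding En_def by blast
  \<comment> \<open>G is built in the disc algebra from the recursion, because f - E_n is a function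
    of a real variable; \<open>Geq\<close> identifies the two on \<open>iv\<close>.\<close>
  define G where "G = rec_nat (\<lambda>z. if z \<in> cD then taylor deg f 0 z else 0) (\<lambda>n g z. inverse lam * T g z + d n z)"
  have G0: "G 0 = (\<lambda>z. if z \<in> cD then taylor deg f 0 z else 0)" and GS: "G (Suc n) = (\<lambda>z. inverse lam * T (G n) z + d n z)" for n
    by (auto simp: G_def)
  have GA: "G n \<in> AD" for n
  proof (induction n)
    case 0 show ?case unfolding G0 by (rule taylor_AD)
  next
    case (Suc n) show ?case unfolding GS by (rule AD_add[OF AD_cmult[OF op_in[OF CT Suc]] dA])
  qed
  have Geq: "G n (of_real x) = f x - En n x" if x: "x \<in> iv" for n x
    using x
  proof (induction n arbitrary: x)
    case 0
    then show ?case using iv_in_cD[OF 0] by (simp add: G0 En_def E_lev_0)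
  next
    case (Suc n)
    obtain K where K: "C_bound deg hexp K iv False (En n)" using EB by blast
    have K': "C_bound deg hexp K {-(1/2)<..<5/2} False (En n)" and fB': "C_bound deg hexp B {-(1/2)<..<5/2} False f"
      using K fB by auto
    have "L_op \<alpha> \<beta> (\<lambda>x. f x + (-1) * En n x) x = T (G n) (of_real x)"
      by (rule L_op_eq_T[OF GA _ Suc.prems]) (simp add: Suc.IH)
    moreover have "L_op \<alpha> \<beta> (\<lambda>x. f x + (-1) * En n x) x = L_op \<alpha> \<beta> f x + (-1) * L_op \<alpha> \<beta> (En n) x"
      by (rule L_op_lincomb[OF _ _ fB' K']) (use Suc.prems one_over_lt[of x] in auto)
    ultimately have e1: "T (G n) (of_real x) = L_op \<alpha> \<beta> f x + (-1) * L_op \<alpha> \<beta> (En n) x" by (simp only:)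
    have e2: "En (Suc n) x = inverse lam * L_op \<alpha> \<beta> (En n) x - d n (of_real x)"
      using E_recursion[OF fB _ Suc.prems, of "lev n", OF lev_le] unfolding En_def d_def case_nat_lev .
    have e3: "f x = inverse lam * L_op \<alpha> \<beta> f x" by (rule feq) (use Suc.prems in auto)
    have "G (Suc n) (of_real x) = inverse lam * L_op \<alpha> \<beta> f x - (inverse lam * L_op \<alpha> \<beta> (En n) x - d n (of_real x))"
      unfolding GS e1 by (simp add: algebra_simps)
    then show ?case by (simp only: e2 e3[symmetric])
  qed
  \<comment> \<open>The differences are what is known to be small: on \<open>iv\<close> the function
    u_n equals E_n - E_(n+1). Their recursion has the small forcing term d_(n+1) - d_n.\<close>
  define u where "u n = (\<lambda>z. G (Suc n) z - G n z)" for n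
  have uA: "u n \<in> AD" for n unfolding u_def by (rule AD_diff[OF GA GA])
  have ux: "cmod (u n (of_real x)) \<le> s n + s (Suc n)" if x: "x \<in> iv" for n x
  proof -
    have "u n (of_real x) = En n x - En (Suc n) x" by (simp add: u_def Geq[OF x])
    then show ?thesis using Ele[OF x, of n] Ele[OF x, of "Suc n"] norm_triangle_ineq4[of "En n x" "En (Suc n) x"] by simp
  qed
  have uS: "u (Suc n) z = inverse lam * T (u n) z + (d (Suc n) z - d n z)" for n z
    unfolding u_def op_diff[OF CT GA GA] GS[of "Suc n"] by (subst GS[of n]) (simp add: algebra_simps)
  have rn: "0 \<le> r n" for n using order_trans[OF snorm_nonneg[OF dA] dle] .
  have dz: "cmod (d n z) \<le> r n" for n z by (rule AD_le[OF dA dle rn])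
  \<comment> \<open>Solving the recursion of u for T u_n bounds it on \<open>iv\<close> by
    quantities that tend to 0.\<close>
  define \<rho> where "\<rho> n = L * (s (Suc n) + s (Suc (Suc n)) + (r (Suc n) + r n))" for n
  have sn: "0 \<le> s n" for n using order_trans[OF norm_ge_zero Ele[of 0 n]] by simp
  have rho0: "0 \<le> \<rho> n" for n using sn rn L by (simp add: \<rho>_def)
  have Tux: "cmod (T (u n) (of_real x)) \<le> \<rho> n" if x: "x \<in> iv" for n x
  proof -
    have "T (u n) (of_real x) = lam * (u (Suc n) (of_real x) - (d (Suc n) (of_real x) - d n (of_real x)))"
      unfolding uS using lam by simp
    then have "cmod (T (u n) (of_real x)) = L * cmod (u (Suc n) (of_real x) - (d (Suc n) (of_real x) - d n (of_real x)))"
      by (simp add: norm_mult L_def)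
    also have "\<dots> \<le> \<rho> n" unfolding \<rho>_def
    proof (rule mult_left_mono)
      show "cmod (u (Suc n) (of_real x) - (d (Suc n) (of_real x) - d n (of_real x))) \<le> s (Suc n) + s (Suc (Suc n)) + (r (Suc n) + r n)"
        using ux[OF x, of "Suc n"] dz[of "Suc n" "of_real x"] dz[of n "of_real x"]
          norm_triangle_ineq4[of "u (Suc n) (of_real x)" "d (Suc n) (of_real x) - d n (of_real x)"]
          norm_triangle_ineq4[of "d (Suc n) (of_real x)" "d n (of_real x)"] by linarith
    qed (use L in simp)
    finally show ?thesis .
  qed
  \<comment> \<open>The choice |lam| / 2 makes T u_n / lam contribute at most half of \<eta>, which
    yields a contraction by 1/2 up to errors.\<close>
  obtain \<delta> where dl: "\<delta> > 0" "\<And>f \<eta>. f \<in> AD \<Longrightarrow> \<eta> > 0 \<Longrightarrow> snorm f \<le> \<eta> \<Longrightarrow> (\<forall>x\<in>iv. cmod (T f (of_real x)) \<le> \<delta> * \<eta>) \<Longrightarrow> snorm (T f) \<le> (L / 2) * \<eta>"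
    using T_small[of "L / 2"] L by auto
  \<comment> \<open>The summand 1 / (n + 1) keeps the \<eta> below positive, as
    \<open>T_small\<close> requires.\<close>
  define t where "t n = (\<rho> n / \<delta> + inverse (real (Suc n))) / 2 + (r (Suc n) + r n)" for n
  have "snorm (u (Suc n)) \<le> snorm (u n) / 2 + t n" for n
  proof (rule snorm_le)
    fix z assume z: "z \<in> cD"
    define \<eta> where "\<eta> = snorm (u n) + \<rho> n / \<delta> + inverse (real (Suc n))"
    have rd: "0 \<le> \<rho> n / \<delta>" using rho0 dl by simp
    have ip: "0 < inverse (real (Suc n))" by simp
    have \<eta>: "0 < \<eta>" "snorm (u n) \<le> \<eta>" unfolding \<eta>_def using snorm_nonneg[OF uA[of n]] rd ip by linarith+
    have "\<rho> n / \<delta> \<le> \<eta>" unfolding \<eta>_def using snorm_nonneg[OF uA[of n]] ip by linarith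
    then have "\<rho> n \<le> \<delta> * \<eta>" using dl(1) by (simp add: divide_le_eq mult.commute)
    then have "\<forall>x\<in>iv. cmod (T (u n) (of_real x)) \<le> \<delta> * \<eta>" using Tux order_trans by blast
    then have "snorm (T (u n)) \<le> (L / 2) * \<eta>" by (rule dl(2)[OF uA \<eta>])
    then have "cmod (T (u n) z) \<le> (L / 2) * \<eta>" using AD_le_snorm[OF op_in[OF CT uA] z, of n] by linarith
    then have "inverse L * cmod (T (u n) z) \<le> inverse L * ((L / 2) * \<eta>)" using L by (intro mult_left_mono) auto
    also have "\<dots> = \<eta> / 2" using L by simp
    finally have "cmod (inverse lam * T (u n) z) \<le> \<eta> / 2" by (simp add: norm_mult norm_inverse L_def)
    then have "cmod (u (Suc n) z) \<le> \<eta> / 2 + (r (Suc n) + r n)"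
      unfolding uS using dz[of "Suc n" z] dz[of n z] norm_triangle_ineq[of "inverse lam * T (u n) z" "d (Suc n) z - d n z"]
        norm_triangle_ineq4[of "d (Suc n) z" "d n z"] by linarith
    then show "cmod (u (Suc n) z) \<le> snorm (u n) / 2 + t n" unfolding \<eta>_def t_def by argo
  qed
  moreover have "t \<longlonglongrightarrow> 0"
  proof -
    have 1: "(\<lambda>n. \<rho> n) \<longlonglongrightarrow> L * (0 + 0 + (0 + 0))" unfolding \<rho>_def
      by (intro tendsto_mult tendsto_add tendsto_const LIMSEQ_Suc[OF s0] LIMSEQ_Suc[OF LIMSEQ_Suc[OF s0]] LIMSEQ_Suc[OF r0] r0)
    have "t \<longlonglongrightarrow> (L * (0 + 0 + (0 + 0)) / \<delta> + 0) / 2 + (0 + 0)" unfolding t_def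
      by (intro tendsto_add tendsto_divide tendsto_const 1 LIMSEQ_inverse_real_of_nat LIMSEQ_Suc[OF r0] r0) (use dl in auto)
    then show ?thesis by simp
  qed
  ultimately have u0: "(\<lambda>n. snorm (u n)) \<longlonglongrightarrow> 0" by (intro contraction_tendsto_0[of "\<lambda>n. snorm (u n)" t]) (use snorm_nonneg[OF uA] in auto)
  \<comment> \<open>By its recursion G_n - M G_n = d_n - u_n, so the resolvent bounds G_n by
    quantities that tend to 0.\<close>
  have GN: "snorm (G n) \<le> CS * (L * (r n + snorm (u n)))" for n
  proof -
    define g where "g = (\<lambda>z. lam * (d n z - u n z))"
    have gA: "g \<in> AD" unfolding g_def by (rule AD_cmult[OF AD_diff[OF dA uA]])
    have "g = (\<lambda>z. lam * G n z - T (G n) z)"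
    proof
      fix z
      have "d n z - u n z = G n z - inverse lam * T (G n) z" by (simp add: u_def GS)
      then show "g z = lam * G n z - T (G n) z"
        using lam unfolding g_def by (simp add: right_diff_distrib mult.assoc[symmetric])
    qed
    then have "S g = G n" using S GA unfolding is_resolvent_def by blast
    then have "snorm (G n) \<le> CS * snorm g" using op_le[OF CS gA] by simp
    also have "snorm g \<le> L * (r n + snorm (u n))"
    proof (rule snorm_le)
      fix z assume z: "z \<in> cD"
      have "cmod (d n z - u n z) \<le> r n + snorm (u n)"
        using dz[of n z] AD_le_snorm[OF uA z, of n] norm_triangle_ineq4[of "d n z" "u n z"] by linarith
      then have "L * cmod (d n z - u n z) \<le> L * (r n + snorm (u n))" using L by (intro mult_left_mono) auto
      then show "cmod (g z) \<le> L * (r n + snorm (u n))" by (simp add: g_def norm_mult L_def)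
    qed
    finally show ?thesis using op_const_nonneg[OF CS] by (simp add: mult_left_mono)
  qed
  have fiv: "f x = 0" if x: "x \<in> iv" for x
  proof -
    have "cmod (f x) \<le> CS * (L * (r n + snorm (u n))) + s n" for n
    proof -
      have "f x = G n (of_real x) + En n x" using Geq[OF x] by simp
      then have "cmod (f x) \<le> cmod (G n (of_real x)) + cmod (En n x)" by (metis norm_triangle_ineq)
      then show ?thesis using AD_le_snorm[OF GA iv_in_cD[OF x], of n] GN[of n] Ele[OF x, of n] by linarith
    qed
    moreover have "(\<lambda>n. CS * (L * (r n + snorm (u n))) + s n) \<longlonglongrightarrow> CS * (L * (0 + 0)) + 0"
      by (intro tendsto_add tendsto_mult tendsto_const r0 u0 s0)
    ultimately have "cmod (f x) \<le> CS * (L * (0 + 0)) + 0" by (intro LIMSEQ_le_const) auto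
    then show ?thesis by simp
  qed
  have L0: "L_op \<alpha> \<beta> (\<lambda>z. 0) z = 0" for z
    by (simp add: L_op_def Let_def vderiv_zero)
  \<comment> \<open>Locality and f = M f carry the vanishing from \<open>iv\<close> first to all z >
    -1/2 and then to the half-line, the two stages of \<open>extend_solution\<close>.\<close>
  have f1: "f z = 0" if z: "z > -1/2" for z
  proof -
    have "L_op \<alpha> \<beta> f z = L_op \<alpha> \<beta> (\<lambda>z. 0) z"
      by (rule L_op_cong[of "1/2" "5/2"]) (use fiv z one_over_lt[OF z] in auto)
    then show ?thesis using feq[of z] z L0 by simp
  qed
  have "f z = 0" for z
  proof (cases "z > -1")
    case True
    have "0 < 1 / (1 + z)" using True by simp
    then have "0 < 1 / (1 + z) + 1" by linarith
    then have "L_op \<alpha> \<beta> f z = L_op \<alpha> \<beta> (\<lambda>z. 0) z"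
      by (rule L_op_cong[rotated, where \<epsilon> = "1/2"]) (use f1 True in auto)
    then show ?thesis using feq[OF True] L0 by simp
  next
    case False then show ?thesis using f by (auto simp: C_alpha_def)
  qed
  then show ?thesis by auto
qed

lemma A_map_diff:
  assumes f: "f \<in> C_alpha \<alpha>" and g: "g \<in> C_alpha \<alpha>"
  shows "(\<lambda>x. f x - g x) \<in> C_alpha \<alpha>" "A_map lam \<beta> \<alpha> (\<lambda>x. f x - g x) = (\<lambda>x. A_map lam \<beta> \<alpha> f x - A_map lam \<beta> \<alpha> g x)"
proof -
  show "(\<lambda>x. f x - g x) \<in> C_alpha \<alpha>"
  proof (rule C_alphaI)
    show "f x - g x = 0" if "\<not> x > -1" for x using f g that by (auto simp: C_alpha_def)
    fix a b :: real assume ab: "-1 < a" "a < b"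
    obtain B B' where "C_bound deg hexp B {a<..<b} False f" "C_bound deg hexp B' {a<..<b} False g"
      using C_alpha_C_bound[OF f ab(1)] C_alpha_C_bound[OF g ab(1)] by metis
    from C_bound_diff[OF this] show "\<exists>B. C_bound deg hexp B {a<..<b} False (\<lambda>x. f x - g x)" by blast
  qed
  have "L_op \<alpha> \<beta> (\<lambda>x. f x - g x) z = L_op \<alpha> \<beta> f z - L_op \<alpha> \<beta> g z" for z
  proof (cases "z > -1")
    case True
    define c where "c = 1 / (1 + z) + 1"
    have "0 < 1 / (1 + z)" using True by simp
    then have c: "c > 0" "1 / (1 + z) < c" unfolding c_def by linarith+
    obtain B where B: "C_bound deg hexp B {-(1/2)<..<c} False f" using C_alpha_C_bound[OF f, of "-(1/2)"] by auto
    obtain B' where B': "C_bound deg hexp B' {-(1/2)<..<c} False g" using C_alpha_C_bound[OF g, of "-(1/2)"] by auto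
    show ?thesis using L_op_lincomb[OF _ c(1) B B' True c(2), of "-1"] by simp
  qed (simp add: L_op_out)
  then show "A_map lam \<beta> \<alpha> (\<lambda>x. f x - g x) = (\<lambda>x. A_map lam \<beta> \<alpha> f x - A_map lam \<beta> \<alpha> g x)"
    by (simp add: A_map_def fun_eq_iff right_diff_distrib)
qed

text \<open>The eigenfunction restricts to a solution on \<open>iv\<close> and extends to the
  half-line; it stays nonzero because a disc function vanishing on \<open>iv\<close> is 0.\<close>

lemma kernel_nontrivial:
  assumes "lam \<in> op_spectrum disc_D T"
  obtains f where "f \<in> C_alpha \<alpha>" "A_map lam \<beta> \<alpha> f = (\<lambda>z. 0)" "f \<noteq> (\<lambda>z. 0)"
proof -
  obtain h where h: "h \<in> AD" "h \<noteq> (\<lambda>z. 0)" "\<And>z. T h z = lam * h z" using spectrum_eigenfunction[OF lam assms] by blast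
  obtain Bh where hB: "C_bound deg hexp Bh {-(1/4)<..<9/4} False (\<lambda>x. h (of_real x))" using AD_C_bound[OF h(1)] .
  have z0: "(\<lambda>z. 0) \<in> C_alpha \<alpha>"
  proof (rule C_alphaI)
    fix a b :: real
    show "\<exists>B. C_bound deg hexp B {a<..<b} False (\<lambda>z. 0)"
      using C_bound_holomorphic[of UNIV "\<lambda>z. 0" a b hexp deg] deg_hexp by auto
  qed simp
  have "h (of_real x) = 0 + inverse lam * L_op \<alpha> \<beta> (\<lambda>x. h (of_real x)) x" if "x \<in> iv" for x
    using L_op_eq_T[OF h(1) _ that, of "\<lambda>x. h (of_real x)"] h(3)[of "of_real x"] lam by simp
  from extend_solution[OF z0 hB this] obtain F where F: "F \<in> C_alpha \<alpha>" "A_map lam \<beta> \<alpha> F = (\<lambda>z. 0)" "\<And>x. x \<in> iv \<Longrightarrow> F x = h (of_real x)"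
    by blast
  have "F \<noteq> (\<lambda>z. 0)" using AD_eq_zeroI[OF h(1)] F(3) h(2) by force
  then show ?thesis using that F by blast
qed

text \<open>The equation f - M f = q is treated in the whole of C^\<alpha>; a solution lies in
  \<open>FE\<close> exactly when q is periodic, and in particular the kernel of 1 - M is contained
  in \<open>FE\<close>.\<close>

lemma A_map_bij_iff:
  "A_map lam \<beta> \<alpha> \<in> FE lam \<beta> \<alpha> \<rightarrow> C_alpha_per \<alpha> \<and>
    (bij_betw (A_map lam \<beta> \<alpha>) (FE lam \<beta> \<alpha>) (C_alpha_per \<alpha>) \<longleftrightarrow> lam \<notin> op_spectrum disc_D T)"
proof (intro conjI iffI)
  have FEC: "f \<in> C_alpha \<alpha>" if "f \<in> FE lam \<beta> \<alpha>" for f using that by (simp add: FE_def)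
  show maps: "A_map lam \<beta> \<alpha> \<in> FE lam \<beta> \<alpha> \<rightarrow> C_alpha_per \<alpha>"
    using FE_iff_A_map_periodic[OF FEC lam] by blast
  {
    assume bij: "bij_betw (A_map lam \<beta> \<alpha>) (FE lam \<beta> \<alpha>) (C_alpha_per \<alpha>)"
    show "lam \<notin> op_spectrum disc_D T"
    proof
      assume "lam \<in> op_spectrum disc_D T"
      then obtain f where f: "f \<in> C_alpha \<alpha>" "A_map lam \<beta> \<alpha> f = (\<lambda>z. 0)" "f \<noteq> (\<lambda>z. 0)" by (rule kernel_nontrivial)
      have z0: "(\<lambda>z. 0) \<in> C_alpha \<alpha>" using A_map_diff(1)[OF f(1) f(1)] by simp
      then have zp: "(\<lambda>z. 0) \<in> C_alpha_per \<alpha>" by (simp add: C_alpha_per_def)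
      have A0: "A_map lam \<beta> \<alpha> (\<lambda>z. 0) = (\<lambda>z. 0)" using A_map_diff(2)[OF f(1) f(1)] by simp
      have "f \<in> FE lam \<beta> \<alpha>" "(\<lambda>z. 0) \<in> FE lam \<beta> \<alpha>"
        using FE_iff_A_map_periodic[OF f(1) lam] FE_iff_A_map_periodic[OF z0 lam] f(2) A0 zp by auto
      then have "f = (\<lambda>z. 0)" using bij_betw_imp_inj_on[OF bij] f(2) A0 by (metis inj_onD)
      then show False using f(3) by simp
    qed
  next
    assume "lam \<notin> op_spectrum disc_D T"
    then obtain S where S: "is_resolvent T lam S" by (auto simp: op_spectrum_iff)
    have "inj_on (A_map lam \<beta> \<alpha>) (FE lam \<beta> \<alpha>)"
    proof (rule inj_onI)
      fix f g assume fg: "f \<in> FE lam \<beta> \<alpha>" "g \<in> FE lam \<beta> \<alpha>" "A_map lam \<beta> \<alpha> f = A_map lam \<beta> \<alpha> g"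
      have "(\<lambda>x. f x - g x) = (\<lambda>x. 0)"
        by (rule solution_unique[OF S A_map_diff(1)[OF FEC[OF fg(1)] FEC[OF fg(2)]]])
           (simp add: A_map_diff(2)[OF FEC[OF fg(1)] FEC[OF fg(2)]] fg(3))
      then show "f = g" by (simp add: fun_eq_iff)
    qed
    moreover have "A_map lam \<beta> \<alpha> ` FE lam \<beta> \<alpha> = C_alpha_per \<alpha>"
    proof (rule antisym)
      show "A_map lam \<beta> \<alpha> ` FE lam \<beta> \<alpha> \<subseteq> C_alpha_per \<alpha>" using maps by auto
      show "C_alpha_per \<alpha> \<subseteq> A_map lam \<beta> \<alpha> ` FE lam \<beta> \<alpha>"
      proof
        fix q assume q: "q \<in> C_alpha_per \<alpha>"
        then have "q \<in> C_alpha \<alpha>" by (simp add: C_alpha_per_def)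
        then obtain f where f: "f \<in> C_alpha \<alpha>" "A_map lam \<beta> \<alpha> f = q" using solution_exists[OF S] by blast
        then have "f \<in> FE lam \<beta> \<alpha>" using FE_iff_A_map_periodic[OF f(1) lam] q by simp
        then show "q \<in> A_map lam \<beta> \<alpha> ` FE lam \<beta> \<alpha>" using f(2) by blast
      qed
    qed
    ultimately show "bij_betw (A_map lam \<beta> \<alpha>) (FE lam \<beta> \<alpha>) (C_alpha_per \<alpha>)" by (simp add: bij_betw_def)
  }
qed

end

theorem theorem4p4:
  fixes \<alpha> :: real and lam \<beta> :: complex
  assumes "\<alpha> > 0"
    and "lam \<noteq> 0"
    and "\<forall>j::nat. \<beta> \<noteq> (1 - of_nat j) / 2"
    and "Re \<beta> > (1 - \<alpha>) / 2"
    and "op_spectral_radius disc_D (transfer_op \<alpha> (of_real (Re \<beta> + \<alpha>))) < norm lam"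
  shows "A_map lam \<beta> \<alpha> \<in> FE lam \<beta> \<alpha> \<rightarrow> C_alpha_per \<alpha> \<and>
    (bij_betw (A_map lam \<beta> \<alpha>) (FE lam \<beta> \<alpha>) (C_alpha_per \<alpha>) \<longleftrightarrow>
      lam \<notin> op_spectrum disc_D (transfer_op \<alpha> \<beta>))"
proof -
  interpret transfer_main \<alpha> \<beta> lam
    using assms by unfold_locales auto
  show ?thesis using A_map_bij_iff unfolding T_def .
qed

end
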